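(* Let $n\ge 2$, $N=\mathbb{R}^n$, and let $F_t$ be a time-only dependent Finsler metric on $N$ satisfying the standing bounds given in the context. Let the initial region $A\subset N$ be either a compact embedded hypersurface of $N$ or a single point, and let $\mathcal{W}_t$ denote the wavefronts from $A$. If $A$ is strictly convex or a single point (resp. $A$ is convex), then the wavefront $\mathcal{W}_t$ is strictly convex (resp. convex) for all $t>0$.
   Context: Setting: $N=\mathbb{R}^n$ ($n\ge2$), spacetime $M=\mathbb{R}\times N$ with points $(t,x)$ and tangent vectors $\hat v=(v^0,v)$. All curves are regular and piecewise smooth unless otherwise stated. A time-dependent Finsler metric $F_t$ on $N$ is a function $F_t(v)\equiv F(t,x,v)\in[0,\infty)$ ($t\in\mathbb{R}$, $x\in N$, $v\in T_xN$), varying smoothly with $t$, continuous everywhere with $F_t(0)=0$, smooth away from the zero vector, positive for $v\ne0$, positively homogeneous of degree 1 in $v$ (not necessarily symmetric), and whose indicatrix $\Sigma_{(t,x)}=\{v\in T_xN:F_t(v)=1\}$ is strongly convex, i.e. the fundamental tensor $g^{F_t}_v(u,w)=\frac12\frac{\partial^2}{\partial\delta\,\partial\eta}F_t(v+\delta u+\eta w)^2|_{\delta=\eta=0}$ is positive definite for every $v\neq 0$. It is time-only dependent if $F(t,x,v)=F(t,v)$ does not depend on $x$. Standing assumption: $F_t$ is bounded above by some time-independent Finsler metric and bounded below by some time-independent complete Finsler metric (complete: every geodesic extends to all of $\mathbb{R}$). A vector $v\in T_xN\setminus\{0\}$ is $F_t$-orthogonal to a submanifold $S\ni x$ at time $t$,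 written $v\perp_{F_t}S$, if $g^{F_t}_v(v,u)=0$ for all $u\in T_xS$; if $S$ is a single point, every vector is orthogonal to it. The associated Lorentz-Finsler metric is $H(\hat v)=(v^0)^2-F_t(v)^2$. A curve $\hat\gamma(s)=(t(s),\gamma(s))$ is (future-directed) causal if $t'>0$ and $H(\hat\gamma')\ge0$ along it, and lightlike if $t'>0$ and $H(\hat\gamma')=0$. Geodesics of $H$ between two points of $M$ are the critical points of $\int_a^bH(\hat\gamma'(s))\,ds$ among curves with the same fixed endpoints; pregeodesics are curves that become geodesics after an orientation-preserving reparametrization. Wavemap from $A$: the map $f:[0,\infty)\times A\to N$ such that, for each $z_0\in A$, $t\mapsto(t,f(t,z_0))$ is the unique $t$-parametrized lightlike pregeodesic of $H$ with $f(0,z_0)=z_0$ and $\partial_tf(0,z_0)\perp_{F_0}A$ pointing outward from $A$. If $A$ is a single point, the parameter $z$ instead parametrizes the directions of $T_AN$ (one trajectory for each initial velocity in $\Sigma_{(0,A)}$). The curves $t\mapsto f(t,z)$ are the spatial trajectories. A spatial trajectory $t\mapsto f(t,z_0)$ is time-minimizing from $A$ at time $\tau>0$ if for every $t_0\in(0,\tau]$, any $t$-parametrized causal curve $(t,\varphi(t))$ with $\varphi(0)\in A$ and $\varphi(t_1)=f(t_0,z_0)$ satisfies $t_0\le t_1$. The wavefront at time $\tau>0$ is $\mathcal{W}_\tau=\{f(\tau,z): t\mapsto f(t,z)\text{ is time-minimizing at }\tau\}$, and $\mathcal{W}_0=A$. $A$ (when a hypersurface) or a wavefront $\mathcal{W}_t$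 is called convex (resp. strictly convex) if the region it encloses is convex (resp. strictly convex) as a subset of $\mathbb{R}^n$. *)

theory Defs
  imports "HOL-Analysis.Analysis"
begin

subsection \<open>Smoothness\<close>

text \<open>For open \<open>S\<close> this is the class \<open>C^k\<close>: the iterated directional derivatives up to order \<open>k\<close>
  are continuous on \<open>S\<close>.\<close>

fun higher_differentiable_on ::
  "'a::real_normed_vector set \<Rightarrow> ('a \<Rightarrow> 'b::real_normed_vector) \<Rightarrow> nat \<Rightarrow> bool" where
  "higher_differentiable_on S f 0 \<longleftrightarrow> continuous_on S f"
| "higher_differentiable_on S f (Suc k) \<longleftrightarrow>
     (\<forall>x\<in>S. f differentiable (at x)) \<and>
     (\<forall>v. higher_differentiable_on S (\<lambda>x. frechet_derivative f (at x) v) k)"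

definition smooth_on ::
  "'a::real_normed_vector set \<Rightarrow> ('a \<Rightarrow> 'b::real_normed_vector) \<Rightarrow> bool" where
  "smooth_on S f \<longleftrightarrow> (\<forall>k. higher_differentiable_on S f k)"

text \<open>Curves on an interval that may contain its endpoints, where derivatives are one-sided;
  \<open>D k\<close> is the derivative of order \<open>k\<close>.\<close>

definition smooth_curve_on :: "real set \<Rightarrow> (real \<Rightarrow> 'a::real_normed_vector) \<Rightarrow> bool" where
  "smooth_curve_on I \<gamma> \<longleftrightarrow>
     (\<exists>D. D 0 = \<gamma> \<and>
          (\<forall>k. \<forall>s\<in>I. (D k has_vector_derivative D (Suc k) s) (at s within I)))"

definition piecewise_smooth_on :: "real set \<Rightarrow> (real \<Rightarrow> 'a::real_normed_vector) \<Rightarrow> bool" where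
  "piecewise_smooth_on I \<gamma> \<longleftrightarrow>
     (\<forall>a b. a < b \<and> {a..b} \<subseteq> I \<longrightarrow>
        continuous_on {a..b} \<gamma> \<and>
        (\<exists>P. finite P \<and>
          (\<forall>c d. a \<le> c \<and> c < d \<and> d \<le> b \<and> {c<..<d} \<inter> P = {} \<longrightarrow> smooth_curve_on {c..d} \<gamma>)))"

text \<open>Left and right velocities of a curve on an interval \<open>I\<close>. They coincide away from the break
  points; at an endpoint of \<open>I\<close> only the one from within \<open>I\<close> is considered.\<close>

definition one_sided_velocity ::
  "real set \<Rightarrow> (real \<Rightarrow> 'a::real_normed_vector) \<Rightarrow> real \<Rightarrow> 'a \<Rightarrow> bool" where
  "one_sided_velocity I \<gamma> s v \<longleftrightarrow>
     (\<exists>r\<in>I. s < r \<and> (\<gamma> has_vector_derivative v) (at s within {s..r})) \<or>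
     (\<exists>r\<in>I. r < s \<and> (\<gamma> has_vector_derivative v) (at s within {r..s}))"

definition regular_curve_on :: "real set \<Rightarrow> (real \<Rightarrow> 'a::real_normed_vector) \<Rightarrow> bool" where
  "regular_curve_on I \<gamma> \<longleftrightarrow>
     piecewise_smooth_on I \<gamma> \<and> (\<forall>s\<in>I. \<forall>v. one_sided_velocity I \<gamma> s v \<longrightarrow> v \<noteq> 0)"

subsection \<open>Geodesics as critical curves\<close>

text \<open>Throughout, \<open>L x v\<close> is a Lagrangian evaluated at the tangent vector \<open>v\<close> at \<open>x\<close>. The velocity
  in the integrand is undefined at finitely many break points only, which the integral ignores.\<close>

definition action ::
  "('a::euclidean_space \<Rightarrow> 'a \<Rightarrow> real) \<Rightarrow> real \<Rightarrow> real \<Rightarrow> (real \<Rightarrow> 'a) \<Rightarrow> real" where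
  "action L a b \<gamma> = integral {a..b} (\<lambda>s. L (\<gamma> s) (vector_derivative \<gamma> (at s within {a..b})))"

text \<open>The curves with given endpoints form an affine space, so criticality is the vanishing of the
  directional derivatives along all piecewise smooth fields \<open>w\<close> vanishing at the endpoints
  (the curves \<open>\<gamma> + \<epsilon> w\<close> remain regular for small \<open>\<epsilon>\<close>).\<close>

definition critical_curve ::
  "('a::euclidean_space \<Rightarrow> 'a \<Rightarrow> real) \<Rightarrow> real \<Rightarrow> real \<Rightarrow> (real \<Rightarrow> 'a) \<Rightarrow> bool" where
  "critical_curve L a b \<gamma> \<longleftrightarrow>
     (\<forall>w. piecewise_smooth_on {a..b} w \<and> w a = 0 \<and> w b = 0 \<longrightarrow>
        ((\<lambda>\<epsilon>. action L a b (\<lambda>s. \<gamma> s + \<epsilon> *\<^sub>R w s)) has_real_derivative 0) (at 0))"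

definition geodesic_on ::
  "('a::euclidean_space \<Rightarrow> 'a \<Rightarrow> real) \<Rightarrow> real set \<Rightarrow> (real \<Rightarrow> 'a) \<Rightarrow> bool" where
  "geodesic_on L I \<gamma> \<longleftrightarrow>
     regular_curve_on I \<gamma> \<and> (\<forall>a b. a < b \<and> {a..b} \<subseteq> I \<longrightarrow> critical_curve L a b \<gamma>)"

definition pregeodesic_on ::
  "('a::euclidean_space \<Rightarrow> 'a \<Rightarrow> real) \<Rightarrow> real set \<Rightarrow> (real \<Rightarrow> 'a) \<Rightarrow> bool" where
  "pregeodesic_on L I \<gamma> \<longleftrightarrow>
     regular_curve_on I \<gamma> \<and>
     (\<exists>J h. is_interval J \<and> h ` J = I \<and> piecewise_smooth_on J h \<and>
        (\<forall>s\<in>J. \<forall>v. one_sided_velocity J h s v \<longrightarrow> v > 0) \<and>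
        geodesic_on L J (\<gamma> \<circ> h))"

subsection \<open>Finsler metrics\<close>

text \<open>A time-dependent metric is written \<open>F t x v\<close>, a time-independent one \<open>G x v\<close>.\<close>

definition fundamental_tensor :: "('a::real_vector \<Rightarrow> real) \<Rightarrow> 'a \<Rightarrow> 'a \<Rightarrow> 'a \<Rightarrow> real" where
  "fundamental_tensor \<Phi> v u w =
     1/2 * deriv (\<lambda>\<delta>. deriv (\<lambda>\<eta>. (\<Phi> (v + \<delta> *\<^sub>R u + \<eta> *\<^sub>R w))\<^sup>2) 0) 0"

definition time_dependent_finsler_metric ::
  "(real \<Rightarrow> 'a::euclidean_space \<Rightarrow> 'a \<Rightarrow> real) \<Rightarrow> bool" where
  "time_dependent_finsler_metric F \<longleftrightarrow>
     continuous_on UNIV (\<lambda>(t, x, v). F t x v) \<and>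
     smooth_on {(t, x, v). v \<noteq> 0} (\<lambda>(t, x, v). F t x v) \<and>
     (\<forall>t x. F t x 0 = 0) \<and>
     (\<forall>t x v. v \<noteq> 0 \<longrightarrow> F t x v > 0) \<and>
     (\<forall>t x v c. c > 0 \<longrightarrow> F t x (c *\<^sub>R v) = c * F t x v) \<and>
     (\<forall>t x v u. v \<noteq> 0 \<and> u \<noteq> 0 \<longrightarrow> fundamental_tensor (F t x) v u u > 0)"

definition finsler_metric :: "('a::euclidean_space \<Rightarrow> 'a \<Rightarrow> real) \<Rightarrow> bool" where
  "finsler_metric G \<longleftrightarrow> time_dependent_finsler_metric (\<lambda>t. G)"

definition time_only_dependent :: "(real \<Rightarrow> 'a \<Rightarrow> 'a \<Rightarrow> real) \<Rightarrow> bool" where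
  "time_only_dependent F \<longleftrightarrow> (\<forall>t x y v. F t x v = F t y v)"

text \<open>Geodesics of a Finsler metric are the critical curves of its energy.\<close>

definition complete_finsler_metric :: "('a::euclidean_space \<Rightarrow> 'a \<Rightarrow> real) \<Rightarrow> bool" where
  "complete_finsler_metric G \<longleftrightarrow>
     finsler_metric G \<and>
     (\<forall>I \<gamma>. is_interval I \<and> interior I \<noteq> {} \<and> geodesic_on (\<lambda>x v. (G x v)\<^sup>2) I \<gamma> \<longrightarrow>
        (\<exists>\<gamma>'. geodesic_on (\<lambda>x v. (G x v)\<^sup>2) UNIV \<gamma>' \<and> (\<forall>s\<in>I. \<gamma>' s = \<gamma> s)))"

definition standing_bounds :: "(real \<Rightarrow> 'a::euclidean_space \<Rightarrow> 'a \<Rightarrow> real) \<Rightarrow> bool" where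
  "standing_bounds F \<longleftrightarrow>
     (\<exists>G. finsler_metric G \<and> (\<forall>t x v. F t x v \<le> G x v)) \<and>
     (\<exists>G. complete_finsler_metric G \<and> (\<forall>t x v. G x v \<le> F t x v))"

subsection \<open>Hypersurfaces and the regions they enclose\<close>

definition embedded_hypersurface :: "'a::euclidean_space set \<Rightarrow> bool" where
  "embedded_hypersurface S \<longleftrightarrow>
     (\<forall>p\<in>S. \<exists>U \<phi>. open U \<and> p \<in> U \<and> smooth_on U (\<phi> :: 'a \<Rightarrow> real) \<and>
        (\<forall>x\<in>U. frechet_derivative \<phi> (at x) \<noteq> (\<lambda>u. 0)) \<and>
        S \<inter> U = {x \<in> U. \<phi> x = 0})"

definition tangent_vectors :: "'a::euclidean_space set \<Rightarrow> 'a \<Rightarrow> 'a set" where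
  "tangent_vectors S x =
     {u. \<exists>c e. e > 0 \<and> smooth_curve_on {-e<..<e} c \<and> c ` {-e<..<e} \<subseteq> S \<and> c 0 = x \<and>
        (c has_vector_derivative u) (at 0)}"

text \<open>For \<open>S = {x}\<close> the only tangent vector is \<open>0\<close>, so every nonzero \<open>v\<close> is orthogonal to \<open>S\<close>.\<close>

definition finsler_orthogonal ::
  "('a::euclidean_space \<Rightarrow> 'a \<Rightarrow> real) \<Rightarrow> 'a set \<Rightarrow> 'a \<Rightarrow> 'a \<Rightarrow> bool" where
  "finsler_orthogonal G S x v \<longleftrightarrow>
     v \<noteq> 0 \<and> (\<forall>u\<in>tangent_vectors S x. fundamental_tensor (G x) v v u = 0)"

definition points_outward :: "'a::euclidean_space set \<Rightarrow> 'a \<Rightarrow> 'a \<Rightarrow> bool" where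
  "points_outward S x v \<longleftrightarrow> (\<forall>\<^sub>F \<epsilon> in at_right 0. x + \<epsilon> *\<^sub>R v \<in> outside S)"

text \<open>The closed region: \<open>S\<close> together with the bounded components of its complement.\<close>

definition enclosed_region :: "'a::euclidean_space set \<Rightarrow> 'a set" where
  "enclosed_region S = S \<union> inside S"

definition strictly_convex :: "'a::euclidean_space set \<Rightarrow> bool" where
  "strictly_convex K \<longleftrightarrow> (\<forall>x\<in>K. \<forall>y\<in>K. x \<noteq> y \<longrightarrow> open_segment x y \<subseteq> interior K)"

definition convex_front :: "'a::euclidean_space set \<Rightarrow> bool" where
  "convex_front S \<longleftrightarrow> convex (enclosed_region S)"

definition strictly_convex_front :: "'a::euclidean_space set \<Rightarrow> bool" where
  "strictly_convex_front S \<longleftrightarrow> strictly_convex (enclosed_region S)"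

subsection \<open>The Lorentz-Finsler metric, the wavemap and the wavefronts\<close>

definition lorentz_finsler ::
  "(real \<Rightarrow> 'a::euclidean_space \<Rightarrow> 'a \<Rightarrow> real) \<Rightarrow> real \<times> 'a \<Rightarrow> real \<times> 'a \<Rightarrow> real" where
  "lorentz_finsler F p V = (fst V)\<^sup>2 - (F (fst p) (snd p) (snd V))\<^sup>2"

definition causal_curve_on ::
  "(real \<Rightarrow> 'a::euclidean_space \<Rightarrow> 'a \<Rightarrow> real) \<Rightarrow> real set \<Rightarrow> (real \<Rightarrow> real \<times> 'a) \<Rightarrow> bool" where
  "causal_curve_on F I \<gamma> \<longleftrightarrow>
     regular_curve_on I \<gamma> \<and>
     (\<forall>s\<in>I. \<forall>V. one_sided_velocity I \<gamma> s V \<longrightarrow> fst V > 0 \<and> lorentz_finsler F (\<gamma> s) V \<ge> 0)"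

definition lightlike_curve_on ::
  "(real \<Rightarrow> 'a::euclidean_space \<Rightarrow> 'a \<Rightarrow> real) \<Rightarrow> real set \<Rightarrow> (real \<Rightarrow> real \<times> 'a) \<Rightarrow> bool" where
  "lightlike_curve_on F I \<gamma> \<longleftrightarrow>
     regular_curve_on I \<gamma> \<and>
     (\<forall>s\<in>I. \<forall>V. one_sided_velocity I \<gamma> s V \<longrightarrow> fst V > 0 \<and> lorentz_finsler F (\<gamma> s) V = 0)"

text \<open>\<open>c\<close> is the trajectory on \<open>[0,\<infinity>)\<close> with parameter \<open>z\<close>. For a single point \<open>A = {p}\<close> the parameter is
  the initial velocity (which lies in the indicatrix at \<open>(0,p)\<close> because \<open>c\<close> is lightlike), otherwise
  it is the initial point.\<close>

definition wave_trajectory ::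
  "(real \<Rightarrow> 'a::euclidean_space \<Rightarrow> 'a \<Rightarrow> real) \<Rightarrow> 'a set \<Rightarrow> 'a \<Rightarrow> (real \<Rightarrow> 'a) \<Rightarrow> bool" where
  "wave_trajectory F A z c \<longleftrightarrow>
     lightlike_curve_on F {0..} (\<lambda>t. (t, c t)) \<and>
     pregeodesic_on (lorentz_finsler F) {0..} (\<lambda>t. (t, c t)) \<and>
     c 0 \<in> A \<and>
     (\<exists>v. (c has_vector_derivative v) (at 0 within {0..}) \<and>
        finsler_orthogonal (F 0) A (c 0) v \<and> points_outward A (c 0) v \<and>
        z = (if \<exists>p. A = {p} then v else c 0))"

text \<open>Points of a disconnected hypersurface that do not border the outer component of the complement
  have no outward vector and hence carry no trajectory.\<close>

definition wave_parameters ::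
  "(real \<Rightarrow> 'a::euclidean_space \<Rightarrow> 'a \<Rightarrow> real) \<Rightarrow> 'a set \<Rightarrow> 'a set" where
  "wave_parameters F A = {z. \<exists>c. wave_trajectory F A z c}"

definition wavemap ::
  "(real \<Rightarrow> 'a::euclidean_space \<Rightarrow> 'a \<Rightarrow> real) \<Rightarrow> 'a set \<Rightarrow> real \<Rightarrow> 'a \<Rightarrow> 'a" where
  "wavemap F A t z = (THE y. \<exists>c. wave_trajectory F A z c \<and> y = c t)"

definition time_minimizing ::
  "(real \<Rightarrow> 'a::euclidean_space \<Rightarrow> 'a \<Rightarrow> real) \<Rightarrow> 'a set \<Rightarrow> (real \<Rightarrow> 'a) \<Rightarrow> real \<Rightarrow> bool" where
  "time_minimizing F A c \<tau> \<longleftrightarrow>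
     (\<forall>t\<^sub>0 t\<^sub>1 \<phi>. 0 < t\<^sub>0 \<and> t\<^sub>0 \<le> \<tau> \<and> 0 < t\<^sub>1 \<and> causal_curve_on F {0..t\<^sub>1} (\<lambda>t. (t, \<phi> t)) \<and>
        \<phi> 0 \<in> A \<and> \<phi> t\<^sub>1 = c t\<^sub>0 \<longrightarrow> t\<^sub>0 \<le> t\<^sub>1)"

definition wavefront ::
  "(real \<Rightarrow> 'a::euclidean_space \<Rightarrow> 'a \<Rightarrow> real) \<Rightarrow> 'a set \<Rightarrow> real \<Rightarrow> 'a set" where
  "wavefront F A \<tau> =
     (if \<tau> = 0 then A
      else {wavemap F A \<tau> z | z.
              z \<in> wave_parameters F A \<and> time_minimizing F A (\<lambda>t. wavemap F A t z) \<tau>})"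

end

theory Submission
  imports Defs
begin

text \<open>Since the metric does not depend on the position, the spatial momentum of a geodesic of the
  Lorentz-Finsler metric is a constant covector \<open>\<xi>\<close>. A lightlike trajectory from \<open>x\<close> is therefore
  \<open>x + disp t \<xi>\<close>, where \<open>disp t \<xi>\<close> integrates over time the point of the indicatrix with outer normal \<open>\<xi>\<close>,
  and orthogonality to the source means that \<open>\<xi>\<close> supports the enclosed region \<open>K\<close> at \<open>x\<close>.
  On a causal curve the functional \<open>\<xi>\<close> grows by at most \<open>\<xi> \<bullet> disp t \<xi>\<close> up to time \<open>t\<close>, so every trajectory is
  time-minimizing. Hence the wavefront is the boundary of the Minkowski sum of \<open>K\<close> and the convex body \<open>D\<close>
  with support function \<open>\<xi> \<mapsto> \<xi> \<bullet> disp t \<xi>\<close>. This support function is differentiable away from \<open>0\<close>, so \<open>D\<close> is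
  strictly convex, and the sum inherits strict convexity from \<open>K\<close>.\<close>

subsection \<open>Smooth functions\<close>

text \<open>Geodesics are defined variationally, among curves that may have corners, and curves must
  be smooth to every order up to the initial time. Two consequences shape the proof. To describe all
  trajectories, corners rule out a pointwise Euler-Lagrange equation, so constancy of the momentum
  is obtained in integrated form (du Bois-Reymond). The lightlike condition then recovers the
  velocity: the direction of \<open>\<xi>\<close> selects a point of the indicatrix, and its length
  only reflects the parametrization. To show that the rays are trajectories, they must be smooth
  although \<open>ind\<close> comes from inverting the Legendre transform. The inverse is first
  shown to be differentiable and is then recognized as an integral curve of an explicit smooth
  vector field, which yields all higher derivatives; the same device produces the tangent curves of
  a hypersurface. Finally, \<open>wavemap\<close> is a definite description, so the initial data
  must fix the momentum up to a positive factor. For a hypersurface this means a unique outer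
  normal, including its sign, and excluding flat regions is where the dimension enters.\<close>

lemma higher_differentiable_on_cong:
  assumes "open S" "\<And>x. x \<in> S \<Longrightarrow> f x = g x" "higher_differentiable_on S f k"
  shows "higher_differentiable_on S g k"
  using assms(2,3)
proof (induction k arbitrary: f g)
  case 0
  then show ?case by (simp cong: continuous_on_cong)
next
  case (Suc k)
  have der: "(g has_derivative frechet_derivative f (at x)) (at x)" if "x \<in> S" for x
  proof (rule has_derivative_transform_within_open[OF _ assms(1) that])
    show "(f has_derivative frechet_derivative f (at x)) (at x)"
      using Suc.prems(2) that frechet_derivative_works by auto
  qed (use Suc.prems in auto)
  have eq: "frechet_derivative f (at x) = frechet_derivative g (at x)" if "x \<in> S" for x
    using frechet_derivative_at[OF der[OF that]] .
  have "higher_differentiable_on S (\<lambda>x. frechet_derivative g (at x) v) k" for v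
    by (rule Suc.IH[of "\<lambda>x. frechet_derivative f (at x) v"]) (use eq Suc.prems in auto)
  then show ?case using der by (auto simp: differentiable_def)
qed

text \<open>\<open>frechet_derivative\<close> is a choice operator. The closure proofs go through
  this rule, which accepts an explicit formula for the derivative and identifies it by uniqueness on
  the open set.\<close>

lemma higher_differentiable_on_SucI:
  assumes "open S" and der: "\<And>x. x \<in> S \<Longrightarrow> (f has_derivative f' x) (at x)"
    and "\<And>v. higher_differentiable_on S (\<lambda>x. f' x v) k"
  shows "higher_differentiable_on S f (Suc k)"
proof -
  have eq: "f' x = frechet_derivative f (at x)" if "x \<in> S" for x
    using frechet_derivative_at[OF der[OF that]] .
  have "higher_differentiable_on S (\<lambda>x. frechet_derivative f (at x) v) k" for v
    by (rule higher_differentiable_on_cong[OF assms(1) _ assms(3)[of v]]) (simp add: eq)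
  then show ?thesis using der by (auto simp: differentiable_def)
qed

lemma higher_differentiable_on_SucD:
  "higher_differentiable_on S f (Suc k) \<Longrightarrow> higher_differentiable_on S f k"
proof (induction k arbitrary: f)
  case 0
  then show ?case
    by (auto intro!: continuous_at_imp_continuous_on differentiable_imp_continuous_within)
qed auto

lemma higher_differentiable_on_has_derivative:
  "higher_differentiable_on S f (Suc k) \<Longrightarrow> x \<in> S \<Longrightarrow>
    (f has_derivative frechet_derivative f (at x)) (at x)"
  using frechet_derivative_works by auto

lemma higher_differentiable_on_derivative:
  "higher_differentiable_on S f (Suc k) \<Longrightarrow>
    higher_differentiable_on S (\<lambda>x. frechet_derivative f (at x) v) k"
  by simp

lemmas higher_differentiable_on_SucE = higher_differentiable_on_has_derivative
  higher_differentiable_on_derivative higher_differentiable_on_SucD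

lemma higher_differentiable_on_subset:
  "higher_differentiable_on T f k \<Longrightarrow> S \<subseteq> T \<Longrightarrow> higher_differentiable_on S f k"
  by (induction k arbitrary: f) (auto intro: continuous_on_subset)

lemma higher_differentiable_on_const:
  "open S \<Longrightarrow> higher_differentiable_on S (\<lambda>x. c) k"
proof (induction k arbitrary: c)
  case (Suc k)
  show ?case
    by (rule higher_differentiable_on_SucI[where f' = "\<lambda>x v. 0"]) (auto intro: Suc derivative_intros)
qed simp

lemma higher_differentiable_on_add:
  assumes "open S" "higher_differentiable_on S f k" "higher_differentiable_on S g k"
  shows "higher_differentiable_on S (\<lambda>x. f x + g x) k"
  using assms(2,3)
proof (induction k arbitrary: f g)
  case (Suc k)
  show ?case
    by (rule higher_differentiable_on_SucI[OF assms(1) has_derivative_add])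
      (rule Suc.prems Suc.IH higher_differentiable_on_SucE | assumption)+
qed (auto intro: continuous_intros)

lemma higher_differentiable_on_linear_image:
  assumes "open S" "bounded_linear L" "higher_differentiable_on S f k"
  shows "higher_differentiable_on S (\<lambda>x. L (f x)) k"
  using assms(3)
proof (induction k arbitrary: f)
  case 0
  then show ?case using bounded_linear.continuous_on[OF assms(2)] by simp
next
  case (Suc k)
  show ?case
    by (rule higher_differentiable_on_SucI[OF assms(1) bounded_linear.has_derivative[OF assms(2)]])
      (rule Suc.prems Suc.IH higher_differentiable_on_SucE | assumption)+
qed

lemma higher_differentiable_on_compose_linear:
  assumes "open S" "bounded_linear L" "higher_differentiable_on T f k" "\<And>x. x \<in> S \<Longrightarrow> L x \<in> T"
  shows "higher_differentiable_on S (\<lambda>x. f (L x)) k"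
  using assms(3)
proof (induction k arbitrary: f)
  case 0
  then show ?case
    using continuous_on_compose2[of T f S L] assms linear_continuous_on[OF assms(2)]
    by auto
next
  case (Suc k)
  have "((\<lambda>x. f (L x)) has_derivative (\<lambda>v. frechet_derivative f (at (L x)) (L v))) (at x)"
    if "x \<in> S" for x
    by (rule has_derivative_compose[OF bounded_linear.has_derivative[OF assms(2) has_derivative_ident]])
      (use Suc.prems assms(4) that higher_differentiable_on_has_derivative in blast)
  then show ?case
    by (rule higher_differentiable_on_SucI[OF assms(1)]) (use Suc in auto)
qed

text \<open>One Leibniz rule serves multiplication and scaling alike. Its derivative pairs one
  factor with a derivative of the other, so the induction runs over all \<open>f\<close> and
  \<open>g\<close> at once.\<close>

lemma higher_differentiable_on_bilinear:
  assumes "open S" "bounded_bilinear B"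
    and "higher_differentiable_on S f k" "higher_differentiable_on S g k"
  shows "higher_differentiable_on S (\<lambda>x. B (f x) (g x)) k"
  using assms(3,4)
proof (induction k arbitrary: f g)
  case 0
  then show ?case using bounded_bilinear.continuous_on[OF assms(2)] by simp
next
  case (Suc k)
  show ?case
  proof (rule higher_differentiable_on_SucI[OF assms(1) bounded_bilinear.FDERIV[OF assms(2)]])
    fix x assume "x \<in> S"
    then show "(f has_derivative frechet_derivative f (at x)) (at x)"
      "(g has_derivative frechet_derivative g (at x)) (at x)"
      by (rule higher_differentiable_on_has_derivative[OF Suc.prems(1)]
          higher_differentiable_on_has_derivative[OF Suc.prems(2)])+
  next
    fix v
    show "higher_differentiable_on S (\<lambda>x. B (f x) (frechet_derivative g (at x) v) +
        B (frechet_derivative f (at x) v) (g x)) k"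
      by (rule Suc.prems higher_differentiable_on_add[OF assms(1)] Suc.IH
          higher_differentiable_on_derivative higher_differentiable_on_SucD)+
  qed
qed

lemma higher_differentiable_on_inverse:
  fixes f :: "'a::real_normed_vector \<Rightarrow> real"
  assumes "open S" "higher_differentiable_on S f k" "\<And>x. x \<in> S \<Longrightarrow> f x \<noteq> 0"
  shows "higher_differentiable_on S (\<lambda>x. inverse (f x)) k"
  using assms(2)
proof (induction k)
  case 0
  then show ?case using assms by (auto intro: continuous_intros)
next
  case (Suc k)
  show ?case
  proof (rule higher_differentiable_on_SucI[OF assms(1)])
    fix x assume "x \<in> S"
    then show "((\<lambda>x. inverse (f x)) has_derivative
        (\<lambda>v. (- 1) * (inverse (f x) * frechet_derivative f (at x) v * inverse (f x)))) (at x)"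
      using Deriv.has_derivative_inverse[OF assms(3) higher_differentiable_on_has_derivative[OF Suc.prems]] by simp
  next
    fix v
    \<comment> \<open>The derivative of the inverse contains the inverse itself, one order lower,
      which is what the induction hypothesis supplies.\<close>
    have "higher_differentiable_on S (\<lambda>x. inverse (f x)) k"
      using Suc.IH Suc.prems higher_differentiable_on_SucD by blast
    then show "higher_differentiable_on S
        (\<lambda>x. (- 1) * (inverse (f x) * frechet_derivative f (at x) v * inverse (f x))) k"
      by (intro higher_differentiable_on_bilinear[OF assms(1) bounded_bilinear_mult]
          higher_differentiable_on_const assms(1) higher_differentiable_on_derivative Suc.prems)
  qed
qed

section \<open>Closure properties of smooth functions, for all orders at once\<close>

lemma smooth_on_cong:
  "smooth_on S f \<Longrightarrow> open S \<Longrightarrow> (\<And>x. x \<in> S \<Longrightarrow> f x = g x) \<Longrightarrow> smooth_on S g"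
  unfolding smooth_on_def using higher_differentiable_on_cong by blast

lemma smooth_on_subset: "smooth_on T f \<Longrightarrow> S \<subseteq> T \<Longrightarrow> smooth_on S f"
  unfolding smooth_on_def using higher_differentiable_on_subset by blast

lemma smooth_on_imp_continuous_on: "smooth_on S f \<Longrightarrow> continuous_on S f"
  unfolding smooth_on_def using higher_differentiable_on.simps(1) by blast

lemma smooth_on_has_derivative:
  "smooth_on S f \<Longrightarrow> x \<in> S \<Longrightarrow> (f has_derivative frechet_derivative f (at x)) (at x)"
  unfolding smooth_on_def using higher_differentiable_on_has_derivative by blast

lemma smooth_on_derivative: "smooth_on S f \<Longrightarrow> smooth_on S (\<lambda>x. frechet_derivative f (at x) v)"
  unfolding smooth_on_def using higher_differentiable_on.simps(2) by blast

lemma smooth_on_const: "open S \<Longrightarrow> smooth_on S (\<lambda>x. c)"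
  unfolding smooth_on_def using higher_differentiable_on_const by blast

lemma smooth_on_add:
  "open S \<Longrightarrow> smooth_on S f \<Longrightarrow> smooth_on S g \<Longrightarrow> smooth_on S (\<lambda>x. f x + g x)"
  unfolding smooth_on_def using higher_differentiable_on_add by blast

lemma smooth_on_linear_image:
  "open S \<Longrightarrow> bounded_linear L \<Longrightarrow> smooth_on S f \<Longrightarrow> smooth_on S (\<lambda>x. L (f x))"
  unfolding smooth_on_def using higher_differentiable_on_linear_image by blast

lemma smooth_on_compose_linear:
  "open S \<Longrightarrow> bounded_linear L \<Longrightarrow> smooth_on T f \<Longrightarrow> (\<And>x. x \<in> S \<Longrightarrow> L x \<in> T) \<Longrightarrow>
    smooth_on S (\<lambda>x. f (L x))"
  unfolding smooth_on_def using higher_differentiable_on_compose_linear by blast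

lemma smooth_on_bilinear:
  "open S \<Longrightarrow> bounded_bilinear B \<Longrightarrow> smooth_on S f \<Longrightarrow> smooth_on S g \<Longrightarrow>
    smooth_on S (\<lambda>x. B (f x) (g x))"
  unfolding smooth_on_def using higher_differentiable_on_bilinear by blast

lemma smooth_on_inverse:
  fixes f :: "'a::real_normed_vector \<Rightarrow> real"
  shows "open S \<Longrightarrow> smooth_on S f \<Longrightarrow> (\<And>x. x \<in> S \<Longrightarrow> f x \<noteq> 0) \<Longrightarrow> smooth_on S (\<lambda>x. inverse (f x))"
  unfolding smooth_on_def using higher_differentiable_on_inverse by blast

lemmas smooth_on_mult = smooth_on_bilinear[OF _ bounded_bilinear_mult]
lemmas smooth_on_scaleR = smooth_on_bilinear[OF _ bounded_bilinear_scaleR]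

lemma smooth_on_divide:
  fixes f g :: "'a::real_normed_vector \<Rightarrow> real"
  shows "open S \<Longrightarrow> smooth_on S f \<Longrightarrow> smooth_on S g \<Longrightarrow> (\<And>x. x \<in> S \<Longrightarrow> g x \<noteq> 0) \<Longrightarrow>
    smooth_on S (\<lambda>x. f x / g x)"
  unfolding divide_inverse by (intro smooth_on_mult smooth_on_inverse)

lemma smooth_on_uminus: "open S \<Longrightarrow> smooth_on S f \<Longrightarrow> smooth_on S (\<lambda>x. - f x)"
  by (rule smooth_on_linear_image[where L = uminus, OF _ bounded_linear_minus[OF bounded_linear_ident]])

lemma smooth_on_linear: "open S \<Longrightarrow> bounded_linear L \<Longrightarrow> smooth_on S L"
proof -
  assume S: "open S" and L: "bounded_linear L"
  have "higher_differentiable_on S L k" for k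
  proof (cases k)
    case 0
    then show ?thesis using linear_continuous_on[OF L] by simp
  next
    case (Suc l)
    then show ?thesis
      using higher_differentiable_on_SucI[OF S bounded_linear_imp_has_derivative[OF L],
          OF higher_differentiable_on_const[OF S]] by simp
  qed
  then show ?thesis by (simp add: smooth_on_def)
qed

lemma smooth_on_sum:
  "open S \<Longrightarrow> (\<And>i. i \<in> I \<Longrightarrow> smooth_on S (f i)) \<Longrightarrow> smooth_on S (\<lambda>x. \<Sum>i\<in>I. f i x)"
  by (induction I rule: infinite_finite_induct) (auto intro: smooth_on_const smooth_on_add)

lemma smooth_on_prod:
  fixes f :: "'i \<Rightarrow> 'a::real_normed_vector \<Rightarrow> real"
  shows "open S \<Longrightarrow> (\<And>i. i \<in> I \<Longrightarrow> smooth_on S (f i)) \<Longrightarrow> smooth_on S (\<lambda>x. \<Prod>i\<in>I. f i x)"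
  by (induction I rule: infinite_finite_induct) (auto intro: smooth_on_const smooth_on_mult)

lemma smooth_on_Pair:
  assumes "open S" "smooth_on S f" "smooth_on S g"
  shows "smooth_on S (\<lambda>x. (f x, g x))"
proof -
  have "smooth_on S (\<lambda>x. (f x, 0) + (0, g x))"
    by (rule smooth_on_add[OF assms(1)
          smooth_on_linear_image[where L = "\<lambda>y. (y, 0)", OF assms(1) _ assms(2)]
          smooth_on_linear_image[where L = "\<lambda>y. (0, y)", OF assms(1) _ assms(3)]])
      (intro bounded_linear_Pair bounded_linear_ident bounded_linear_zero)+
  then show ?thesis by simp
qed

lemma smooth_on_vec_lambda:
  fixes f :: "'a::real_normed_vector \<Rightarrow> 'n::finite \<Rightarrow> real"
  assumes "open S" "\<And>i. smooth_on S (\<lambda>x. f x i)"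
  shows "smooth_on S (\<lambda>x. \<chi> i. f x i)"
proof -
  have "smooth_on S (\<lambda>x. \<Sum>i\<in>UNIV. f x i *\<^sub>R axis i (1::real))"
    using assms by (intro smooth_on_sum smooth_on_scaleR smooth_on_const)
  moreover have "(\<Sum>i\<in>UNIV. f x i *\<^sub>R axis i (1::real)) = (\<chi> i. f x i)" for x
    by (simp add: vec_eq_iff axis_def if_distrib cong: if_cong)
  ultimately show ?thesis by simp
qed

lemma smooth_on_det:
  fixes M :: "'a::real_normed_vector \<Rightarrow> real ^ 'n ^ 'n"
  assumes "open S" "\<And>i j. smooth_on S (\<lambda>x. M x $ i $ j)"
  shows "smooth_on S (\<lambda>x. det (M x))"
  unfolding det_def using assms
  by (intro smooth_on_sum smooth_on_mult smooth_on_prod smooth_on_const)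

text \<open>Smoothness is defined by derivatives in fixed directions, so the moving direction
  \<open>V x\<close> is expanded in the basis. This makes iterated Lie derivatives along
  \<open>V\<close> smooth.\<close>

lemma smooth_on_derivative_along:
  fixes f :: "'a::euclidean_space \<Rightarrow> 'b::real_normed_vector"
  assumes "open S" "smooth_on S f" "smooth_on S V"
  shows "smooth_on S (\<lambda>x. frechet_derivative f (at x) (V x))"
proof (rule smooth_on_cong)
  show "smooth_on S (\<lambda>x. \<Sum>b\<in>Basis. (V x \<bullet> b) *\<^sub>R frechet_derivative f (at x) b)"
    by (intro smooth_on_sum smooth_on_scaleR smooth_on_derivative assms
        smooth_on_linear_image[where L = "\<lambda>y. y \<bullet> b" for b] bounded_linear_inner_left)
  fix x assume "x \<in> S"
  then have "linear (frechet_derivative f (at x))"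
    using smooth_on_has_derivative[OF assms(2)] has_derivative_linear by blast
  then show "(\<Sum>b\<in>Basis. (V x \<bullet> b) *\<^sub>R frechet_derivative f (at x) b) =
      frechet_derivative f (at x) (V x)"
    using linear_sum[of "frechet_derivative f (at x)" "\<lambda>b. (V x \<bullet> b) *\<^sub>R b" Basis]
    by (simp add: linear_scale euclidean_representation)
qed (use assms in auto)

text \<open>The derivatives of an integral curve of \<open>V\<close> are the iterated Lie derivatives of the identity
  along \<open>V\<close>, evaluated on the curve.\<close>

lemma integral_curve_smooth:
  fixes c :: "real \<Rightarrow> 'a::euclidean_space"
  assumes "open S" "smooth_on S V" "\<And>s. s \<in> I \<Longrightarrow> c s \<in> S"
    and der: "\<And>s. s \<in> I \<Longrightarrow> (c has_vector_derivative V (c s)) (at s within I)"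
  shows "smooth_curve_on I c"
proof -
  define X where "X = rec_nat (\<lambda>x::'a. x) (\<lambda>_ f x. frechet_derivative f (at x) (V x))"
  have X: "X 0 = (\<lambda>x. x)" "X (Suc k) = (\<lambda>x. frechet_derivative (X k) (at x) (V x))" for k
    by (simp_all add: X_def)
  have sm: "smooth_on S (X k)" for k
  proof (induction k)
    case 0
    then show ?case by (simp add: X assms(1) smooth_on_linear bounded_linear_ident)
  next
    case (Suc k)
    then show ?case unfolding X by (rule smooth_on_derivative_along[OF assms(1) _ assms(2)])
  qed
  have "((\<lambda>s. X k (c s)) has_vector_derivative X (Suc k) (c s)) (at s within I)"
    if "s \<in> I" for k s
  proof -
    have "(X k has_derivative frechet_derivative (X k) (at (c s))) (at (c s) within c ` I)"
      using smooth_on_has_derivative[OF sm] assms(3) that has_derivative_at_withinI by blast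
    from vector_derivative_diff_chain_within[OF der[OF that] this]
    show ?thesis by (simp add: X o_def)
  qed
  then show ?thesis
    unfolding smooth_curve_on_def by (intro exI[of _ "\<lambda>k s. X k (c s)"]) (auto simp: X)
qed

lemma smooth_curve_on_linear_image:
  assumes "bounded_linear L" "smooth_curve_on I c"
  shows "smooth_curve_on I (\<lambda>s. L (c s))"
proof -
  obtain D where "D 0 = c" "\<And>k s. s \<in> I \<Longrightarrow> (D k has_vector_derivative D (Suc k) s) (at s within I)"
    using assms(2) unfolding smooth_curve_on_def by blast
  then show ?thesis
    unfolding smooth_curve_on_def
    by (intro exI[of _ "\<lambda>k s. L (D k s)"])
      (auto intro!: bounded_linear.has_vector_derivative[OF assms(1)])
qed

lemma smooth_curve_on_subset:
  "smooth_curve_on T c \<Longrightarrow> S \<subseteq> T \<Longrightarrow> smooth_curve_on S c"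
  unfolding smooth_curve_on_def using has_vector_derivative_within_subset subsetD by metis

lemma smooth_curve_on_imp_C1:
  assumes "smooth_curve_on I c"
  obtains c' where "continuous_on I c'" "\<And>s. s \<in> I \<Longrightarrow> (c has_vector_derivative c' s) (at s within I)"
proof -
  obtain D where "D 0 = c" "\<And>k s. s \<in> I \<Longrightarrow> (D k has_vector_derivative D (Suc k) s) (at s within I)"
    using assms unfolding smooth_curve_on_def by blast
  then have "continuous_on I (D (Suc 0))" and "(c has_vector_derivative D (Suc 0) s) (at s within I)"
    if "s \<in> I" for s
    using that has_vector_derivative_continuous continuous_on_eq_continuous_within by metis+
  then show ?thesis using that[of "D (Suc 0)"] by force
qed

lemma smooth_curve_on_continuous_on: "smooth_curve_on I c \<Longrightarrow> continuous_on I c"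
  by (metis smooth_curve_on_imp_C1 has_vector_derivative_continuous continuous_on_eq_continuous_within)

lemma smooth_curve_on_imp_piecewise:
  assumes "smooth_curve_on I c" shows "piecewise_smooth_on I c"
  unfolding piecewise_smooth_on_def
proof (intro allI impI conjI exI[of _ "{}"])
  fix a b :: real assume ab: "a < b \<and> {a..b} \<subseteq> I"
  then show "continuous_on {a..b} c"
    using assms smooth_curve_on_continuous_on continuous_on_subset by blast
  fix x y assume "a \<le> x \<and> x < y \<and> y \<le> b \<and> {x<..<y} \<inter> {} = {}"
  then have "{x..y} \<subseteq> I" using ab by fastforce
  then show "smooth_curve_on {x..y} c" by (rule smooth_curve_on_subset[OF assms])
qed simp

subsection \<open>Piecewise smooth curves\<close>

text \<open>Cutting at a break point leaves fewer break points inside each half. The rule lifts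
  statements from smooth pieces to whole intervals: the first variation, monotonicity of
  reparametrizations, and the bound along causal curves.\<close>

lemma piecewise_induct:
  fixes a b :: real
  assumes "finite P" "a < b"
    and piece: "\<And>c d. a \<le> c \<Longrightarrow> c < d \<Longrightarrow> d \<le> b \<Longrightarrow> {c<..<d} \<inter> P = {} \<Longrightarrow> R c d"
    and join: "\<And>c m d. a \<le> c \<Longrightarrow> c < m \<Longrightarrow> m < d \<Longrightarrow> d \<le> b \<Longrightarrow> R c m \<Longrightarrow> R m d \<Longrightarrow> R c d"
  shows "R a b"
proof -
  have "a \<le> c \<Longrightarrow> c < d \<Longrightarrow> d \<le> b \<Longrightarrow> R c d" for c d
  proof (induction "card ({c<..<d} \<inter> P)" arbitrary: c d rule: less_induct)
    case less
    show ?case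
    proof (cases "{c<..<d} \<inter> P = {}")
      case False
      then obtain m where m: "m \<in> P" "c < m" "m < d" by auto
      have "{c<..<m} \<inter> P \<subset> {c<..<d} \<inter> P" "{m<..<d} \<inter> P \<subset> {c<..<d} \<inter> P"
        using m by (simp_all add: psubset_eq set_eq_iff) force+
      then have "card ({c<..<m} \<inter> P) < card ({c<..<d} \<inter> P)"
        "card ({m<..<d} \<inter> P) < card ({c<..<d} \<inter> P)"
        using assms(1) by (simp_all add: psubset_card_mono)
      then have "R c m" "R m d" using less.hyps[of c m] less.hyps[of m d] m less.prems by simp_all
      then show ?thesis using join[of c m d] less.prems m by simp
    qed (rule piece, use less.prems in auto)
  qed
  then show ?thesis using \<open>a < b\<close> by auto
qed

text \<open>Regular, causal and lightlike curves are defined by quantifying over one-sided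
  velocities. Where a derivative within \<open>I\<close> exists, this reduces the condition to that
  single vector.\<close>

lemma one_sided_velocity_unique:
  fixes c :: "real \<Rightarrow> 'a::real_normed_vector"
  assumes "is_interval I" "s \<in> I" and der: "(c has_vector_derivative c') (at s within I)"
    and "one_sided_velocity I c s v"
  shows "v = c'"
proof -
  have uniq: "v = c'" if "x \<in> I" "y \<in> I" "x < y" "s \<in> {x..y}"
    and v: "(c has_vector_derivative v) (at s within {x..y})" for x y
  proof -
    have "{x..y} \<subseteq> I"
      using mem_is_interval_1_I[OF assms(1) that(1,2)] by (simp add: subset_iff)
    from has_vector_derivative_within_subset[OF der this]
    show ?thesis using vector_derivative_unique_within_closed_interval[of x y s c v c'] that by simp
  qed
  from assms(4) consider r where "r \<in> I" "s < r" "(c has_vector_derivative v) (at s within {s..r})"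
    | r where "r \<in> I" "r < s" "(c has_vector_derivative v) (at s within {r..s})"
    unfolding one_sided_velocity_def by blast
  then show ?thesis
  proof cases
    case 1
    then show ?thesis using uniq[of s r] \<open>s \<in> I\<close> by simp
  next
    case 2
    then show ?thesis using uniq[of r s] \<open>s \<in> I\<close> by simp
  qed
qed

text \<open>The velocity is taken from the right, except at the right end of the piece. Conditions
  on one-sided velocities thereby reach the closed ends of each smooth piece.\<close>

lemma one_sided_velocity_piece:
  assumes "{c..d} \<subseteq> I" "c < d" "s \<in> {c..d}" "(\<gamma> has_vector_derivative v) (at s within {c..d})"
  shows "one_sided_velocity I \<gamma> s v"
proof (cases "s < d")
  case True
  then have "(\<gamma> has_vector_derivative v) (at s within {s..d})" "d \<in> I"
    using assms has_vector_derivative_within_subset[OF assms(4), of "{s..d}"] by auto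
  then show ?thesis unfolding one_sided_velocity_def using True by blast
next
  case False
  then have "(\<gamma> has_vector_derivative v) (at s within {c..s})" "c \<in> I" "c < s"
    using assms has_vector_derivative_within_subset[OF assms(4), of "{c..s}"] by auto
  then show ?thesis unfolding one_sided_velocity_def by blast
qed

subsection \<open>The Legendre transform of a time-only dependent metric\<close>

locale time_only_finsler =
  fixes F :: "real \<Rightarrow> real ^ 'n \<Rightarrow> real ^ 'n \<Rightarrow> real"
  assumes metric: "time_dependent_finsler_metric F"
    and time_only: "time_only_dependent F"
begin

abbreviation slit :: "(real \<times> (real ^ 'n)) set" where
  "slit \<equiv> {p. snd p \<noteq> 0}"

text \<open>Half the squared metric is homogeneous of degree 2, so its gradient in \<open>v\<close>
  is homogeneous of degree 1 and its Hessian in \<open>v\<close> is the fundamental tensor.\<close>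

definition E :: "real \<times> (real ^ 'n) \<Rightarrow> real" where
  "E p = (F (fst p) 0 (snd p))\<^sup>2 / 2"

text \<open>\<open>G (t, v)\<close> is the gradient of \<open>E (t, \<sqdot>)\<close> at \<open>v\<close>, i.e. the Legendre transform of \<open>v\<close>.\<close>

definition G :: "real \<times> (real ^ 'n) \<Rightarrow> real ^ 'n" where
  "G p = (\<chi> i. frechet_derivative E (at p) (0, axis i 1))"

definition Et :: "real \<times> (real ^ 'n) \<Rightarrow> real" where
  "Et p = frechet_derivative E (at p) (1, 0)"

definition dG :: "real \<times> (real ^ 'n) \<Rightarrow> real ^ 'n \<Rightarrow> real ^ 'n" where
  "dG p w = frechet_derivative G (at p) (0, w)"

lemma F_indep: "F t x v = F t 0 v"
  using time_only unfolding time_only_dependent_def by blast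

lemma F_0: "F t x 0 = 0"
  and F_pos: "v \<noteq> 0 \<Longrightarrow> F t x v > 0"
  and F_scale: "c > 0 \<Longrightarrow> F t x (c *\<^sub>R v) = c * F t x v"
  using metric unfolding time_dependent_finsler_metric_def by blast+

lemma F_nonneg: "F t x v \<ge> 0"
  using F_pos[of v t x] F_0[of t x] by (cases "v = 0") auto

lemma F_nonzero_iff: "F t x v = 0 \<longleftrightarrow> v = 0"
  using F_pos[of v t x] F_0[of t x] by (cases "v = 0") auto

lemma open_slit: "open slit"
proof -
  have "slit = UNIV \<times> - {0}" by auto
  then show ?thesis by (simp add: open_Times open_Compl)
qed

lemma smooth_on_F: "smooth_on slit (\<lambda>p. F (fst p) 0 (snd p))"
proof -
  have F: "smooth_on {(t, x, v). v \<noteq> 0} (\<lambda>(t, x, v). F t x v)"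
    using metric unfolding time_dependent_finsler_metric_def by blast
  have L: "bounded_linear (\<lambda>p::real \<times> (real ^ 'n). (fst p, 0 :: real ^ 'n, snd p))"
    by (intro bounded_linear_Pair bounded_linear_fst bounded_linear_snd bounded_linear_zero)
  show ?thesis
    using smooth_on_compose_linear[OF open_slit L F] by auto
qed

lemma smooth_on_E: "smooth_on slit E"
  using smooth_on_divide[OF open_slit smooth_on_mult[OF open_slit smooth_on_F smooth_on_F]
      smooth_on_const[OF open_slit, of 2]]
  by (rule smooth_on_cong) (auto simp: open_slit E_def power2_eq_square)

lemma continuous_on_F: "continuous_on UNIV (\<lambda>p. F (fst p) 0 (snd p))"
proof -
  have F: "continuous_on UNIV (\<lambda>(t, x, v). F t x v)"
    using metric unfolding time_dependent_finsler_metric_def by blast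
  have "continuous_on UNIV (\<lambda>p::real \<times> (real ^ 'n). (fst p, 0 :: real ^ 'n, snd p))"
    by (intro continuous_intros)
  from continuous_on_compose2[OF F this] show ?thesis by simp
qed

lemma continuous_on_E: "continuous_on UNIV E"
  unfolding E_def[abs_def] by (intro continuous_intros continuous_on_F) auto

lemma smooth_on_G: "smooth_on slit G"
  unfolding G_def[abs_def]
  by (intro smooth_on_vec_lambda open_slit smooth_on_derivative smooth_on_E)

lemma smooth_on_Et: "smooth_on slit Et"
  unfolding Et_def[abs_def] by (intro smooth_on_derivative smooth_on_E)

lemma E_has_derivative:
  assumes "p \<in> slit"
  shows "(E has_derivative (\<lambda>q. fst q * Et p + G p \<bullet> snd q)) (at p)"
proof -
  have der: "(E has_derivative frechet_derivative E (at p)) (at p)"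
    by (rule smooth_on_has_derivative[OF smooth_on_E assms])
  then have lin: "linear (frechet_derivative E (at p))" by (rule has_derivative_linear)
  have "frechet_derivative E (at p) (a, w) = a * Et p + G p \<bullet> w" for a w
  proof -
    have w: "w = (\<Sum>i\<in>UNIV. (w $ i) *\<^sub>R axis i 1)"
      by (simp add: vec_eq_iff axis_def if_distrib cong: if_cong)
    have "(\<Sum>i\<in>UNIV. (0::real, w $ i *\<^sub>R axis i (1::real))) = (0, w)"
      by (subst (2) w) (simp add: prod_eq_iff fst_sum snd_sum)
    then have "(a, w) = a *\<^sub>R (1, 0) + (\<Sum>i\<in>UNIV. (w $ i) *\<^sub>R (0, axis i 1))" by simp
    then have "frechet_derivative E (at p) (a, w) =
        a * Et p + (\<Sum>i\<in>UNIV. (w $ i) * frechet_derivative E (at p) (0, axis i 1))"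
      by (simp only: linear_add[OF lin] linear_sum[OF lin] linear_scale[OF lin] Et_def)
        (simp add: o_def linear_scale[OF lin])
    then show ?thesis by (simp add: G_def inner_vec_def mult.commute)
  qed
  then have "frechet_derivative E (at p) = (\<lambda>q. fst q * Et p + G p \<bullet> snd q)"
    by (auto simp: fun_eq_iff)
  with der show ?thesis by simp
qed

lemma G_has_derivative:
  "p \<in> slit \<Longrightarrow> (G has_derivative frechet_derivative G (at p)) (at p)"
  by (rule smooth_on_has_derivative[OF smooth_on_G])

lemma G_derivative_split:
  assumes "p \<in> slit"
  shows "frechet_derivative G (at p) (a, w) = a *\<^sub>R frechet_derivative G (at p) (1, 0) + dG p w"
proof -
  have lin: "linear (frechet_derivative G (at p))"
    using G_has_derivative[OF assms] has_derivative_linear by blast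
  show ?thesis
    using linear_add[OF lin, of "a *\<^sub>R (1, 0)" "(0, w)"] linear_scale[OF lin, of a "(1, 0)"]
    by (simp add: dG_def)
qed

lemma linear_dG: "p \<in> slit \<Longrightarrow> linear (dG p)"
proof -
  assume "p \<in> slit"
  then have lin: "linear (frechet_derivative G (at p))"
    using G_has_derivative has_derivative_linear by blast
  have "linear (\<lambda>w::real ^ 'n. (0::real, w))" by (rule linearI) auto
  from linear_compose[OF this lin] show "linear (dG p)" unfolding o_def dG_def[abs_def] .
qed

lemma E_along:
  assumes "v + s *\<^sub>R u \<noteq> 0"
  shows "((\<lambda>s. E (t, v + s *\<^sub>R u)) has_real_derivative G (t, v + s *\<^sub>R u) \<bullet> u) (at s)"
proof -
  have "((\<lambda>s. (t, v + s *\<^sub>R u)) has_derivative (\<lambda>h. (0, h *\<^sub>R u))) (at s)"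
    by (auto intro!: derivative_eq_intros)
  from has_derivative_compose[OF this E_has_derivative] assms
  show ?thesis by (simp add: has_field_derivative_def mult.commute[of _ "G _ \<bullet> u"])
qed

lemma G_along:
  assumes "v + s *\<^sub>R u \<noteq> 0"
  shows "((\<lambda>s. G (t, v + s *\<^sub>R u)) has_vector_derivative dG (t, v + s *\<^sub>R u) u) (at s)"
proof -
  have "((\<lambda>s. (t, v + s *\<^sub>R u)) has_derivative (\<lambda>h. (0, h *\<^sub>R u))) (at s)"
    by (auto intro!: derivative_eq_intros)
  from has_derivative_compose[OF this G_has_derivative] assms
  show ?thesis
    using linear_scale[OF linear_dG[of "(t, v + s *\<^sub>R u)"]]
    by (simp add: has_vector_derivative_def dG_def)
qed

section \<open>Homogeneity, Euler identities and the fundamental tensor\<close>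

lemma E_scale: "c > 0 \<Longrightarrow> E (t, c *\<^sub>R v) = c\<^sup>2 * E (t, v)"
  by (simp add: E_def F_scale power_mult_distrib)

lemma E_nonneg: "E p \<ge> 0"
  by (simp add: E_def)

lemma E_0: "E (t, 0) = 0"
  by (simp add: E_def F_0)

lemma E_pos: "v \<noteq> 0 \<Longrightarrow> E (t, v) > 0"
  using F_pos[of v t 0] by (simp add: E_def)

lemma F_squared: "(F t x v)\<^sup>2 = 2 * E (t, v)"
  using F_indep[of t x v] by (simp add: E_def)

lemma eventually_shift_nonzero:
  fixes v u :: "real ^ 'n"
  assumes "v \<noteq> 0"
  shows "\<forall>\<^sub>F s in nhds (0::real). v + s *\<^sub>R u \<noteq> 0"
proof -
  have "((\<lambda>s. v + s *\<^sub>R u) \<longlongrightarrow> v + 0 *\<^sub>R u) (nhds (0::real))"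
    by (intro tendsto_intros filterlim_ident)
  then show ?thesis using assms tendsto_imp_eventually_ne by (metis add.right_neutral scaleR_zero_left)
qed

text \<open>Along \<open>v + s v\<close> the energy is \<open>(1 + s)^2 * E (t, v)\<close> for
  \<open>s > -1\<close>; compare derivatives at \<open>s = 0\<close>.\<close>

lemma G_euler:
  assumes "v \<noteq> 0"
  shows "G (t, v) \<bullet> v = 2 * E (t, v)"
proof -
  have der: "((\<lambda>s. E (t, v + s *\<^sub>R v)) has_real_derivative G (t, v) \<bullet> v) (at 0)"
    using E_along[of v 0 v t] assms by simp
  have "((\<lambda>s. (1 + s)\<^sup>2 * E (t, v)) has_real_derivative 2 * E (t, v)) (at 0)"
    by (auto intro!: derivative_eq_intros)
  moreover have "\<forall>\<^sub>F s in nhds 0. E (t, v + s *\<^sub>R v) = (1 + s)\<^sup>2 * E (t, v)"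
  proof (rule eventually_mono)
    show "\<forall>\<^sub>F s in nhds 0. (-1::real) < s"
      using eventually_nhds_in_open[of "{-1<..}" "0::real"] by simp
    fix s :: real assume "-1 < s"
    then show "E (t, v + s *\<^sub>R v) = (1 + s)\<^sup>2 * E (t, v)"
      using E_scale[of "1 + s" t v] by (simp add: scaleR_add_left)
  qed
  ultimately have "((\<lambda>s. E (t, v + s *\<^sub>R v)) has_real_derivative 2 * E (t, v)) (at 0)"
    using DERIV_cong_ev[OF refl _ refl, of "\<lambda>s. E (t, v + s *\<^sub>R v)" "\<lambda>s. (1 + s)\<^sup>2 * E (t, v)" 0]
    by blast
  with der show ?thesis by (rule DERIV_unique)
qed

text \<open>Differentiating the degree-2 scaling of \<open>E\<close> in direction \<open>c w\<close>
  produces the factor \<open>c\<close> once on the left and twice on the right.\<close>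

lemma G_scale:
  assumes "c > 0" "v \<noteq> 0"
  shows "G (t, c *\<^sub>R v) = c *\<^sub>R G (t, v)"
proof (rule vector_eq_rdot[THEN iffD1], rule allI)
  fix w
  have "((\<lambda>s. E (t, c *\<^sub>R v + s *\<^sub>R (c *\<^sub>R w))) has_real_derivative G (t, c *\<^sub>R v) \<bullet> (c *\<^sub>R w)) (at 0)"
    using E_along[of "c *\<^sub>R v" 0 "c *\<^sub>R w" t] assms by simp
  moreover have "E (t, c *\<^sub>R v + s *\<^sub>R (c *\<^sub>R w)) = c\<^sup>2 * E (t, v + s *\<^sub>R w)" for s
    using E_scale[OF assms(1), of t "v + s *\<^sub>R w"] by (simp add: scaleR_add_right mult.commute)
  moreover have "((\<lambda>s. c\<^sup>2 * E (t, v + s *\<^sub>R w)) has_real_derivative c\<^sup>2 * (G (t, v) \<bullet> w)) (at 0)"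
    using E_along[of v 0 w t] assms by (auto intro!: derivative_eq_intros)
  ultimately have "c * (G (t, c *\<^sub>R v) \<bullet> w) = c\<^sup>2 * (G (t, v) \<bullet> w)"
    using DERIV_unique by fastforce
  then show "G (t, c *\<^sub>R v) \<bullet> w = c *\<^sub>R G (t, v) \<bullet> w"
    using assms(1) by (simp add: power2_eq_square)
qed

lemma dG_euler:
  assumes "v \<noteq> 0"
  shows "dG (t, v) v = G (t, v)"
proof -
  have der: "((\<lambda>s. G (t, v + s *\<^sub>R v)) has_vector_derivative dG (t, v) v) (at 0)"
    using G_along[of v 0 v t] assms by simp
  have "((\<lambda>s. (1 + s) *\<^sub>R G (t, v)) has_vector_derivative G (t, v)) (at 0)"
    by (auto intro!: derivative_eq_intros)
  moreover have "(1 + s) *\<^sub>R G (t, v) = G (t, v + s *\<^sub>R v)" if "s \<in> {-1<..}" for s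
    using G_scale[of "1 + s" v t] that assms by (simp add: scaleR_add_left)
  ultimately have "((\<lambda>s. G (t, v + s *\<^sub>R v)) has_vector_derivative G (t, v)) (at 0)"
    using has_vector_derivative_transform_within_open[of "\<lambda>s. (1 + s) *\<^sub>R G (t, v)" "G (t, v)" 0 "{-1<..}"]
    by simp
  with der show ?thesis by (rule vector_derivative_unique_at)
qed

text \<open>The inner derivative is expressed through \<open>G\<close> only where the shifted vector
  is nonzero. This holds for \<open>\<delta>\<close> near \<open>0\<close>, and the outer derivative
  sees only that germ.\<close>

lemma fundamental_tensor_eq:
  assumes "v \<noteq> 0"
  shows "fundamental_tensor (F t x) v u w = dG (t, v) u \<bullet> w"
proof -
  have inner: "deriv (\<lambda>\<eta>. (F t x (v + \<delta> *\<^sub>R u + \<eta> *\<^sub>R w))\<^sup>2) 0 = 2 * (G (t, v + \<delta> *\<^sub>R u) \<bullet> w)"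
    if "v + \<delta> *\<^sub>R u \<noteq> 0" for \<delta>
    unfolding F_squared
    by (rule DERIV_imp_deriv) (use E_along[of "v + \<delta> *\<^sub>R u" 0 w t] that in \<open>auto intro!: derivative_eq_intros\<close>)
  have "deriv (\<lambda>\<delta>. deriv (\<lambda>\<eta>. (F t x (v + \<delta> *\<^sub>R u + \<eta> *\<^sub>R w))\<^sup>2) 0) 0 =
      deriv (\<lambda>\<delta>. 2 * (G (t, v + \<delta> *\<^sub>R u) \<bullet> w)) 0"
    by (rule deriv_cong_ev[OF eventually_mono[OF eventually_shift_nonzero[OF assms, of u]] refl])
      (rule inner)
  also have "((\<lambda>\<delta>. 2 * (G (t, v + \<delta> *\<^sub>R u) \<bullet> w)) has_real_derivative 2 * (dG (t, v) u \<bullet> w)) (at 0)"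
  proof -
    have "((\<lambda>\<delta>. G (t, v + \<delta> *\<^sub>R u)) has_vector_derivative dG (t, v) u) (at 0)"
      using G_along[of v 0 u t] assms by simp
    from bounded_linear.has_vector_derivative[OF bounded_linear_inner_left this, of w]
    show ?thesis
      by (auto simp: has_real_derivative_iff_has_vector_derivative[symmetric] intro!: derivative_eq_intros)
  qed
  then have "deriv (\<lambda>\<delta>. 2 * (G (t, v + \<delta> *\<^sub>R u) \<bullet> w)) 0 = 2 * (dG (t, v) u \<bullet> w)"
    by (rule DERIV_imp_deriv)
  finally show ?thesis by (simp add: fundamental_tensor_def)
qed

text \<open>Turns Finsler orthogonality of \<open>v\<close> into Euclidean orthogonality of its
  Legendre transform.\<close>

lemma fundamental_tensor_self: "v \<noteq> 0 \<Longrightarrow> fundamental_tensor (F t x) v v u = G (t, v) \<bullet> u"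
  by (simp add: fundamental_tensor_eq dG_euler)

section \<open>Strict convexity of the energy and bijectivity of the Legendre transform\<close>

lemma dG_pos: "v \<noteq> 0 \<Longrightarrow> u \<noteq> 0 \<Longrightarrow> dG (t, v) u \<bullet> u > 0"
  using metric unfolding time_dependent_finsler_metric_def
  by (metis fundamental_tensor_eq)

text \<open>A strict Fenchel-Young inequality. The mean value theorem, applied twice on the segment
  from \<open>v\<close> to \<open>w\<close>, derives it from positivity of \<open>dG\<close>. A
  segment through the origin leaves the domain of smoothness and is treated separately.\<close>

lemma G_inner_less:
  assumes "v \<noteq> 0" "w \<noteq> v"
  shows "G (t, v) \<bullet> w < E (t, v) + E (t, w)"
proof (cases "\<exists>s. 0 < s \<and> s \<le> 1 \<and> v + s *\<^sub>R (w - v) = 0")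
  case True
  then obtain s where s: "0 < s" "s \<le> 1" "v + s *\<^sub>R (w - v) = 0" by blast
  \<comment> \<open>Here \<open>w\<close> is a nonpositive multiple of \<open>v\<close>, so the left
    side of the claim is nonpositive by Euler's identity while \<open>E (t, v)\<close> is
    positive.\<close>
  have "s *\<^sub>R w = (s - 1) *\<^sub>R v" using s(3) by (simp add: algebra_simps)
  then have "s * (G (t, v) \<bullet> w) = (s - 1) * (2 * E (t, v))"
    using G_euler[OF assms(1)] by (metis inner_scaleR_right)
  moreover have "(s - 1) * (2 * E (t, v)) \<le> 0"
    using s E_pos[OF assms(1), of t] by (simp add: mult_nonpos_nonneg)
  ultimately have "G (t, v) \<bullet> w \<le> 0" using s(1) by (metis linorder_not_le mult_pos_pos)
  then show ?thesis
    using E_pos[OF assms(1), of t] E_nonneg[of "(t, w)"] by linarith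
next
  case False
  define u where "u = w - v"
  have nz: "v + s *\<^sub>R u \<noteq> 0" if "0 \<le> s" "s \<le> 1" for s
    using False that assms(1) unfolding u_def by (cases "s = 0") auto
  have "\<exists>z. 0 < z \<and> z < 1 \<and> E (t, v + 1 *\<^sub>R u) - E (t, v + 0 *\<^sub>R u) = (1 - 0) * (G (t, v + z *\<^sub>R u) \<bullet> u)"
    by (rule MVT2[where f = "\<lambda>s. E (t, v + s *\<^sub>R u)" and f' = "\<lambda>s. G (t, v + s *\<^sub>R u) \<bullet> u"])
      (simp_all add: E_along nz)
  then obtain z where z: "0 < z" "z < 1" "E (t, w) - E (t, v) = G (t, v + z *\<^sub>R u) \<bullet> u"
    by (auto simp: u_def)
  have "\<exists>y. 0 < y \<and> y < z \<and> G (t, v + z *\<^sub>R u) \<bullet> u - G (t, v + 0 *\<^sub>R u) \<bullet> u =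
      (z - 0) * (dG (t, v + y *\<^sub>R u) u \<bullet> u)"
  proof (rule MVT2[OF z(1)])
    fix y assume "0 \<le> y" "y \<le> z"
    then have "v + y *\<^sub>R u \<noteq> 0" using nz z by auto
    from bounded_linear.has_vector_derivative[OF bounded_linear_inner_left[of u] G_along[OF this, of t]]
    show "((\<lambda>y. G (t, v + y *\<^sub>R u) \<bullet> u) has_real_derivative dG (t, v + y *\<^sub>R u) u \<bullet> u) (at y)"
      by (simp add: has_real_derivative_iff_has_vector_derivative)
  qed
  then obtain y where y: "0 < y" "y < z"
    "G (t, v + z *\<^sub>R u) \<bullet> u - G (t, v) \<bullet> u = z * (dG (t, v + y *\<^sub>R u) u \<bullet> u)" by auto
  have "dG (t, v + y *\<^sub>R u) u \<bullet> u > 0"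
    using dG_pos nz[of y] y z assms(2) by (auto simp: u_def)
  then have "E (t, w) - E (t, v) > G (t, v) \<bullet> u" using y z by (simp add: z(3)) (smt (verit) mult_pos_pos)
  then show ?thesis using G_euler[OF assms(1), of t] by (simp add: u_def inner_diff_right)
qed

lemma G_nonzero: "v \<noteq> 0 \<Longrightarrow> G (t, v) \<noteq> 0"
  using G_euler[of v t] E_pos[of v t] by auto

text \<open>If the transforms agree, adding the strict inequalities for \<open>(v, w)\<close> and
  \<open>(w, v)\<close> contradicts the sum of Euler's identities.\<close>

lemma G_inj:
  assumes "v \<noteq> 0" "w \<noteq> 0" "G (t, v) = G (t, w)"
  shows "v = w"
proof (rule ccontr)
  assume "v \<noteq> w"
  then have "G (t, v) \<bullet> w < E (t, v) + E (t, w)" "G (t, w) \<bullet> v < E (t, w) + E (t, v)"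
    using G_inner_less[of v w t] G_inner_less[of w v t] assms(1,2) by simp_all
  then show False using G_euler[OF assms(1), of t] G_euler[OF assms(2), of t] assms(3) by simp
qed

text \<open>The vector is a minimum point of \<open>E (t, w) - \<xi> \<bullet> w\<close>, where the
  gradient vanishes. Homogeneity and compactness of the unit sphere bound \<open>E\<close> below by
  a multiple of the squared norm, so a minimum exists.\<close>

lemma G_surj:
  assumes "\<xi> \<noteq> 0"
  obtains v where "v \<noteq> 0" "G (t, v) = \<xi>"
proof -
  have cont: "continuous_on S (\<lambda>w. E (t, w))" for S
    by (rule continuous_on_compose2[OF continuous_on_E]) (auto intro: continuous_intros)
  have "\<exists>m. m \<in> sphere 0 1 \<and> (\<forall>w\<in>sphere 0 1. E (t, m) \<le> E (t, w))"
    using continuous_attains_inf[of "sphere (0 :: real ^ 'n) 1", OF _ _ cont] by force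
  then obtain m where m: "norm m = 1" "\<And>w. norm w = 1 \<Longrightarrow> E (t, m) \<le> E (t, w)" by auto
  define \<mu> where "\<mu> = E (t, m)"
  have \<mu>: "\<mu> > 0" unfolding \<mu>_def by (rule E_pos) (use m(1) in auto)
  have lower: "E (t, w) \<ge> \<mu> * (norm w)\<^sup>2" for w
  proof (cases "w = 0")
    case False
    have "E (t, w) = (norm w)\<^sup>2 * E (t, w /\<^sub>R norm w)"
      using E_scale[of "norm w" t "w /\<^sub>R norm w"] False by simp
    moreover have "\<mu> \<le> E (t, w /\<^sub>R norm w)" using m(2)[of "w /\<^sub>R norm w"] False by (simp add: \<mu>_def)
    ultimately show ?thesis by (simp add: mult.commute[of \<mu>] mult_left_mono)
  qed (simp add: E_0)
  define f where "f w = E (t, w) - \<xi> \<bullet> w" for w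
  \<comment> \<open>For norms above this radius the quadratic lower bound dominates the linear term,
    so \<open>f\<close> is at least \<open>f 0\<close> there.\<close>
  define R where "R = norm \<xi> / \<mu>"
  have R: "R \<ge> 0" using \<mu> by (simp add: R_def)
  have "continuous_on (cball 0 R) f" unfolding f_def by (intro continuous_intros cont)
  then obtain v where v: "v \<in> cball 0 R" "\<And>w. w \<in> cball 0 R \<Longrightarrow> f v \<le> f w"
    using continuous_attains_inf[of "cball (0 :: real ^ 'n) R" f] R by auto
  have min: "f v \<le> f w" for w
  proof (cases "norm w \<le> R")
    case False
    have "f v \<le> f 0" using v R by auto
    also have "\<dots> = 0" by (simp add: f_def E_0)
    also have "0 \<le> norm w * (\<mu> * norm w - norm \<xi>)"
      using False \<mu> by (simp add: R_def pos_divide_le_eq mult.commute not_le)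
        (simp add: less_imp_le divide_less_eq mult.commute)
    also have "\<dots> \<le> f w"
      using lower[of w] norm_cauchy_schwarz[of \<xi> w] by (simp add: f_def power2_eq_square algebra_simps)
    finally show ?thesis .
  qed (use v in auto)
  have "v \<noteq> 0"
  proof
    assume "v = 0"
    define \<epsilon> where "\<epsilon> = (norm \<xi>)\<^sup>2 / (2 * E (t, \<xi>))"
    have \<epsilon>: "\<epsilon> > 0" using assms E_pos[OF assms, of t] by (simp add: \<epsilon>_def)
    have "f (\<epsilon> *\<^sub>R \<xi>) = \<epsilon> * (\<epsilon> * E (t, \<xi>) - (norm \<xi>)\<^sup>2)"
      unfolding f_def E_scale[OF \<epsilon>] inner_scaleR_right dot_square_norm
      by (simp add: power2_eq_square algebra_simps)
    also have "\<epsilon> * E (t, \<xi>) = (norm \<xi>)\<^sup>2 / 2" using E_pos[OF assms, of t] by (simp add: \<epsilon>_def)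
    also have "\<epsilon> * ((norm \<xi>)\<^sup>2 / 2 - (norm \<xi>)\<^sup>2) < 0"
      using \<epsilon> assms by (simp add: mult_pos_neg)
    finally show False using min[of "\<epsilon> *\<^sub>R \<xi>"] \<open>v = 0\<close> by (simp add: f_def E_0)
  qed
  moreover have "G (t, v) = \<xi>"
  proof (rule vector_eq_rdot[THEN iffD1], rule allI)
    fix u
    have "((\<lambda>s. E (t, v + s *\<^sub>R u) - \<xi> \<bullet> (v + s *\<^sub>R u)) has_real_derivative
        G (t, v) \<bullet> u - \<xi> \<bullet> u) (at 0)"
      using E_along[of v 0 u t] \<open>v \<noteq> 0\<close>
      by (auto intro!: derivative_eq_intros simp: inner_add_right)
    then have "G (t, v) \<bullet> u - \<xi> \<bullet> u = 0"
      by (rule DERIV_local_min[of _ _ _ 1]) (use min in \<open>auto simp: f_def\<close>)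
    then show "G (t, v) \<bullet> u = \<xi> \<bullet> u" by simp
  qed
  ultimately show ?thesis using that by blast
qed

section \<open>The inverse Legendre transform and the indicatrix\<close>

definition vel :: "real \<Rightarrow> real ^ 'n \<Rightarrow> real ^ 'n" where
  "vel t \<xi> = (SOME v. v \<noteq> 0 \<and> G (t, v) = \<xi>)"

text \<open>The point of the indicatrix at time \<open>t\<close> with outer normal \<open>\<xi>\<close>.\<close>

definition ind :: "real \<Rightarrow> real ^ 'n \<Rightarrow> real ^ 'n" where
  "ind t \<xi> = vel t \<xi> /\<^sub>R F t 0 (vel t \<xi>)"

lemma vel_nonzero: "\<xi> \<noteq> 0 \<Longrightarrow> vel t \<xi> \<noteq> 0"
  and G_vel: "\<xi> \<noteq> 0 \<Longrightarrow> G (t, vel t \<xi>) = \<xi>"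
proof -
  assume "\<xi> \<noteq> 0"
  then have "\<exists>v. v \<noteq> 0 \<and> G (t, v) = \<xi>" using G_surj by blast
  from someI_ex[OF this] show "vel t \<xi> \<noteq> 0" "G (t, vel t \<xi>) = \<xi>" unfolding vel_def by auto
qed

lemma vel_G: "v \<noteq> 0 \<Longrightarrow> vel t (G (t, v)) = v"
  using G_inj[OF vel_nonzero _ G_vel] G_nonzero by blast

lemma vel_scale:
  assumes "a > 0" "\<xi> \<noteq> 0"
  shows "vel t (a *\<^sub>R \<xi>) = a *\<^sub>R vel t \<xi>"
  using vel_G[of "a *\<^sub>R vel t \<xi>" t] G_scale[OF assms(1) vel_nonzero[OF assms(2)], of t t] assms
  by (simp add: G_vel vel_nonzero)

lemma F_vel_pos: "\<xi> \<noteq> 0 \<Longrightarrow> F t x (vel t \<xi>) > 0"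
  by (simp add: F_pos vel_nonzero)

lemma ind_scale:
  assumes "a > 0" "\<xi> \<noteq> 0"
  shows "ind t (a *\<^sub>R \<xi>) = ind t \<xi>"
  using assms by (simp add: ind_def vel_scale F_scale)

lemma ind_nonzero: "\<xi> \<noteq> 0 \<Longrightarrow> ind t \<xi> \<noteq> 0"
  using F_vel_pos[of \<xi> t 0] by (simp add: ind_def vel_nonzero)

lemma F_ind: "\<xi> \<noteq> 0 \<Longrightarrow> F t x (ind t \<xi>) = 1"
  using F_vel_pos[of \<xi> t 0] F_indep[of t x] by (simp add: ind_def F_scale)

lemma ind_G: "v \<noteq> 0 \<Longrightarrow> ind t (G (t, v)) = v /\<^sub>R F t 0 v"
  by (simp add: ind_def vel_G)

lemma inner_ind:
  assumes "\<xi> \<noteq> 0"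
  shows "\<xi> \<bullet> ind t \<xi> = F t 0 (vel t \<xi>)"
  using G_euler[OF vel_nonzero[OF assms], of t t] F_vel_pos[OF assms, of t 0] F_squared[of t 0 "vel t \<xi>"]
  by (simp add: ind_def G_vel[OF assms] power2_eq_square field_simps)

text \<open>Rescale \<open>w\<close> by \<open>m = F t 0 (vel t \<xi>)\<close>: both energies in the
  Fenchel-Young inequality are then at most \<open>m^2 / 2\<close>, and dividing by \<open>m\<close>
  gives the claim. Thus \<open>ind t \<xi>\<close> maximizes \<open>\<xi>\<close> on the unit ball
  of the metric.\<close>

lemma inner_le_inner_ind:
  assumes "\<xi> \<noteq> 0" "F t x w \<le> 1"
  shows "\<xi> \<bullet> w \<le> \<xi> \<bullet> ind t \<xi>"
proof -
  define v where "v = vel t \<xi>"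
  define m where "m = F t 0 v"
  have m: "m > 0" using F_vel_pos[OF assms(1)] by (simp add: m_def v_def)
  have v: "v \<noteq> 0" "G (t, v) = \<xi>" using vel_nonzero G_vel assms(1) by (auto simp: v_def)
  have "\<xi> \<bullet> (m *\<^sub>R w) \<le> E (t, v) + E (t, m *\<^sub>R w)"
  proof (cases "m *\<^sub>R w = v")
    case True
    then show ?thesis using G_euler[OF v(1), of t] v(2) by simp
  next
    case False
    then show ?thesis using G_inner_less[OF v(1), of "m *\<^sub>R w" t] v(2) by simp
  qed
  also have "E (t, m *\<^sub>R w) = m\<^sup>2 * E (t, w)" by (rule E_scale[OF m])
  also have "E (t, w) \<le> 1 / 2"
    using assms(2) F_nonneg[of t 0 w] F_indep[of t x w] power_le_one[of "F t 0 w" 2] by (simp add: E_def)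
  then have "E (t, v) + m\<^sup>2 * E (t, w) \<le> m\<^sup>2"
    using mult_left_mono[of "E (t, w)" "1/2" "m\<^sup>2"] by (simp add: E_def[of "(t, v)"] m_def)
  finally have "m * (\<xi> \<bullet> w) \<le> m * m" by (simp add: power2_eq_square)
  then show ?thesis using m by (simp add: inner_ind[OF assms(1)] m_def v_def)
qed

text \<open>Inverse function theorem for \<open>(t, v) \<mapsto> (t, G (t, v))\<close>, which keeps
  time as a coordinate so that \<open>vel\<close> is jointly differentiable. The derivative is
  injective because \<open>dG\<close> is positive definite, and a left inverse on the whole slit
  space is already known.\<close>

lemma vel_has_derivative:
  assumes "\<xi> \<noteq> 0"
  shows "\<exists>f'. ((\<lambda>q. vel (fst q) (snd q)) has_derivative f') (at (t, \<xi>))"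
proof -
  define p where "p = (t, vel t \<xi>)"
  have p: "p \<in> slit" by (simp add: p_def vel_nonzero assms)
  define \<Psi> where "\<Psi> q = (fst q, G q)" for q
  define \<Psi>' where "\<Psi>' q = (fst q, frechet_derivative G (at p) q)" for q
  define g where "g q = (fst q, vel (fst q) (snd q))" for q :: "real \<times> (real ^ 'n)"
  have der: "(\<Psi> has_derivative \<Psi>') (at p)"
    unfolding \<Psi>_def \<Psi>'_def by (intro has_derivative_Pair has_derivative_fst has_derivative_ident G_has_derivative p)
  have "inj \<Psi>'"
  proof (rule linear_injective_0[THEN iffD2, OF has_derivative_linear[OF der]], intro allI impI)
    fix q assume q: "\<Psi>' q = 0"
    then have "fst q = 0" "frechet_derivative G (at p) q = 0" by (simp_all add: \<Psi>'_def prod_eq_iff)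
    then have "dG p (snd q) = 0" unfolding dG_def by (metis prod.collapse)
    then have "snd q = 0" using dG_pos[OF vel_nonzero[OF assms], of "snd q" t t] by (auto simp: p_def)
    then show "q = 0" using \<open>fst q = 0\<close> by (simp add: prod_eq_iff)
  qed
  then have "\<Psi>' \<circ> inv \<Psi>' = id"
    using linear_injective_imp_surjective[OF has_derivative_linear[OF der]] surj_iff by blast
  moreover have "g (\<Psi> q) = q" if "q \<in> slit" for q
    using that vel_G[of "snd q" "fst q"] by (simp add: g_def \<Psi>_def prod_eq_iff)
  moreover have "continuous_on slit \<Psi>"
    unfolding \<Psi>_def[abs_def] by (intro continuous_intros smooth_on_imp_continuous_on smooth_on_G)
  ultimately have "(g has_derivative inv \<Psi>') (at (\<Psi> p))"
    using has_derivative_inverse_strong[OF open_slit p _ _ der] by blast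
  moreover have "\<Psi> p = (t, \<xi>)" by (simp add: \<Psi>_def p_def G_vel assms)
  ultimately have "((\<lambda>q. snd (g q)) has_derivative (\<lambda>q. snd (inv \<Psi>' q))) (at (t, \<xi>))"
    using has_derivative_snd by metis
  then show ?thesis by (auto simp: g_def)
qed

lemma continuous_on_vel: "continuous_on slit (\<lambda>q. vel (fst q) (snd q))"
proof (rule continuous_at_imp_continuous_on, rule ballI)
  fix q :: "real \<times> (real ^ 'n)" assume "q \<in> slit"
  then show "isCont (\<lambda>q. vel (fst q) (snd q)) q"
    using vel_has_derivative[of "snd q" "fst q"] has_derivative_continuous by auto
qed

lemma continuous_on_F_vel: "continuous_on slit (\<lambda>q. F (fst q) 0 (vel (fst q) (snd q)))"
  using continuous_on_compose2[OF continuous_on_F continuous_on_Pair[OF continuous_on_fst[OF continuous_on_id] continuous_on_vel]]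
  by simp

lemma continuous_on_ind: "continuous_on slit (\<lambda>q. ind (fst q) (snd q))"
  unfolding ind_def using F_vel_pos
  by (intro continuous_intros continuous_on_vel continuous_on_F_vel) (metis less_irrefl mem_Collect_eq)

lemma continuous_on_ind_time: "\<xi> \<noteq> 0 \<Longrightarrow> continuous_on S (\<lambda>t. ind t \<xi>)"
  using continuous_on_compose2[OF continuous_on_ind, of S "\<lambda>t. (t, \<xi>)"]
    continuous_on_Pair[OF continuous_on_id continuous_on_const, of S \<xi>]
  by (simp add: image_subset_iff)

text \<open>Cramer's rule exhibits the time derivative of \<open>vel t \<xi>\<close> as a smooth function of \<open>(t, vel t \<xi>)\<close>.\<close>

definition Y :: "real \<times> (real ^ 'n) \<Rightarrow> real ^ 'n" where
  "Y p = (\<chi> k. det (\<chi> i j. if j = k then (- frechet_derivative G (at p) (1, 0)) $ i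
       else (\<chi> i j. dG p (axis j 1) $ i) $ i $ j) / det (\<chi> i j. dG p (axis j 1) $ i))"

lemma det_dG:
  assumes "p \<in> slit"
  shows "det (\<chi> i j. dG p (axis j 1) $ i) \<noteq> 0"
    and "(\<chi> i j. dG p (axis j 1) $ i) *v w = dG p w"
proof -
  have M: "(\<chi> i j. dG p (axis j 1) $ i) = matrix (dG p)" by (simp add: matrix_def)
  show eq: "(\<chi> i j. dG p (axis j 1) $ i) *v w = dG p w" for w
    unfolding M by (rule matrix_works) (use linear_dG[OF assms] in \<open>simp add: linear_matrix_vector_mul_eq\<close>)
  have "inj ((*v) (matrix (dG p)))"
  proof (rule linear_injective_0[THEN iffD2], simp, intro allI impI)
    fix w assume "matrix (dG p) *v w = 0"
    then have "dG p w = 0" using eq M by metis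
    then show "w = 0" using dG_pos[of "snd p" w "fst p"] assms by auto
  qed
  then show "det (\<chi> i j. dG p (axis j 1) $ i) \<noteq> 0"
    unfolding M by (simp add: inj_matrix_vector_mult invertible_det_nz[symmetric] invertible_left_inverse matrix_left_invertible_injective)
qed

lemma smooth_on_Y: "smooth_on slit Y"
proof -
  have comp: "smooth_on slit (\<lambda>p. frechet_derivative G (at p) w $ i)" for w i
    by (rule smooth_on_linear_image[OF open_slit bounded_linear_vec_nth smooth_on_derivative[OF smooth_on_G]])
  show ?thesis
    unfolding Y_def[abs_def]
  proof (intro smooth_on_vec_lambda smooth_on_divide smooth_on_det open_slit)
    fix k i j
    show "smooth_on slit (\<lambda>p. (\<chi> i j. dG p (axis j 1) $ i) $ i $ j)"
      by (simp add: dG_def comp)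
    show "smooth_on slit (\<lambda>p. (\<chi> i j. if j = k then (- frechet_derivative G (at p) (1, 0)) $ i
        else (\<chi> i j. dG p (axis j 1) $ i) $ i $ j) $ i $ j)"
      by (cases "j = k") (simp_all add: dG_def comp smooth_on_uminus open_slit)
  qed (use det_dG in auto)
qed

text \<open>Differentiating \<open>G (t, vel t \<xi>) = \<xi>\<close> gives a linear equation for
  the velocity, which \<open>Y\<close> solves. Thus \<open>(t, vel t \<xi>)\<close> is an integral
  curve of a smooth field, and higher derivatives follow.\<close>

lemma vel_has_vector_derivative:
  assumes "\<xi> \<noteq> 0"
  shows "((\<lambda>t. vel t \<xi>) has_vector_derivative Y (t, vel t \<xi>)) (at t)"
proof -
  obtain f' where f': "((\<lambda>q. vel (fst q) (snd q)) has_derivative f') (at (t, \<xi>))"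
    using vel_has_derivative[OF assms] by blast
  have "((\<lambda>t. (t, \<xi>)) has_vector_derivative (1, 0)) (at t)"
    by (auto intro!: derivative_eq_intros has_vector_derivative_Pair)
  from vector_derivative_diff_chain_within[OF this, of "\<lambda>q. vel (fst q) (snd q)" f'] f'
  have y: "((\<lambda>t. vel t \<xi>) has_vector_derivative f' (1, 0)) (at t)"
    by (simp add: o_def has_derivative_at_withinI)
  define p where "p = (t, vel t \<xi>)"
  have p: "p \<in> slit" by (simp add: p_def vel_nonzero assms)
  have "((\<lambda>t. (t, vel t \<xi>)) has_vector_derivative (1, f' (1, 0))) (at t)"
    by (intro has_vector_derivative_Pair y) simp
  from vector_derivative_diff_chain_within[OF this, of G "frechet_derivative G (at p)"] G_has_derivative[OF p]
  have "((\<lambda>t. G (t, vel t \<xi>)) has_vector_derivative frechet_derivative G (at p) (1, f' (1, 0))) (at t)"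
    by (simp add: o_def has_derivative_at_withinI p_def)
  moreover have "(\<lambda>t. G (t, vel t \<xi>)) = (\<lambda>t. \<xi>)" by (simp add: G_vel assms)
  ultimately have "frechet_derivative G (at p) (1, f' (1, 0)) = 0"
    using vector_derivative_unique_at has_vector_derivative_const by metis
  then have "dG p (f' (1, 0)) = - frechet_derivative G (at p) (1, 0)"
    using G_derivative_split[OF p, of 1 "f' (1, 0)"] by (simp add: eq_neg_iff_add_eq_0 add.commute)
  then have "f' (1, 0) = Y p"
    unfolding Y_def by (subst cramer[OF det_dG(1)[OF p], symmetric]) (simp only: det_dG(2)[OF p])
  then show ?thesis using y by (simp add: p_def)
qed

subsection \<open>The displacement of a wave\<close>

definition disp :: "real \<Rightarrow> real ^ 'n \<Rightarrow> real ^ 'n" where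
  "disp t \<xi> = integral {0..t} (\<lambda>s. ind s \<xi>)"

lemma disp_0: "disp 0 \<xi> = 0"
  by (simp add: disp_def)

lemma disp_scale: "a > 0 \<Longrightarrow> \<xi> \<noteq> 0 \<Longrightarrow> disp t (a *\<^sub>R \<xi>) = disp t \<xi>"
  by (simp add: disp_def ind_scale)

lemma disp_has_vector_derivative:
  assumes "\<xi> \<noteq> 0" "t \<ge> 0"
  shows "((\<lambda>t. disp t \<xi>) has_vector_derivative ind t \<xi>) (at t within {0..})"
proof -
  have "((\<lambda>t. disp t \<xi>) has_vector_derivative ind t \<xi>) (at t within {0..t + 1})"
    unfolding disp_def
    by (rule integral_has_vector_derivative[OF continuous_on_ind_time[OF assms(1)]]) (use assms in auto)
  moreover have "at t within {0..t + 1} = at t within {0..}"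
    by (rule at_within_nhd[of t "{..<t + 1}"]) auto
  ultimately show ?thesis by simp
qed

text \<open>This continuity in the covector makes the support function of
  \<open>displacements t\<close> differentiable, and hence that body strictly convex.\<close>

lemma continuous_on_disp: "continuous_on (- {0}) (disp t)"
proof -
  have "continuous_on ((- {0}) \<times> cbox 0 t) (\<lambda>(\<xi>, s). ind s \<xi>)"
    using continuous_on_compose2[OF continuous_on_ind continuous_on_swap, of "(- {0}) \<times> cbox 0 t"]
    by (simp add: case_prod_unfold prod.swap_def image_subset_iff)
  from integral_continuous_on_param[OF this] show ?thesis by (simp add: disp_def[abs_def])
qed

lemma inner_disp:
  "\<xi> \<noteq> 0 \<Longrightarrow> ((\<lambda>s. \<zeta> \<bullet> ind s \<xi>) has_integral \<zeta> \<bullet> disp t \<xi>) {0..t}"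
  unfolding disp_def
  using has_integral_linear[OF integrable_integral[OF integrable_continuous_real[OF continuous_on_ind_time]]
      bounded_linear_inner_right[of \<zeta>]]
  by (simp add: o_def)

lemma inner_disp_le:
  assumes "\<xi> \<noteq> 0" "\<zeta> \<noteq> 0"
  shows "\<zeta> \<bullet> disp t \<xi> \<le> \<zeta> \<bullet> disp t \<zeta>"
  by (rule has_integral_le[OF inner_disp[OF assms(1)] inner_disp[OF assms(2)]])
    (use inner_le_inner_ind[OF assms(2)] F_ind[OF assms(1)] in force)

text \<open>The rate of growth is \<open>\<xi> \<bullet> ind t \<xi>\<close>, which equals
  \<open>F t 0 (vel t \<xi>)\<close> and is positive. A bound on displacements thereby becomes a
  bound on arrival times.\<close>

lemma inner_disp_strict_mono:
  assumes "\<xi> \<noteq> 0" "0 \<le> s" "s < t"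
  shows "\<xi> \<bullet> disp s \<xi> < \<xi> \<bullet> disp t \<xi>"
proof (rule DERIV_pos_imp_increasing_open[OF assms(3)])
  have der: "((\<lambda>t. \<xi> \<bullet> disp t \<xi>) has_vector_derivative \<xi> \<bullet> ind x \<xi>) (at x within {0..})" if "x \<ge> 0" for x
    by (rule bounded_linear.has_vector_derivative[OF bounded_linear_inner_right
          disp_has_vector_derivative[OF assms(1) that]])
  fix x assume x: "s < x" "x < t"
  then have "at x within {0..} = at x"
    using at_within_interior[of x "{0..}"] assms(2) by simp
  then show "\<exists>y. ((\<lambda>t. \<xi> \<bullet> disp t \<xi>) has_real_derivative y) (at x) \<and> y > 0"
    using der[of x] x assms inner_ind[OF assms(1)] F_vel_pos[OF assms(1)]
    by (auto simp: has_real_derivative_iff_has_vector_derivative)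
next
  have "continuous_on {0..} (\<lambda>t. disp t \<xi>)"
    using disp_has_vector_derivative[OF assms(1)] has_vector_derivative_continuous
      continuous_on_eq_continuous_within by (metis atLeast_iff)
  then have "continuous_on {s..t} (\<lambda>t. disp t \<xi>)" by (rule continuous_on_subset) (use assms in auto)
  then show "continuous_on {s..t} (\<lambda>t. \<xi> \<bullet> disp t \<xi>)" by (intro continuous_intros)
qed

end

subsection \<open>First variation\<close>

text \<open>The velocity is carried as an explicit function, continuous up to both ends of the
  piece. At a corner of the whole curve, \<open>vector_derivative\<close> would give no usable
  value.\<close>

definition C1_curve :: "real \<Rightarrow> real \<Rightarrow> (real \<Rightarrow> 'a::real_normed_vector) \<Rightarrow> (real \<Rightarrow> 'a) \<Rightarrow> bool" where
  "C1_curve c d \<gamma> g \<longleftrightarrow>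
     continuous_on {c..d} g \<and> (\<forall>s\<in>{c..d}. (\<gamma> has_vector_derivative g s) (at s within {c..d}))"

lemma smooth_curve_on_imp_C1_curve: "smooth_curve_on {c..d} \<gamma> \<Longrightarrow> \<exists>g. C1_curve c d \<gamma> g"
  by (metis smooth_curve_on_imp_C1 C1_curve_def)

lemma C1_curve_continuous_on: "C1_curve c d \<gamma> g \<Longrightarrow> continuous_on {c..d} \<gamma>"
  using C1_curve_def has_vector_derivative_continuous continuous_on_eq_continuous_within by metis

lemma C1_curve_at:
  assumes "C1_curve c d \<gamma> g" "c < s" "s < d"
  shows "(\<gamma> has_vector_derivative g s) (at s)"
proof -
  have "(\<gamma> has_vector_derivative g s) (at s within {c..d})" using assms by (simp add: C1_curve_def)
  moreover have "at s within {c..d} = at s" by (rule at_within_interior) (use assms in simp)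
  ultimately show ?thesis by simp
qed

lemma C1_curve_add_scaleR:
  assumes "C1_curve c d \<gamma> g" "C1_curve c d w k"
  shows "C1_curve c d (\<lambda>s. \<gamma> s + \<epsilon> *\<^sub>R w s) (\<lambda>s. g s + \<epsilon> *\<^sub>R k s)"
  using assms unfolding C1_curve_def
  by (auto intro!: continuous_intros has_vector_derivative_add
      bounded_linear.has_vector_derivative[OF bounded_linear_scaleR_right])

lemma piecewise_smooth_onE:
  assumes "piecewise_smooth_on I \<gamma>" "a < b" "{a..b} \<subseteq> I"
  obtains P where "finite P" "continuous_on {a..b} \<gamma>"
    "\<And>c d. a \<le> c \<Longrightarrow> c < d \<Longrightarrow> d \<le> b \<Longrightarrow> {c<..<d} \<inter> P = {} \<Longrightarrow> smooth_curve_on {c..d} \<gamma>"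
proof -
  have "continuous_on {a..b} \<gamma> \<and> (\<exists>P. finite P \<and>
      (\<forall>c d. a \<le> c \<and> c < d \<and> d \<le> b \<and> {c<..<d} \<inter> P = {} \<longrightarrow> smooth_curve_on {c..d} \<gamma>))"
    using assms(1)[unfolded piecewise_smooth_on_def, rule_format, of a b] assms(2,3) by simp
  then obtain P where "continuous_on {a..b} \<gamma>" "finite P"
    and P: "\<forall>c d. a \<le> c \<and> c < d \<and> d \<le> b \<and> {c<..<d} \<inter> P = {} \<longrightarrow> smooth_curve_on {c..d} \<gamma>"
    by (elim conjE exE)
  then show ?thesis by (intro that[of P]) simp_all
qed

lemma piece_around:
  fixes s :: real
  assumes "finite P" "s \<in> {a<..<b} - P"
  obtains c d where "a \<le> c" "c < s" "s < d" "d \<le> b" "{c<..<d} \<inter> P = {}"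
proof -
  have "open ({a<..<b} - P)" using assms(1) by (intro open_Diff) (auto intro: finite_imp_closed)
  then obtain e where e: "e > 0" "ball s e \<subseteq> {a<..<b} - P"
    using assms(2) open_contains_ball by blast
  then have sub: "{s - e<..<s + e} \<subseteq> {a<..<b} - P" by (simp add: ball_eq_greaterThanLessThan)
  then have "{s - e<..<s + e} \<subseteq> {a<..<b}" by blast
  then have "a \<le> s - e" "s + e \<le> b" using e(1) by (simp_all add: greaterThanLessThan_subseteq_greaterThanLessThan)
  moreover have "{s - e<..<s + e} \<inter> P = {}" using sub by blast
  ultimately show ?thesis using that[of "s - e" "s + e"] e(1) by simp
qed

context time_only_finsler
begin

abbreviation L :: "real \<times> (real ^ 'n) \<Rightarrow> real \<times> (real ^ 'n) \<Rightarrow> real" where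
  "L \<equiv> lorentz_finsler F"

lemma L_eq: "L p V = (fst V)\<^sup>2 - 2 * E (fst p, snd V)"
  by (simp add: lorentz_finsler_def F_squared)

text \<open>The expected derivative at \<open>\<epsilon> = 0\<close> of the Lagrangian along
  \<open>\<gamma> + \<epsilon> w\<close>. Two-sided derivatives are used, so the formula is
  meaningful away from finitely many break points.\<close>

definition variation :: "(real \<Rightarrow> real \<times> (real ^ 'n)) \<Rightarrow> (real \<Rightarrow> real \<times> (real ^ 'n)) \<Rightarrow> real \<Rightarrow> real" where
  "variation \<gamma> w s =
     (let q = (fst (\<gamma> s), snd (vector_derivative \<gamma> (at s))); k = vector_derivative w (at s) in
      2 * fst (vector_derivative \<gamma> (at s)) * fst k - 2 * (fst (w s) * Et q + G q \<bullet> snd k))"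

definition varied_lagrangian where
  "varied_lagrangian a b \<gamma> w \<epsilon> s =
     L (\<gamma> s + \<epsilon> *\<^sub>R w s) (vector_derivative (\<lambda>s. \<gamma> s + \<epsilon> *\<^sub>R w s) (at s within {a..b}))"

text \<open>Differentiation under the integral sign. It requires the varied spatial velocities to
  stay off the origin, uniformly on the piece, since \<open>E\<close> is smooth only there.\<close>

lemma first_variation_piece:
  assumes "a \<le> c" "c < d" "d \<le> b" and \<gamma>: "C1_curve c d \<gamma> g" and w: "C1_curve c d w k"
    and nz: "\<And>s. s \<in> {c..d} \<Longrightarrow> snd (g s) \<noteq> 0"
  shows "((\<lambda>\<epsilon>. integral {c..d} (varied_lagrangian a b \<gamma> w \<epsilon>)) has_real_derivative
      integral {c..d} (variation \<gamma> w)) (at 0)"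
    and "variation \<gamma> w integrable_on {c..d}"
    and "\<forall>\<^sub>F \<epsilon> in nhds 0. varied_lagrangian a b \<gamma> w \<epsilon> integrable_on {c..d}"
proof -
  have cont: "continuous_on {c..d} g" "continuous_on {c..d} k" "continuous_on {c..d} \<gamma>" "continuous_on {c..d} w"
    using \<gamma> w C1_curve_continuous_on by (auto simp: C1_curve_def)
  have "\<exists>s\<in>{c..d}. \<forall>r\<in>{c..d}. norm (snd (g s)) \<le> norm (snd (g r))"
    by (rule continuous_attains_inf) (use assms(2) in \<open>auto intro!: continuous_intros cont\<close>)
  then obtain s0 where s0: "s0 \<in> {c..d}" "\<And>r. r \<in> {c..d} \<Longrightarrow> norm (snd (g s0)) \<le> norm (snd (g r))" by blast
  have "\<exists>s\<in>{c..d}. \<forall>r\<in>{c..d}. norm (snd (k r)) \<le> norm (snd (k s))"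
    by (rule continuous_attains_sup) (use assms(2) in \<open>auto intro!: continuous_intros cont\<close>)
  then obtain s1 where s1: "\<And>r. r \<in> {c..d} \<Longrightarrow> norm (snd (k r)) \<le> norm (snd (k s1))" by blast
  \<comment> \<open>Minimal speed of \<open>\<gamma>\<close> over maximal speed of \<open>w\<close>;
    the summand 1 avoids division by zero and makes the later estimate strict.\<close>
  define e where "e = norm (snd (g s0)) / (norm (snd (k s1)) + 1)"
  have e: "e > 0" using nz[OF s0(1)] by (simp add: e_def add_nonneg_pos)
  define U where "U = {-e<..<e}"
  define q where "q \<epsilon> s = (fst (\<gamma> s) + \<epsilon> * fst (w s), snd (g s) + \<epsilon> *\<^sub>R snd (k s))" for \<epsilon> s
  have q: "q \<epsilon> s \<in> slit" if "\<epsilon> \<in> U" "s \<in> {c..d}" for \<epsilon> s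
  proof -
    have "norm (\<epsilon> *\<^sub>R snd (k s)) \<le> \<bar>\<epsilon>\<bar> * norm (snd (k s1))" using s1[OF that(2)] by (simp add: mult_left_mono)
    also have "\<dots> \<le> \<bar>\<epsilon>\<bar> * (norm (snd (k s1)) + 1)" by (simp add: mult_left_mono)
    also have "\<dots> < e * (norm (snd (k s1)) + 1)"
      by (rule mult_strict_right_mono) (use that(1) in \<open>auto simp: U_def add_nonneg_pos\<close>)
    also have "\<dots> = norm (snd (g s0))" using add_nonneg_pos[OF norm_ge_zero[of "snd (k s1)"] zero_less_one] by (simp add: e_def)
    also have "\<dots> \<le> norm (snd (g s))" by (rule s0(2)[OF that(2)])
    finally have "snd (g s) + \<epsilon> *\<^sub>R snd (k s) \<noteq> 0"
      by (metis add.inverse_unique less_irrefl norm_minus_cancel)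
    then show ?thesis by (simp add: q_def)
  qed
  define f where "f \<epsilon> s = (fst (g s) + \<epsilon> * fst (k s))\<^sup>2 - 2 * E (q \<epsilon> s)" for \<epsilon> s
  define fx where "fx \<epsilon> s = 2 * (fst (g s) + \<epsilon> * fst (k s)) * fst (k s) -
      2 * (fst (w s) * Et (q \<epsilon> s) + G (q \<epsilon> s) \<bullet> snd (k s))" for \<epsilon> s
  have der: "((\<lambda>\<epsilon>. f \<epsilon> s) has_field_derivative fx \<epsilon> s) (at \<epsilon> within U)"
    if "\<epsilon> \<in> U" "s \<in> cbox c d" for \<epsilon> s
  proof -
    have derq: "((\<lambda>\<epsilon>. q \<epsilon> s) has_derivative (\<lambda>h. (h * fst (w s), h *\<^sub>R snd (k s)))) (at \<epsilon>)"
      unfolding q_def by (auto intro!: derivative_eq_intros)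
    have "q \<epsilon> s \<in> slit" using q that by simp
    from has_derivative_compose[OF derq E_has_derivative[OF this]]
    have "((\<lambda>\<epsilon>. E (q \<epsilon> s)) has_derivative
        (\<lambda>h. h * (fst (w s) * Et (q \<epsilon> s) + G (q \<epsilon> s) \<bullet> snd (k s)))) (at \<epsilon>)"
      by (simp add: distrib_left mult.assoc)
    then have "((\<lambda>\<epsilon>. E (q \<epsilon> s)) has_real_derivative
        fst (w s) * Et (q \<epsilon> s) + G (q \<epsilon> s) \<bullet> snd (k s)) (at \<epsilon>)"
      unfolding has_field_derivative_def by (simp only: mult_commute_abs)
    then have "((\<lambda>\<epsilon>. f \<epsilon> s) has_real_derivative fx \<epsilon> s) (at \<epsilon>)"
      unfolding f_def fx_def by (auto intro!: derivative_eq_intros)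
    then show ?thesis by (rule has_field_derivative_at_within)
  qed
  have contq: "continuous_on (U \<times> {c..d}) (\<lambda>(\<epsilon>, s). q \<epsilon> s)"
    unfolding q_def case_prod_unfold
    by (intro continuous_intros continuous_on_compose2[OF cont(1)] continuous_on_compose2[OF cont(2)]
        continuous_on_compose2[OF cont(3)] continuous_on_compose2[OF cont(4)]) auto
  have contEt: "continuous_on (U \<times> {c..d}) (\<lambda>z. Et (q (fst z) (snd z)))"
    and contG: "continuous_on (U \<times> {c..d}) (\<lambda>z. G (q (fst z) (snd z)))"
    using continuous_on_compose2[OF smooth_on_imp_continuous_on[OF smooth_on_Et] contq]
      continuous_on_compose2[OF smooth_on_imp_continuous_on[OF smooth_on_G] contq] q
    by (simp_all add: case_prod_unfold image_subset_iff)
  have contfx: "continuous_on (U \<times> cbox c d) (\<lambda>(\<epsilon>, s). fx \<epsilon> s)"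
    unfolding fx_def case_prod_unfold box_real
    by (intro continuous_intros contEt contG continuous_on_compose2[OF cont(1)] continuous_on_compose2[OF cont(2)]
        continuous_on_compose2[OF cont(4)]) auto
  have intf: "f \<epsilon> integrable_on cbox c d" if "\<epsilon> \<in> U" for \<epsilon>
  proof -
    have "continuous_on {c..d} (\<lambda>s. q \<epsilon> s)" unfolding q_def by (intro continuous_intros cont)
    then have "continuous_on {c..d} (\<lambda>s. E (q \<epsilon> s))"
      by (rule continuous_on_compose2[OF continuous_on_E]) simp
    then have "continuous_on {c..d} (f \<epsilon>)" unfolding f_def[abs_def] by (intro continuous_intros cont)
    then show ?thesis using integrable_continuous_real by simp
  qed
  \<comment> \<open>The ends of the piece are omitted: the derivative within \<open>{a..b}\<close>
    may fail to exist at a corner. Two points do not affect the integrals.\<close>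
  have eq1: "varied_lagrangian a b \<gamma> w \<epsilon> s = f \<epsilon> s" if "s \<in> {c..d} - {c, d}" for s \<epsilon>
  proof -
    have "((\<lambda>s. \<gamma> s + \<epsilon> *\<^sub>R w s) has_vector_derivative g s + \<epsilon> *\<^sub>R k s) (at s)"
      by (rule C1_curve_at[OF C1_curve_add_scaleR[OF \<gamma> w]]) (use that in auto)
    moreover have "at s within {a..b} = at s"
      by (rule at_within_interior) (use that assms(1,3) in auto)
    ultimately show ?thesis
      by (simp add: varied_lagrangian_def vector_derivative_at L_eq f_def q_def)
  qed
  have eq2: "variation \<gamma> w s = fx 0 s" if "s \<in> {c..d} - {c, d}" for s
    using vector_derivative_at[OF C1_curve_at[OF \<gamma>, of s]] vector_derivative_at[OF C1_curve_at[OF w, of s]] that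
    by (auto simp: variation_def fx_def q_def Let_def)
  have neg: "negligible {c, d}" by simp
  have int1: "integral {c..d} (varied_lagrangian a b \<gamma> w \<epsilon>) = integral (cbox c d) (f \<epsilon>)" for \<epsilon>
    using integral_spike[OF neg, of "{c..d}" "f \<epsilon>" "varied_lagrangian a b \<gamma> w \<epsilon>"] eq1 by simp
  have int2: "integral {c..d} (variation \<gamma> w) = integral (cbox c d) (fx 0)"
    using integral_spike[OF neg, of "{c..d}" "fx 0" "variation \<gamma> w"] eq2 by simp
  have U: "0 \<in> U" "convex U" "open U" using e by (auto simp: U_def)
  from leibniz_rule_field_derivative[OF der intf contfx U(1,2)]
  show "((\<lambda>\<epsilon>. integral {c..d} (varied_lagrangian a b \<gamma> w \<epsilon>)) has_real_derivative
      integral {c..d} (variation \<gamma> w)) (at 0)"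
    unfolding int1 int2 using at_within_open[OF U(1,3)] by simp
  have "continuous_on {c..d} (\<lambda>s. fx 0 s)"
    using continuous_on_compose2[OF contfx, of "{c..d}" "\<lambda>s. (0, s)"] U(1)
      continuous_on_Pair[OF continuous_on_const continuous_on_id, of "{c..d}" "0::real"]
    by (simp add: image_subset_iff)
  then have "fx 0 integrable_on {c..d}" by (rule integrable_continuous_real)
  then show "variation \<gamma> w integrable_on {c..d}" by (rule integrable_spike[OF _ neg]) (rule eq2)
  show "\<forall>\<^sub>F \<epsilon> in nhds 0. varied_lagrangian a b \<gamma> w \<epsilon> integrable_on {c..d}"
  proof (rule eventually_mono[OF eventually_nhds_in_open[OF U(3,1)]])
    fix \<epsilon> assume "\<epsilon> \<in> U"
    then have "f \<epsilon> integrable_on {c..d}" using intf by simp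
    then show "varied_lagrangian a b \<gamma> w \<epsilon> integrable_on {c..d}"
      by (rule integrable_spike[OF _ neg]) (rule eq1)
  qed
qed

lemma first_variation:
  assumes "finite P" "a < b"
    and \<gamma>: "\<And>c d. a \<le> c \<Longrightarrow> c < d \<Longrightarrow> d \<le> b \<Longrightarrow> {c<..<d} \<inter> P = {} \<Longrightarrow>
      \<exists>g. C1_curve c d \<gamma> g \<and> (\<forall>s\<in>{c..d}. snd (g s) \<noteq> 0)"
    and w: "piecewise_smooth_on {a..b} w"
  shows "((\<lambda>\<epsilon>. action L a b (\<lambda>s. \<gamma> s + \<epsilon> *\<^sub>R w s)) has_real_derivative
      integral {a..b} (variation \<gamma> w)) (at 0)"
    and "variation \<gamma> w integrable_on {a..b}"
proof -
  obtain Q where Q: "finite Q"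
    "\<And>c d. a \<le> c \<Longrightarrow> c < d \<Longrightarrow> d \<le> b \<Longrightarrow> {c<..<d} \<inter> Q = {} \<Longrightarrow> smooth_curve_on {c..d} w"
    using piecewise_smooth_onE[OF w \<open>a < b\<close> order_refl] by metis
  \<comment> \<open>Eventual integrability belongs to the invariant: without it the integrals over
    two adjacent pieces could not be added before differentiating in
    \<open>\<epsilon>\<close>.\<close>
  define R where "R c d \<longleftrightarrow>
    ((\<lambda>\<epsilon>. integral {c..d} (varied_lagrangian a b \<gamma> w \<epsilon>)) has_real_derivative
      integral {c..d} (variation \<gamma> w)) (at 0) \<and>
    variation \<gamma> w integrable_on {c..d} \<and>
    (\<forall>\<^sub>F \<epsilon> in nhds 0. varied_lagrangian a b \<gamma> w \<epsilon> integrable_on {c..d})" for c d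
  have "finite (P \<union> Q)" using assms(1) Q(1) by simp
  then have "R a b"
  proof (rule piecewise_induct[OF _ \<open>a < b\<close>])
    fix c d assume cd: "a \<le> c" "c < d" "d \<le> b" "{c<..<d} \<inter> (P \<union> Q) = {}"
    then have PQ: "{c<..<d} \<inter> P = {}" "{c<..<d} \<inter> Q = {}" by auto
    obtain g where g: "C1_curve c d \<gamma> g" "\<And>s. s \<in> {c..d} \<Longrightarrow> snd (g s) \<noteq> 0"
      using \<gamma>[OF cd(1-3) PQ(1)] by blast
    obtain k where k: "C1_curve c d w k"
      using smooth_curve_on_imp_C1_curve[OF Q(2)[OF cd(1-3) PQ(2)]] by blast
    show "R c d" unfolding R_def
      by (intro conjI first_variation_piece[OF cd(1-3) g(1) k g(2)])
  next
    fix c m d assume cmd: "a \<le> c" "c < m" "m < d" "d \<le> b" and "R c m" "R m d"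
    then have der: "((\<lambda>\<epsilon>. integral {c..m} (varied_lagrangian a b \<gamma> w \<epsilon>) +
        integral {m..d} (varied_lagrangian a b \<gamma> w \<epsilon>)) has_real_derivative
        integral {c..m} (variation \<gamma> w) + integral {m..d} (variation \<gamma> w)) (at 0)"
      and int: "variation \<gamma> w integrable_on {c..m}" "variation \<gamma> w integrable_on {m..d}"
      and ev: "\<forall>\<^sub>F \<epsilon> in nhds 0. varied_lagrangian a b \<gamma> w \<epsilon> integrable_on {c..m} \<and>
        varied_lagrangian a b \<gamma> w \<epsilon> integrable_on {m..d}"
      unfolding R_def by (simp_all add: DERIV_add eventually_conj_iff)
    have int': "variation \<gamma> w integrable_on {c..d}"
      by (rule Henstock_Kurzweil_Integration.integrable_combine[where a = c and c = m and b = d]) (use cmd int in auto)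
    have ev': "\<forall>\<^sub>F \<epsilon> in nhds 0. varied_lagrangian a b \<gamma> w \<epsilon> integrable_on {c..d}"
      using ev by (rule eventually_mono)
        (rule Henstock_Kurzweil_Integration.integrable_combine[where a = c and c = m and b = d], use cmd in auto)
    have "integral {c..m} (variation \<gamma> w) + integral {m..d} (variation \<gamma> w) = integral {c..d} (variation \<gamma> w)"
      by (rule Henstock_Kurzweil_Integration.integral_combine) (use cmd int' in auto)
    moreover have "\<forall>\<^sub>F \<epsilon> in nhds 0. integral {c..m} (varied_lagrangian a b \<gamma> w \<epsilon>) +
        integral {m..d} (varied_lagrangian a b \<gamma> w \<epsilon>) = integral {c..d} (varied_lagrangian a b \<gamma> w \<epsilon>)"
      using ev' by (rule eventually_mono) (rule Henstock_Kurzweil_Integration.integral_combine, use cmd in auto)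
    ultimately have "((\<lambda>\<epsilon>. integral {c..d} (varied_lagrangian a b \<gamma> w \<epsilon>)) has_real_derivative
        integral {c..d} (variation \<gamma> w)) (at 0)"
      using der DERIV_cong_ev[OF refl, of "\<lambda>\<epsilon>. integral {c..m} (varied_lagrangian a b \<gamma> w \<epsilon>) +
        integral {m..d} (varied_lagrangian a b \<gamma> w \<epsilon>)" "\<lambda>\<epsilon>. integral {c..d} (varied_lagrangian a b \<gamma> w \<epsilon>)" 0]
      by simp
    then show "R c d" unfolding R_def using int' ev' by blast
  qed
  then show "((\<lambda>\<epsilon>. action L a b (\<lambda>s. \<gamma> s + \<epsilon> *\<^sub>R w s)) has_real_derivative
      integral {a..b} (variation \<gamma> w)) (at 0)" and "variation \<gamma> w integrable_on {a..b}"
    unfolding R_def action_def varied_lagrangian_def by blast+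
qed

end

subsection \<open>The Euler-Lagrange equation\<close>

lemma smooth_curve_on_affine:
  fixes \<gamma> :: "real \<Rightarrow> 'a::euclidean_space"
  assumes "\<And>s. s \<in> I \<Longrightarrow> \<gamma> s = p + s *\<^sub>R q"
  shows "smooth_curve_on I \<gamma>"
proof (rule integral_curve_smooth[OF open_UNIV smooth_on_const[OF open_UNIV, of q]])
  fix s assume "s \<in> I"
  have "((\<lambda>s. p + s *\<^sub>R q) has_vector_derivative q) (at s within I)"
    by (auto intro!: derivative_eq_intros)
  then show "(\<gamma> has_vector_derivative q) (at s within I)"
    using has_vector_derivative_transform[OF \<open>s \<in> I\<close>, of \<gamma> "\<lambda>s. p + s *\<^sub>R q" q] assms by blast
qed simp

context time_only_finsler
begin

definition momentum :: "(real \<Rightarrow> real \<times> (real ^ 'n)) \<Rightarrow> real \<Rightarrow> real ^ 'n" where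
  "momentum \<gamma> s = G (fst (\<gamma> s), snd (vector_derivative \<gamma> (at s)))"

text \<open>A field without time component leaves \<open>t\<close> fixed, so only the gradient of
  \<open>E\<close> in the velocity, that is the momentum, enters.\<close>

lemma variation_spatial:
  assumes "(f has_real_derivative f') (at s)"
  shows "variation \<gamma> (\<lambda>s. (0, f s *\<^sub>R u)) s = (- 2 * f') * (momentum \<gamma> s \<bullet> u)"
proof -
  have "((\<lambda>s. (0::real, f s *\<^sub>R u)) has_vector_derivative (0, f' *\<^sub>R u)) (at s)"
    using has_vector_derivative_scaleR[OF assms has_vector_derivative_const, of u]
    by (intro has_vector_derivative_Pair) simp_all
  from vector_derivative_at[OF this] show ?thesis
    by (simp add: variation_def momentum_def)
qed

text \<open>Criticality against all triangular bumps on \<open>[a, b]\<close> makes the primitive of the momentum affine.\<close>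

lemma momentum_primitive:
  assumes P: "finite P" "a < b"
    and \<gamma>: "\<And>c d. a \<le> c \<Longrightarrow> c < d \<Longrightarrow> d \<le> b \<Longrightarrow> {c<..<d} \<inter> P = {} \<Longrightarrow>
      \<exists>g. C1_curve c d \<gamma> g \<and> (\<forall>s\<in>{c..d}. snd (g s) \<noteq> 0)"
    and crit: "critical_curve L a b \<gamma>"
  shows "(\<lambda>s. momentum \<gamma> s \<bullet> u) integrable_on {a..b}"
    and "x \<in> {a..b} \<Longrightarrow> integral {a..x} (\<lambda>s. momentum \<gamma> s \<bullet> u) =
      (x - a) * (integral {a..b} (\<lambda>s. momentum \<gamma> s \<bullet> u) / (b - a))"
proof -
  define M where "M = (\<lambda>s. momentum \<gamma> s \<bullet> u)"
  \<comment> \<open>With slope 1 the variation is \<open>-2\<close> times the momentum component, so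
    integrability of the variation passes to the momentum.\<close>
  have "smooth_curve_on {a..b} (\<lambda>s. (0::real, s *\<^sub>R u))"
    by (rule smooth_curve_on_affine[of _ _ 0 "(0, u)"]) simp
  then have "variation \<gamma> (\<lambda>s. (0, s *\<^sub>R u)) integrable_on {a..b}"
    using first_variation(2)[OF P \<gamma>] smooth_curve_on_imp_piecewise by blast
  moreover have "variation \<gamma> (\<lambda>s. (0, s *\<^sub>R u)) = (\<lambda>s. (- 2) *\<^sub>R M s)"
    using variation_spatial[where f = "\<lambda>s. s" and f' = 1 and u = u and \<gamma> = \<gamma>] by (auto simp: fun_eq_iff M_def)
  ultimately show int: "(\<lambda>s. momentum \<gamma> s \<bullet> u) integrable_on {a..b}"
    using integrable_cmul[of "\<lambda>s. (- 2) *\<^sub>R M s" "{a..b}" "- 1 / 2"] by (simp add: M_def)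
  have main: "integral {a..m} M = (m - a) * (integral {a..b} M / (b - a))" if m: "a < m" "m < b" for m
  proof -
    \<comment> \<open>The tent with height 1 at \<open>m\<close> and zeros at \<open>a\<close> and
      \<open>b\<close>. Its slopes \<open>1 / (m - a)\<close> and \<open>-1 / (b - m)\<close> turn
      criticality into equality of the means of \<open>M\<close> over \<open>{a..m}\<close> and
      \<open>{m..b}\<close>.\<close>
    define f where "f s = min ((s - a) / (m - a)) ((b - s) / (b - m))" for s
    have f1: "f s = (s - a) / (m - a)" if "s \<le> m" for s
    proof -
      have "(s - a) / (m - a) \<le> 1" "1 \<le> (b - s) / (b - m)" using that m by (simp_all add: field_simps)
      then show ?thesis by (simp add: f_def)
    qed
    have f2: "f s = (b - s) / (b - m)" if "m \<le> s" for s
    proof -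
      have "1 \<le> (s - a) / (m - a)" "(b - s) / (b - m) \<le> 1" using that m by (simp_all add: field_simps)
      then show ?thesis by (simp add: f_def)
    qed
    define w where "w s = (0::real, f s *\<^sub>R u)" for s
    have "piecewise_smooth_on {a..b} w"
      unfolding piecewise_smooth_on_def
    proof (intro allI impI conjI exI[of _ "{m}"])
      fix a' b' :: real
      have "m - a \<noteq> 0" "b - m \<noteq> 0" using m by auto
      then show "continuous_on {a'..b'} w" unfolding w_def f_def by (intro continuous_intros) auto
      fix c d assume "a' \<le> c \<and> c < d \<and> d \<le> b' \<and> {c<..<d} \<inter> {m} = {}"
      then consider "d \<le> m" | "m \<le> c" by force
      then show "smooth_curve_on {c..d} w"
      proof cases
        case 1
        show ?thesis
          by (rule smooth_curve_on_affine[of _ _ "(0, (- a / (m - a)) *\<^sub>R u)" "(0, (1 / (m - a)) *\<^sub>R u)"])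
            (use 1 in \<open>simp add: w_def f1 scaleR_diff_left diff_divide_distrib\<close>)
      next
        case 2
        show ?thesis
          by (rule smooth_curve_on_affine[of _ _ "(0, (b / (b - m)) *\<^sub>R u)" "(0, (- 1 / (b - m)) *\<^sub>R u)"])
            (use 2 in \<open>simp add: w_def f2 scaleR_diff_left diff_divide_distrib\<close>)
      qed
    qed simp
    note fv = first_variation[OF P \<gamma> this]
    have "w a = 0" "w b = 0" using m by (auto simp: w_def f1 f2 zero_prod_def)
    then have "((\<lambda>\<epsilon>. action L a b (\<lambda>s. \<gamma> s + \<epsilon> *\<^sub>R w s)) has_real_derivative 0) (at 0)"
      using crit \<open>piecewise_smooth_on {a..b} w\<close> unfolding critical_curve_def by blast
    then have zero: "integral {a..b} (variation \<gamma> w) = 0" using DERIV_unique[OF fv(1)] by blast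
    have v1: "variation \<gamma> w s = (- 2 / (m - a)) * M s" if "s \<in> {a..m} - {m}" for s
    proof -
      have "(f has_real_derivative 1 / (m - a)) (at s)"
        by (rule has_field_derivative_transform_within_open[of "\<lambda>s. (s - a) / (m - a)" _ _ "{..<m}"])
          (use that in \<open>auto intro!: derivative_eq_intros simp: f1\<close>)
      from variation_spatial[OF this] show ?thesis by (simp add: w_def[abs_def] M_def)
    qed
    have v2: "variation \<gamma> w s = (2 / (b - m)) * M s" if "s \<in> {m..b} - {m}" for s
    proof -
      have "((\<lambda>s. (b - s) / (b - m)) has_real_derivative (0 - 1) / (b - m)) (at s)"
        by (intro DERIV_cdivide DERIV_diff DERIV_const DERIV_ident)
      then have "(f has_real_derivative (0 - 1) / (b - m)) (at s)"
        by (rule has_field_derivative_transform_within_open[of _ _ _ "{m<..}"])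
          (use that in \<open>simp_all add: f2\<close>)
      from variation_spatial[OF this] show ?thesis by (simp add: w_def[abs_def] M_def)
    qed
    have neg: "negligible {m}" by simp
    define X Y where "X = integral {a..m} M" and "Y = integral {m..b} M"
    have "integral {a..m} (variation \<gamma> w) = integral {a..m} (\<lambda>s. (- 2 / (m - a)) * M s)"
      by (rule integral_spike[OF neg]) (simp only: v1)
    then have "integral {a..m} (variation \<gamma> w) = (- 2 / (m - a)) * X"
      unfolding X_def by (simp only: integral_mult_right)
    moreover have "integral {m..b} (variation \<gamma> w) = integral {m..b} (\<lambda>s. (2 / (b - m)) * M s)"
      by (rule integral_spike[OF neg]) (simp only: v2)
    then have "integral {m..b} (variation \<gamma> w) = (2 / (b - m)) * Y"
      unfolding Y_def by (simp only: integral_mult_right)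
    moreover have "integral {a..m} (variation \<gamma> w) + integral {m..b} (variation \<gamma> w) = 0"
      unfolding zero[symmetric]
      by (rule Henstock_Kurzweil_Integration.integral_combine[OF less_imp_le[OF m(1)] less_imp_le[OF m(2)] fv(2)])
    moreover have XY: "X + Y = integral {a..b} M"
      unfolding M_def X_def Y_def
      by (rule Henstock_Kurzweil_Integration.integral_combine[OF less_imp_le[OF m(1)] less_imp_le[OF m(2)] int])
    ultimately have "X / (m - a) = Y / (b - m)" by simp
    then have "X * (b - m) = Y * (m - a)" using m by (simp add: frac_eq_eq)
    moreover have "Y = integral {a..b} M - X" using XY by linarith
    ultimately have "X * (b - m) = (integral {a..b} M - X) * (m - a)" by simp
    then have "X * (b - a) = integral {a..b} M * (m - a)" by (simp add: algebra_simps)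
    then show ?thesis using m by (simp add: eq_divide_eq mult.commute X_def)
  qed
  show "integral {a..x} (\<lambda>s. momentum \<gamma> s \<bullet> u) =
      (x - a) * (integral {a..b} (\<lambda>s. momentum \<gamma> s \<bullet> u) / (b - a))" if "x \<in> {a..b}"
    using main[of x] that P(2) unfolding M_def by (cases "x = a"; cases "x = b") auto
qed

text \<open>Off the break points the momentum is continuous, so the affine primitive may be
  differentiated. Its slope belongs to the whole interval, hence the value is the same on both sides
  of each corner.\<close>

lemma momentum_constant:
  assumes P: "finite P" "a < b"
    and \<gamma>: "\<And>c d. a \<le> c \<Longrightarrow> c < d \<Longrightarrow> d \<le> b \<Longrightarrow> {c<..<d} \<inter> P = {} \<Longrightarrow>
      \<exists>g. C1_curve c d \<gamma> g \<and> (\<forall>s\<in>{c..d}. snd (g s) \<noteq> 0)"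
    and crit: "critical_curve L a b \<gamma>"
  obtains \<xi> where "\<And>s. s \<in> {a<..<b} - P \<Longrightarrow> momentum \<gamma> s = \<xi>"
proof -
  have const: "momentum \<gamma> s \<bullet> u = integral {a..b} (\<lambda>s. momentum \<gamma> s \<bullet> u) / (b - a)"
    if s: "s \<in> {a<..<b} - P" for s u
  proof -
    define M where "M = (\<lambda>s. momentum \<gamma> s \<bullet> u)"
    define k where "k = integral {a..b} M / (b - a)"
    note prim = momentum_primitive[OF P \<gamma> crit, where u = u, folded M_def, folded k_def]
    obtain c d where cd: "a \<le> c" "c < s" "s < d" "d \<le> b" "{c<..<d} \<inter> P = {}"
      using piece_around[OF P(1) s] .
    obtain g where g: "C1_curve c d \<gamma> g" "\<And>s. s \<in> {c..d} \<Longrightarrow> snd (g s) \<noteq> 0"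
      using \<gamma>[of c d] cd by force
    define q where "q r = (fst (\<gamma> r), snd (g r))" for r
    have "continuous_on {c..d} q"
      unfolding q_def using C1_curve_continuous_on[OF g(1)] g(1)
      by (intro continuous_intros) (auto simp: C1_curve_def)
    then have "continuous_on {c..d} (\<lambda>r. G (q r))"
      by (rule continuous_on_compose2[OF smooth_on_imp_continuous_on[OF smooth_on_G]])
        (use g(2) in \<open>auto simp: q_def\<close>)
    then have contq: "continuous_on {c..d} (\<lambda>r. G (q r) \<bullet> u)" by (intro continuous_intros)
    have Mq: "M r = G (q r) \<bullet> u" if "c < r" "r < d" for r
      using vector_derivative_at[OF C1_curve_at[OF g(1) that]] by (simp add: M_def momentum_def q_def)
    have neg: "negligible {c, d}" by simp
    have eq: "integral {c..x} (\<lambda>r. G (q r) \<bullet> u) = (x - c) * k" if x: "x \<in> {c..d}" for x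
    proof -
      have "integral {c..x} (\<lambda>r. G (q r) \<bullet> u) = integral {c..x} M"
        by (rule integral_spike[OF neg]) (use Mq x in auto)
      moreover have "M integrable_on {a..x}"
        by (rule integrable_subinterval_real[OF prim(1)]) (use x cd in auto)
      from Henstock_Kurzweil_Integration.integral_combine[OF _ _ this, of c]
      have "integral {a..c} M + integral {c..x} M = integral {a..x} M" using x cd by auto
      moreover have "integral {a..c} M = (c - a) * k" "integral {a..x} M = (x - a) * k"
        by (rule prim(2); use x cd in auto)+
      ultimately show ?thesis by (simp add: algebra_simps)
    qed
    have "((\<lambda>x. integral {c..x} (\<lambda>r. G (q r) \<bullet> u)) has_vector_derivative G (q s) \<bullet> u) (at s within {c..d})"
      by (rule integral_has_vector_derivative[OF contq]) (use cd in auto)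
    then have "((\<lambda>x. (x - c) * k) has_vector_derivative G (q s) \<bullet> u) (at s within {c..d})"
      by (rule has_vector_derivative_transform[rotated 2]) (use eq cd in auto)
    moreover have "((\<lambda>x. (x - c) * k) has_vector_derivative k) (at s within {c..d})"
      by (auto intro!: derivative_eq_intros simp: has_real_derivative_iff_has_vector_derivative[symmetric])
    ultimately have "G (q s) \<bullet> u = k"
      using vector_derivative_unique_within_closed_interval[of c d s] cd by auto
    then show ?thesis using Mq[OF cd(2,3)] by (simp add: M_def k_def)
  qed
  show ?thesis
  proof (cases "{a<..<b} - P = {}")
    case True
    then have "\<And>s. s \<in> {a<..<b} - P \<Longrightarrow> momentum \<gamma> s = 0" by (simp only: empty_iff)
    then show ?thesis by (rule that)
  next
    case False
    then obtain s0 where s0: "s0 \<in> {a<..<b} - P" by blast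
    have "momentum \<gamma> s = momentum \<gamma> s0" if "s \<in> {a<..<b} - P" for s
      by (rule vector_eq_rdot[THEN iffD1]) (use const[OF that] const[OF s0] in simp)
    then show ?thesis using that by blast
  qed
qed

end

section \<open>The explicit form of lightlike pregeodesics\<close>

lemma positive_velocity_increasing:
  assumes "is_interval J" "piecewise_smooth_on J h"
    and pos: "\<And>s v. s \<in> J \<Longrightarrow> one_sided_velocity J h s v \<Longrightarrow> v > (0::real)"
    and ab: "a \<in> J" "b \<in> J" "a < b"
  shows "h a < h b"
proof -
  have sub: "{a..b} \<subseteq> J"
    using mem_is_interval_1_I[OF assms(1) ab(1,2)] by (simp add: subset_iff)
  obtain P where P: "finite P"
    "\<And>c d. a \<le> c \<Longrightarrow> c < d \<Longrightarrow> d \<le> b \<Longrightarrow> {c<..<d} \<inter> P = {} \<Longrightarrow> smooth_curve_on {c..d} h"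
    using piecewise_smooth_onE[OF assms(2) ab(3) sub] by metis
  show ?thesis
  proof (rule piecewise_induct[where R = "\<lambda>c d. h c < h d", OF P(1) ab(3)])
    fix c d assume cd: "a \<le> c" "c < d" "d \<le> b" "{c<..<d} \<inter> P = {}"
    obtain g where g: "C1_curve c d h g" using smooth_curve_on_imp_C1_curve[OF P(2)[OF cd]] by blast
    have subcd: "{c..d} \<subseteq> J" using sub cd by auto
    have "g s > 0" if "s \<in> {c..d}" for s
    proof (rule pos)
      show "s \<in> J" using subcd that by auto
      show "one_sided_velocity J h s (g s)"
        by (rule one_sided_velocity_piece[OF subcd cd(2) that]) (use g that in \<open>simp add: C1_curve_def\<close>)
    qed
    then show "h c < h d"
      using C1_curve_at[OF g] cd
      by (intro DERIV_pos_imp_increasing_open[OF cd(2) _ C1_curve_continuous_on[OF g]])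
        (metis atLeastAtMost_iff has_real_derivative_iff_has_vector_derivative less_imp_le)
  qed auto
qed

context time_only_finsler
begin

lemma lightlike_piece:
  assumes "lightlike_curve_on F {0..} \<gamma>" "0 \<le> c" "c < d" "C1_curve c d \<gamma> g" "t \<in> {c..d}"
  shows "fst (g t) > 0" "F (fst (\<gamma> t)) 0 (snd (g t)) = fst (g t)"
proof -
  have "one_sided_velocity {0..} \<gamma> t (g t)"
    by (rule one_sided_velocity_piece[OF _ assms(3,5)]) (use assms in \<open>auto simp: C1_curve_def\<close>)
  moreover have "t \<in> {0..}" using assms(2,5) by simp
  ultimately have "fst (g t) > 0 \<and> L (\<gamma> t) (g t) = 0"
    using assms(1) unfolding lightlike_curve_on_def by blast
  then show "fst (g t) > 0" "F (fst (\<gamma> t)) 0 (snd (g t)) = fst (g t)"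
    using F_indep[of "fst (\<gamma> t)" "snd (\<gamma> t)" "snd (g t)"] F_nonneg[of "fst (\<gamma> t)" 0 "snd (g t)"]
    by (auto simp: lorentz_finsler_def power2_eq_iff_nonneg)
qed

text \<open>Constant momentum holds in the geodesic parameter. Returning to the time parameter
  rescales it by a positive factor, to which \<open>ind\<close> is insensitive; the lightlike
  condition normalizes the speed, and integration gives \<open>disp\<close>.\<close>

lemma lightlike_pregeodesic_segment:
  assumes light: "lightlike_curve_on F {0..} (\<lambda>t. (t, c t))"
    and geo: "pregeodesic_on L {0..} (\<lambda>t. (t, c t))" and "t > 0"
  obtains \<xi> where "\<xi> \<noteq> 0" "\<And>\<tau>. \<tau> \<in> {0..t} \<Longrightarrow> c \<tau> = c 0 + disp \<tau> \<xi>"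
proof -
  define \<gamma> where "\<gamma> = (\<lambda>t. (t, c t))"
  obtain J h where J: "is_interval J" "h ` J = {0..}" "piecewise_smooth_on J h"
    and pos: "\<And>s v. s \<in> J \<Longrightarrow> one_sided_velocity J h s v \<Longrightarrow> v > 0"
    and gJ: "geodesic_on L J (\<gamma> \<circ> h)"
    using geo unfolding pregeodesic_on_def \<gamma>_def by metis
  have incr: "h x < h y" if "x \<in> J" "y \<in> J" "x < y" for x y
    by (rule positive_velocity_increasing[OF J(1,3) pos that])
  obtain a b where ab: "a \<in> J" "h a = 0" "b \<in> J" "h b = t"
    using J(2) \<open>t > 0\<close> by (metis atLeast_iff imageE less_imp_le order_refl)
  have "a < b" using incr[of b a] ab \<open>t > 0\<close> by (metis less_asym linorder_neqE_linordered_idom)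
  have sub: "{a..b} \<subseteq> J"
    using mem_is_interval_1_I[OF J(1) ab(1,3)] by (simp add: subset_iff)
  have incr': "h x < h y" if "a \<le> x" "x < y" "y \<le> b" for x y
    by (rule incr) (use that sub in \<open>auto simp: subset_iff\<close>)
  have mono': "h x \<le> h y" if "a \<le> x" "x \<le> y" "y \<le> b" for x y
    using incr'[of x y] that by (cases "x = y") auto
  obtain Q where Q: "finite Q" "continuous_on {a..b} h"
    "\<And>c d. a \<le> c \<Longrightarrow> c < d \<Longrightarrow> d \<le> b \<Longrightarrow> {c<..<d} \<inter> Q = {} \<Longrightarrow> smooth_curve_on {c..d} h"
    using piecewise_smooth_onE[OF J(3) \<open>a < b\<close> sub] by metis
  have "piecewise_smooth_on {0..} \<gamma>"
    using light unfolding lightlike_curve_on_def regular_curve_on_def \<gamma>_def by blast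
  then obtain R where R: "finite R" "continuous_on {0..t} \<gamma>"
    "\<And>c d. 0 \<le> c \<Longrightarrow> c < d \<Longrightarrow> d \<le> t \<Longrightarrow> {c<..<d} \<inter> R = {} \<Longrightarrow> smooth_curve_on {c..d} \<gamma>"
    using piecewise_smooth_onE[of "{0..}" \<gamma> 0 t] \<open>t > 0\<close> by (metis Icc_subset_Ici_iff order_refl)
  \<comment> \<open>Break points of the reparametrization together with the parameters of the
    corners of \<open>\<gamma>\<close>; injectivity of \<open>h\<close> keeps the latter
    finite.\<close>
  define P where "P = Q \<union> (h -` R \<inter> {a..b})"
  have "inj_on h {a..b}"
    using incr' by (intro linorder_inj_onI') (metis atLeastAtMost_iff less_irrefl)
  then have "finite P" unfolding P_def using Q(1) R(1) by (simp add: finite_vimage_IntI)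
  have piece: "\<exists>g k. C1_curve x y h g \<and> C1_curve (h x) (h y) \<gamma> k \<and>
      C1_curve x y (\<gamma> \<circ> h) (\<lambda>s. g s *\<^sub>R k (h s)) \<and> (\<forall>s\<in>{x..y}. g s > 0) \<and> 0 \<le> h x \<and> h x < h y"
    if xy: "a \<le> x" "x < y" "y \<le> b" "{x<..<y} \<inter> P = {}" for x y
  proof -
    have hx: "0 \<le> h x" "h x < h y" "h y \<le> t"
      using mono'[of a x] mono'[of y b] incr'[of x y] xy ab by auto
    have conth: "continuous_on {x..y} h" by (rule continuous_on_subset[OF Q(2)]) (use xy in auto)
    have "{x<..<y} \<inter> Q = {}" using xy(4) unfolding P_def by blast
    then obtain g where g: "C1_curve x y h g"
      using smooth_curve_on_imp_C1_curve[OF Q(3)[OF xy(1-3)]] by blast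
    \<comment> \<open>A corner strictly between \<open>h x\<close> and \<open>h y\<close> would have
      a preimage by continuity, and that preimage would lie in \<open>P\<close>.\<close>
    have "{h x<..<h y} \<inter> R = {}"
    proof (rule ccontr)
      assume "{h x<..<h y} \<inter> R \<noteq> {}"
      then obtain z where z: "z \<in> R" "h x < z" "z < h y" by auto
      then obtain s where s: "x \<le> s" "s \<le> y" "h s = z"
        using IVT'[of h x z y] conth xy(2) by auto
      then have "s \<in> {x<..<y}" using z by (auto simp: less_le)
      moreover have "s \<in> P" using s z xy by (auto simp: P_def)
      ultimately show False using xy(4) by blast
    qed
    then obtain k where k: "C1_curve (h x) (h y) \<gamma> k"
      using smooth_curve_on_imp_C1_curve[OF R(3)[OF hx]] by blast
    have img: "h ` {x..y} \<subseteq> {h x..h y}" using mono' xy by auto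
    have subJ: "{x..y} \<subseteq> J" using xy sub by auto
    have gpos: "g s > 0" if "s \<in> {x..y}" for s
    proof (rule pos)
      show "s \<in> J" using subJ that by auto
      show "one_sided_velocity J h s (g s)"
        by (rule one_sided_velocity_piece[OF subJ xy(2) that]) (use g that in \<open>simp add: C1_curve_def\<close>)
    qed
    have "C1_curve x y (\<gamma> \<circ> h) (\<lambda>s. g s *\<^sub>R k (h s))"
      unfolding C1_curve_def
    proof (intro conjI ballI)
      have "continuous_on {x..y} (\<lambda>s. k (h s))"
        by (rule continuous_on_compose2[OF _ conth img]) (use k in \<open>simp add: C1_curve_def\<close>)
      then show "continuous_on {x..y} (\<lambda>s. g s *\<^sub>R k (h s))"
        using g unfolding C1_curve_def by (intro continuous_intros) auto
    next
      fix s assume s: "s \<in> {x..y}"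
      then have "h s \<in> {h x..h y}" using img by blast
      then have "(\<gamma> has_vector_derivative k (h s)) (at (h s) within h ` {x..y})"
        using k has_vector_derivative_within_subset[OF _ img] unfolding C1_curve_def by blast
      moreover have "(h has_vector_derivative g s) (at s within {x..y})"
        using g s by (simp add: C1_curve_def)
      ultimately show "(\<gamma> \<circ> h has_vector_derivative g s *\<^sub>R k (h s)) (at s within {x..y})"
        by (rule vector_diff_chain_within[rotated])
    qed
    then show ?thesis using g k gpos hx by blast
  qed
  have pieces: "\<exists>g. C1_curve x y (\<gamma> \<circ> h) g \<and> (\<forall>s\<in>{x..y}. snd (g s) \<noteq> 0)"
    if xy: "a \<le> x" "x < y" "y \<le> b" "{x<..<y} \<inter> P = {}" for x y
  proof -
    obtain g k where gk: "C1_curve (h x) (h y) \<gamma> k" "C1_curve x y (\<gamma> \<circ> h) (\<lambda>s. g s *\<^sub>R k (h s))"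
      "\<And>s. s \<in> {x..y} \<Longrightarrow> g s > 0" "0 \<le> h x" "h x < h y"
      using piece[OF xy] by metis
    have "snd (g s *\<^sub>R k (h s)) \<noteq> 0" if s: "s \<in> {x..y}" for s
    proof -
      have "h s \<in> {h x..h y}" using mono' s xy by auto
      from lightlike_piece[OF light[folded \<gamma>_def] gk(4,5,1) this] have "snd (k (h s)) \<noteq> 0"
        using F_0 by force
      then show ?thesis using gk(3)[OF s] by simp
    qed
    then show ?thesis using gk(2) by blast
  qed
  have crit: "critical_curve L a b (\<gamma> \<circ> h)" using gJ \<open>a < b\<close> sub unfolding geodesic_on_def by blast
  obtain \<xi> where \<xi>: "\<And>s. s \<in> {a<..<b} - P \<Longrightarrow> momentum (\<gamma> \<circ> h) s = \<xi>"
    by (rule momentum_constant[OF \<open>finite P\<close> \<open>a < b\<close> _ crit]) (erule (3) pieces, blast)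
  have vel: "\<xi> \<noteq> 0 \<and> (c has_vector_derivative ind (h s) \<xi>) (at (h s))" if s: "s \<in> {a<..<b} - P" for s
  proof -
    obtain x y where xy: "a \<le> x" "x < s" "s < y" "y \<le> b" "{x<..<y} \<inter> P = {}"
      using piece_around[OF \<open>finite P\<close> s] .
    then have "x < y" by simp
    obtain g k where gk: "C1_curve (h x) (h y) \<gamma> k" "C1_curve x y (\<gamma> \<circ> h) (\<lambda>s. g s *\<^sub>R k (h s))"
      "\<And>s. s \<in> {x..y} \<Longrightarrow> g s > 0" "0 \<le> h x" "h x < h y"
      using piece[OF xy(1) \<open>x < y\<close> xy(4,5)] by metis
    have hs: "h x < h s" "h s < h y" using incr' xy by auto
    have k: "(\<gamma> has_vector_derivative k (h s)) (at (h s))" by (rule C1_curve_at[OF gk(1) hs])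
    have "((\<lambda>t. fst (\<gamma> t)) has_vector_derivative fst (k (h s))) (at (h s))"
      by (rule bounded_linear.has_vector_derivative[OF bounded_linear_fst k])
    then have "fst (k (h s)) = 1"
      using vector_derivative_unique_at[of "\<lambda>t. t" _ "h s", OF _ has_vector_derivative_id]
      by (simp add: \<gamma>_def)
    have c: "(c has_vector_derivative snd (k (h s))) (at (h s))"
      using bounded_linear.has_vector_derivative[OF bounded_linear_snd k] by (simp add: \<gamma>_def)
    have F1: "F (h s) 0 (snd (k (h s))) = 1"
      using lightlike_piece(2)[OF light[folded \<gamma>_def] gk(4,5,1), of "h s"] hs \<open>fst (k (h s)) = 1\<close>
      by (simp add: \<gamma>_def)
    then have nz: "snd (k (h s)) \<noteq> 0" using F_0 by force
    have gs: "g s > 0" using gk(3) xy by simp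
    have "vector_derivative (\<gamma> \<circ> h) (at s) = g s *\<^sub>R k (h s)"
      by (rule vector_derivative_at[OF C1_curve_at[OF gk(2) xy(2,3)]])
    \<comment> \<open>The factor \<open>g s\<close> comes from the parametrization. Removing it
      identifies the velocity in \<open>t\<close> as the indicatrix point with normal
      \<open>\<xi>\<close>.\<close>
    then have \<xi>': "\<xi> = g s *\<^sub>R G (h s, snd (k (h s)))"
      using \<xi>[OF s] G_scale[OF gs nz] by (simp add: momentum_def \<gamma>_def)
    then have "ind (h s) \<xi> = snd (k (h s))"
      using ind_scale[OF gs G_nonzero[OF nz]] ind_G[OF nz, of "h s"] F1 by simp
    then show ?thesis using c \<xi>' gs G_nonzero[OF nz] by simp
  qed
  \<comment> \<open>A parameter off the break points is needed once to learn that
    \<open>\<xi>\<close> is nonzero.\<close>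
  have "infinite ({a<..<b} - P)" using \<open>a < b\<close> \<open>finite P\<close> infinite_Ioo by (simp add: Diff_infinite_finite)
  then obtain s0 where "s0 \<in> {a<..<b} - P" using infinite_imp_nonempty by blast
  then have "\<xi> \<noteq> 0" using vel by blast
  moreover have "c \<tau> = c 0 + disp \<tau> \<xi>" if \<tau>: "\<tau> \<in> {0..t}" for \<tau>
  proof -
    have "((\<lambda>s. ind s \<xi>) has_integral (c \<tau> - c 0)) {0..\<tau>}"
    proof (rule fundamental_theorem_of_calculus_interior_strong[of "h ` P"])
      show "finite (h ` P)" using \<open>finite P\<close> by simp
      show "0 \<le> \<tau>" using \<tau> by simp
      have "continuous_on {0..t} (\<lambda>t. snd (\<gamma> t))" by (intro continuous_intros R(2))
      then have "continuous_on {0..t} c" by (simp add: \<gamma>_def)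
      then show "continuous_on {0..\<tau>} c" by (rule continuous_on_subset) (use \<tau> in simp)
      fix z assume z: "z \<in> {0<..<\<tau>} - h ` P"
      then obtain s where s: "a \<le> s" "s \<le> b" "h s = z"
        using IVT'[of h a z b] Q(2) \<open>a < b\<close> ab \<tau> by auto
      have "s \<noteq> a" "s \<noteq> b" "s \<notin> P" using s z ab \<tau> by auto
      then have "s \<in> {a<..<b} - P" using s by auto
      from vel[OF this] s show "(c has_vector_derivative ind z \<xi>) (at z)" by simp
    qed
    then have "disp \<tau> \<xi> = c \<tau> - c 0" unfolding disp_def by (rule integral_unique)
    then show ?thesis by simp
  qed
  ultimately show ?thesis using that by blast
qed

text \<open>The momentum found on a segment could depend on the segment. The initial velocity
  determines it up to a positive factor, and \<open>disp\<close> ignores such factors.\<close>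

lemma lightlike_pregeodesic_eq:
  assumes "lightlike_curve_on F {0..} (\<lambda>t. (t, c t))" "pregeodesic_on L {0..} (\<lambda>t. (t, c t))"
    and v: "(c has_vector_derivative v) (at 0 within {0..})" and "t \<ge> 0"
  shows "v \<noteq> 0 \<and> c t = c 0 + disp t (G (0, v))"
proof -
  \<comment> \<open>Going to \<open>t + 1\<close> keeps the interval nondegenerate for
    \<open>t = 0\<close>, so that the one-sided derivative at \<open>0\<close> is unique.\<close>
  obtain \<xi> where \<xi>: "\<xi> \<noteq> 0" "\<And>\<tau>. \<tau> \<in> {0..t + 1} \<Longrightarrow> c \<tau> = c 0 + disp \<tau> \<xi>"
    using lightlike_pregeodesic_segment[OF assms(1,2), of "t + 1"] \<open>t \<ge> 0\<close> by auto
  have "((\<lambda>\<tau>. c 0 + disp \<tau> \<xi>) has_vector_derivative ind 0 \<xi>) (at 0 within {0..t + 1})"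
    using has_vector_derivative_add[OF has_vector_derivative_const
      has_vector_derivative_within_subset[OF disp_has_vector_derivative[OF \<xi>(1) order_refl]],
      of "{0..t + 1}" "c 0"] by simp
  then have "(c has_vector_derivative ind 0 \<xi>) (at 0 within {0..t + 1})"
    by (rule has_vector_derivative_transform[rotated 2]) (use \<open>t \<ge> 0\<close> in simp, rule \<xi>(2))
  moreover have "(c has_vector_derivative v) (at 0 within {0..t + 1})"
    by (rule has_vector_derivative_within_subset[OF v]) simp
  ultimately have "v = ind 0 \<xi>"
    using vector_derivative_unique_within_closed_interval[of 0 "t + 1" 0 c] \<open>t \<ge> 0\<close> by simp
  moreover have "G (0, ind 0 \<xi>) = inverse (F 0 0 (vel 0 \<xi>)) *\<^sub>R \<xi>"
    using G_scale[of "inverse (F 0 0 (vel 0 \<xi>))" "vel 0 \<xi>" 0] F_vel_pos[OF \<xi>(1), of 0 0]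
    by (simp add: ind_def vel_nonzero G_vel \<xi>(1))
  moreover have "disp t (inverse (F 0 0 (vel 0 \<xi>)) *\<^sub>R \<xi>) = disp t \<xi>"
    by (rule disp_scale) (use F_vel_pos[OF \<xi>(1), of 0 0] \<xi>(1) in simp_all)
  moreover have "c t = c 0 + disp t \<xi>" by (rule \<xi>(2)) (use \<open>t \<ge> 0\<close> in simp)
  ultimately show ?thesis using ind_nonzero[OF \<xi>(1)] by metis
qed

subsection \<open>Existence of trajectories\<close>

lemma inner_vel: "\<xi> \<noteq> 0 \<Longrightarrow> \<xi> \<bullet> vel t \<xi> = (F t 0 (vel t \<xi>))\<^sup>2"
  using G_euler[OF vel_nonzero, of \<xi> t t] by (simp add: G_vel F_squared)

text \<open>Differentiate \<open>E (t, vel t \<xi>) = \<xi> \<bullet> vel t \<xi> / 2\<close> in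
  time, by the chain rule on the left and linearly on the right.\<close>

lemma inner_Y:
  assumes "\<xi> \<noteq> 0"
  shows "\<xi> \<bullet> Y (t, vel t \<xi>) = - 2 * Et (t, vel t \<xi>)"
proof -
  have p: "(t, vel t \<xi>) \<in> slit" by (simp add: vel_nonzero assms)
  have "((\<lambda>t. (t, vel t \<xi>)) has_vector_derivative (1, Y (t, vel t \<xi>))) (at t)"
    by (intro has_vector_derivative_Pair vel_has_vector_derivative[OF assms]) simp
  from vector_derivative_diff_chain_within[OF this has_derivative_at_withinI[OF E_has_derivative[OF p]]]
  have "((\<lambda>t. E (t, vel t \<xi>)) has_vector_derivative Et (t, vel t \<xi>) + \<xi> \<bullet> Y (t, vel t \<xi>)) (at t)"
    by (simp add: o_def G_vel assms)
  moreover have "E (t, vel t \<xi>) = \<xi> \<bullet> vel t \<xi> / 2" for t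
    using inner_vel[OF assms, of t] by (simp add: F_squared)
  moreover have "((\<lambda>t. \<xi> \<bullet> vel t \<xi> / 2) has_vector_derivative \<xi> \<bullet> Y (t, vel t \<xi>) / 2) (at t)"
    by (rule bounded_linear.has_vector_derivative[OF bounded_linear_divide
          bounded_linear.has_vector_derivative[OF bounded_linear_inner_right vel_has_vector_derivative[OF assms]]])
  ultimately have "Et (t, vel t \<xi>) + \<xi> \<bullet> Y (t, vel t \<xi>) = \<xi> \<bullet> Y (t, vel t \<xi>) / 2"
    using vector_derivative_unique_at[of "\<lambda>t. \<xi> \<bullet> vel t \<xi> / 2"] by (simp only:)
  then show ?thesis by simp
qed

text \<open>With \<open>m\<close> denoting this function and \<open>dt / ds = m\<close>, the formula
  reads \<open>dm / ds = - Et\<close>, the time component of the Euler-Lagrange equations.\<close>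

lemma F_vel_has_derivative:
  assumes "\<xi> \<noteq> 0"
  shows "((\<lambda>t. F t 0 (vel t \<xi>)) has_vector_derivative - Et (t, vel t \<xi>) / F t 0 (vel t \<xi>)) (at t)"
proof -
  have eq: "F t 0 (vel t \<xi>) = sqrt (\<xi> \<bullet> vel t \<xi>)" for t
    using inner_vel[OF assms, of t] F_nonneg by simp
  have pos: "\<xi> \<bullet> vel t \<xi> > 0" using inner_vel[OF assms, of t] F_vel_pos[OF assms, of t 0] by simp
  have "((\<lambda>t. \<xi> \<bullet> vel t \<xi>) has_real_derivative \<xi> \<bullet> Y (t, vel t \<xi>)) (at t)"
    unfolding has_real_derivative_iff_has_vector_derivative
    by (rule bounded_linear.has_vector_derivative[OF bounded_linear_inner_right vel_has_vector_derivative[OF assms]])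
  from DERIV_chain2[OF DERIV_real_sqrt[OF pos] this]
  have "((\<lambda>t. sqrt (\<xi> \<bullet> vel t \<xi>)) has_real_derivative - Et (t, vel t \<xi>) / sqrt (\<xi> \<bullet> vel t \<xi>)) (at t)"
    by (simp add: inner_Y[OF assms] field_simps)
  then show ?thesis unfolding eq has_real_derivative_iff_has_vector_derivative .
qed

section \<open>The ray with momentum \<open>\<xi>\<close>, its smoothness and its
  criticality\<close>

context
  fixes \<xi> x :: "real ^ 'n"
  assumes xi: "\<xi> \<noteq> 0"
begin

abbreviation "m t \<equiv> F t 0 (vel t \<xi>)"
abbreviation "ray t \<equiv> (t, x + disp t \<xi>)"

text \<open>Adjoining the velocity makes the system autonomous with a smooth right-hand side; the
  ray is a linear image of this integral curve.\<close>

definition state :: "real \<Rightarrow> real \<times> (real ^ 'n) \<times> (real ^ 'n)" where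
  "state t = (t, vel t \<xi>, x + disp t \<xi>)"

definition field :: "real \<times> (real ^ 'n) \<times> (real ^ 'n) \<Rightarrow> real \<times> (real ^ 'n) \<times> (real ^ 'n)" where
  "field p = (1, Y (fst p, fst (snd p)), fst (snd p) /\<^sub>R F (fst p) 0 (fst (snd p)))"

abbreviation "speed p \<equiv> F (fst p) 0 (fst (snd p))"

abbreviation dom :: "(real \<times> (real ^ 'n) \<times> (real ^ 'n)) set" where
  "dom \<equiv> {p. fst (snd p) \<noteq> 0}"

lemma open_dom: "open dom"
proof -
  have "dom = UNIV \<times> ((- {0}) \<times> UNIV)" by auto
  then show ?thesis by (simp add: open_Times open_Compl)
qed

lemma bounded_linear_position_velocity:
  "bounded_linear (\<lambda>p::real \<times> (real ^ 'n) \<times> (real ^ 'n). (fst p, fst (snd p)))"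
  by (intro bounded_linear_Pair bounded_linear_fst
      bounded_linear_compose[OF bounded_linear_fst bounded_linear_snd])

lemma smooth_on_speed: "smooth_on dom speed"
  using smooth_on_compose_linear[OF open_dom bounded_linear_position_velocity smooth_on_F] by simp

lemma smooth_on_field: "smooth_on dom field"
proof -
  have "smooth_on dom (\<lambda>p. Y (fst p, fst (snd p)))"
    using smooth_on_compose_linear[OF open_dom bounded_linear_position_velocity smooth_on_Y] by simp
  moreover have "smooth_on dom (\<lambda>p::real \<times> (real ^ 'n) \<times> (real ^ 'n). fst (snd p))"
    by (rule smooth_on_linear[OF open_dom bounded_linear_compose[OF bounded_linear_fst bounded_linear_snd]])
  moreover have "smooth_on dom (\<lambda>p. inverse (speed p))"
    by (rule smooth_on_inverse[OF open_dom smooth_on_speed]) (simp add: F_nonzero_iff)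
  ultimately show ?thesis
    unfolding field_def[abs_def]
    by (intro smooth_on_Pair smooth_on_const smooth_on_scaleR open_dom)
qed

lemma state_derivative:
  assumes "t \<ge> 0"
  shows "(state has_vector_derivative field (state t)) (at t within {0..})"
proof -
  have "((\<lambda>t. x + disp t \<xi>) has_vector_derivative 0 + ind t \<xi>) (at t within {0..})"
    by (intro has_vector_derivative_add has_vector_derivative_const disp_has_vector_derivative xi assms)
  moreover have "((\<lambda>t. vel t \<xi>) has_vector_derivative Y (t, vel t \<xi>)) (at t within {0..})"
    by (rule has_vector_derivative_at_within[OF vel_has_vector_derivative[OF xi]])
  ultimately show ?thesis
    unfolding state_def[abs_def] field_def
    by (intro has_vector_derivative_Pair) (simp_all add: ind_def)
qed

lemma state_in_dom: "state t \<in> dom"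
  by (simp add: state_def vel_nonzero xi)

lemma bounded_linear_time_position:
  "bounded_linear (\<lambda>p::real \<times> (real ^ 'n) \<times> (real ^ 'n). (fst p, snd (snd p)))"
  by (intro bounded_linear_Pair bounded_linear_fst
      bounded_linear_compose[OF bounded_linear_snd bounded_linear_snd])

lemma ray_derivative:
  assumes "t \<ge> 0"
  shows "(ray has_vector_derivative (1, ind t \<xi>)) (at t within {0..})"
  using bounded_linear.has_vector_derivative[OF bounded_linear_time_position state_derivative[OF assms]]
  by (simp add: state_def field_def ind_def)

lemma smooth_ray: "smooth_curve_on {0..} ray"
proof -
  have "smooth_curve_on {0..} state"
    by (rule integral_curve_smooth[OF open_dom smooth_on_field state_in_dom]) (rule state_derivative, simp)
  from smooth_curve_on_linear_image[OF bounded_linear_time_position this]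
  show ?thesis by (simp add: state_def)
qed

lemma ray_velocity:
  "t \<in> {0..} \<Longrightarrow> one_sided_velocity {0..} ray t V \<Longrightarrow> V = (1, ind t \<xi>)"
  by (rule one_sided_velocity_unique[OF _ _ ray_derivative]) (simp_all add: is_interval_1)

lemma regular_ray: "regular_curve_on {0..} ray"
  unfolding regular_curve_on_def
proof (intro conjI ballI allI impI)
  fix t V assume "t \<in> {0..}" "one_sided_velocity {0..} ray t V"
  from ray_velocity[OF this] show "V \<noteq> 0" by (simp add: zero_prod_def)
qed (rule smooth_curve_on_imp_piecewise[OF smooth_ray])

lemma lightlike_ray: "lightlike_curve_on F {0..} ray"
  unfolding lightlike_curve_on_def
proof (intro conjI ballI allI impI regular_ray)
  fix t V assume "t \<in> {0..}" "one_sided_velocity {0..} ray t V"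
  from ray_velocity[OF this] show "fst V > 0" "L (ray t) V = 0"
    by (simp_all add: lorentz_finsler_def F_ind[OF xi])
qed

text \<open>The affine parameter \<open>s\<close> of the ray satisfies \<open>dt / ds = m t\<close>, so that its momentum is constantly \<open>\<xi>\<close>.
  Integrating from \<open>-1\<close> makes it differentiable at \<open>0\<close> from both sides.\<close>

definition par :: "real \<Rightarrow> real" where
  "par t = integral {-1..t} (\<lambda>s. inverse (m s))"

definition time :: "real \<Rightarrow> real" where
  "time = inv_into {-1<..} par"

lemma m_pos: "m t > 0"
  by (rule F_vel_pos[OF xi])

lemma par_derivative:
  assumes "t > -1"
  shows "(par has_vector_derivative inverse (m t)) (at t)"
proof -
  have "continuous_on UNIV (\<lambda>s. m s)"
    by (intro continuous_at_imp_continuous_on ballI has_vector_derivative_continuous[OF F_vel_has_derivative[OF xi]])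
  then have "continuous_on UNIV (\<lambda>s. inverse (m s))"
    using m_pos by (intro continuous_intros) (auto simp: less_imp_neq[symmetric])
  then have "continuous_on {-1..t + 1} (\<lambda>s. inverse (m s))" by (rule continuous_on_subset) simp
  from integral_has_vector_derivative[OF this, of t] assms
  have "(par has_vector_derivative inverse (m t)) (at t within {-1..t + 1})"
    by (simp add: par_def[abs_def])
  moreover have "at t within {-1..t + 1} = at t" by (rule at_within_interior) (use assms in simp)
  ultimately show ?thesis by simp
qed

lemma par_strict_mono:
  assumes "-1 < s" "s < t"
  shows "par s < par t"
proof (rule DERIV_pos_imp_increasing[OF assms(2)])
  fix r assume "s \<le> r" "r \<le> t"
  then have "(par has_real_derivative inverse (m r)) (at r)"
    using par_derivative[of r] assms by (simp add: has_real_derivative_iff_has_vector_derivative)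
  then show "\<exists>y. (par has_real_derivative y) (at r) \<and> y > 0" using m_pos[of r] by auto
qed

lemma time_par: "t > -1 \<Longrightarrow> time (par t) = t"
  unfolding time_def
proof (rule inv_into_f_f)
  show "inj_on par {-1<..}"
    using par_strict_mono by (intro linorder_inj_onI') (metis greaterThan_iff less_irrefl)
qed simp

lemma time_derivative:
  assumes "t > -1"
  shows "(time has_vector_derivative m t) (at (par t))"
  unfolding has_vector_derivative_def
proof (rule has_derivative_inverse_strong[of "{-1<..}" t par])
  show "continuous_on {-1<..} par"
    using has_vector_derivative_continuous[OF par_derivative]
    by (intro continuous_at_imp_continuous_on) auto
  show "(par has_derivative (\<lambda>x. x *\<^sub>R inverse (m t))) (at t)"
    using par_derivative[OF assms] by (simp add: has_vector_derivative_def)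
  show "(\<lambda>x. x *\<^sub>R inverse (m t)) \<circ> (\<lambda>x. x *\<^sub>R m t) = id"
    using m_pos[of t] by (auto simp: fun_eq_iff)
qed (use assms time_par in auto)

abbreviation dom_par :: "real set" where
  "dom_par \<equiv> par ` {0..}"

lemma time_dom_par: "s \<in> dom_par \<Longrightarrow> time s \<ge> 0"
  using time_par by fastforce

lemma time_image: "time ` dom_par = {0..}"
proof -
  have "time ` dom_par = (\<lambda>t. time (par t)) ` {0..}" by (rule image_image)
  also have "\<dots> = (\<lambda>t. t) ` {0..}" by (rule image_cong) (auto simp: time_par)
  finally show ?thesis by simp
qed

lemma time_derivative_dom: "s \<in> dom_par \<Longrightarrow> (time has_vector_derivative m (time s)) (at s)"
  using time_derivative time_par by fastforce

lemma interval_dom_par: "is_interval dom_par"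
proof -
  have "continuous_on {0..} par"
    using has_vector_derivative_continuous[OF par_derivative]
    by (intro continuous_at_imp_continuous_on) auto
  then have "connected dom_par" by (rule connected_continuous_image) (rule connected_Ici)
  then show ?thesis by (simp add: is_interval_connected_1)
qed

text \<open>The change of parameter multiplies the field by the smooth function
  \<open>speed\<close>, so the curve is again an integral curve. This replaces a chain rule of all
  orders and also yields smoothness of \<open>time\<close>.\<close>

lemma smooth_state_time: "smooth_curve_on dom_par (\<lambda>s. state (time s))"
proof (rule integral_curve_smooth[OF open_dom smooth_on_scaleR[OF open_dom smooth_on_speed smooth_on_field] state_in_dom])
  fix s assume s: "s \<in> dom_par"
  have "(state has_vector_derivative field (state (time s))) (at (time s) within time ` dom_par)"
    unfolding time_image by (rule state_derivative[OF time_dom_par[OF s]])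
  from vector_diff_chain_within[OF has_vector_derivative_at_within[OF time_derivative_dom[OF s]] this]
  show "((\<lambda>s. state (time s)) has_vector_derivative speed (state (time s)) *\<^sub>R field (state (time s)))
      (at s within dom_par)"
    by (simp add: o_def state_def)
qed

lemma smooth_time: "smooth_curve_on dom_par time"
  using smooth_curve_on_linear_image[OF bounded_linear_fst smooth_state_time] by (simp add: state_def)

lemma smooth_ray_time: "smooth_curve_on dom_par (ray \<circ> time)"
  using smooth_curve_on_linear_image[OF bounded_linear_time_position smooth_state_time]
  by (simp add: state_def o_def)

text \<open>In this parameter the spatial velocity is \<open>vel\<close> itself, whose Legendre
  transform is the constant \<open>\<xi>\<close>.\<close>

lemma ray_time_derivative:
  assumes s: "s \<in> dom_par"
  shows "(ray \<circ> time has_vector_derivative (m (time s), vel (time s) \<xi>)) (at s within dom_par)"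
proof -
  have "(ray has_vector_derivative (1, ind (time s) \<xi>)) (at (time s) within time ` dom_par)"
    unfolding time_image by (rule ray_derivative[OF time_dom_par[OF s]])
  from vector_diff_chain_within[OF has_vector_derivative_at_within[OF time_derivative_dom[OF s]] this]
  show ?thesis using m_pos[of "time s"] by (simp add: ind_def)
qed

lemma regular_ray_time: "regular_curve_on dom_par (ray \<circ> time)"
  unfolding regular_curve_on_def
proof (intro conjI ballI allI impI)
  fix s V assume s: "s \<in> dom_par" and V: "one_sided_velocity dom_par (ray \<circ> time) s V"
  have "V = (m (time s), vel (time s) \<xi>)"
    by (rule one_sided_velocity_unique[OF interval_dom_par s ray_time_derivative[OF s] V])
  then show "V \<noteq> 0" using m_pos[of "time s"] by (auto simp: zero_prod_def)
qed (rule smooth_curve_on_imp_piecewise[OF smooth_ray_time])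

text \<open>The first variation has the primitive \<open>2 m w\<^sub>0 - 2 \<xi> \<bullet> w\<^sub>1\<close>, whose boundary values vanish.\<close>

lemma critical_ray_time:
  assumes "a < b" "{a..b} \<subseteq> dom_par"
  shows "critical_curve L a b (ray \<circ> time)"
  unfolding critical_curve_def
proof (intro allI impI)
  fix w :: "real \<Rightarrow> real \<times> (real ^ 'n)"
  assume "piecewise_smooth_on {a..b} w \<and> w a = 0 \<and> w b = 0"
  then have w: "piecewise_smooth_on {a..b} w" "w a = 0" "w b = 0" by auto
  let ?\<gamma> = "ray \<circ> time"
  have cont_time: "continuous_on {a..b} time"
    using has_vector_derivative_continuous[OF time_derivative_dom] assms(2)
    by (intro continuous_at_imp_continuous_on) auto
  have cont_m: "continuous_on UNIV (\<lambda>t. m t)" and cont_vel: "continuous_on UNIV (\<lambda>t. vel t \<xi>)"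
    by (intro continuous_at_imp_continuous_on ballI has_vector_derivative_continuous[OF F_vel_has_derivative[OF xi]]
        has_vector_derivative_continuous[OF vel_has_vector_derivative[OF xi]])+
  have pieces: "\<exists>g. C1_curve c d ?\<gamma> g \<and> (\<forall>s\<in>{c..d}. snd (g s) \<noteq> 0)"
    if "a \<le> c" "c < d" "d \<le> b" for c d
  proof (intro exI[of _ "\<lambda>s. (m (time s), vel (time s) \<xi>)"] conjI ballI)
    have sub: "{c..d} \<subseteq> {a..b}" using that by auto
    have cont: "continuous_on {c..d} time" by (rule continuous_on_subset[OF cont_time sub])
    show "C1_curve c d ?\<gamma> (\<lambda>s. (m (time s), vel (time s) \<xi>))"
      unfolding C1_curve_def
    proof (intro conjI ballI)
      show "continuous_on {c..d} (\<lambda>s. (m (time s), vel (time s) \<xi>))"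
        using continuous_on_compose2[OF cont_m cont] continuous_on_compose2[OF cont_vel cont]
        by (intro continuous_on_Pair) auto
      fix s assume "s \<in> {c..d}"
      then have "s \<in> dom_par" using sub assms(2) by blast
      show "(?\<gamma> has_vector_derivative (m (time s), vel (time s) \<xi>)) (at s within {c..d})"
        by (rule has_vector_derivative_within_subset[OF ray_time_derivative[OF \<open>s \<in> dom_par\<close>]])
          (use sub assms(2) in blast)
    qed
  qed (simp add: vel_nonzero xi)
  have der: "((\<lambda>\<epsilon>. action L a b (\<lambda>s. ?\<gamma> s + \<epsilon> *\<^sub>R w s)) has_real_derivative
      integral {a..b} (variation ?\<gamma> w)) (at 0)"
    by (rule first_variation(1)[OF finite.emptyI assms(1) _ w(1)]) (rule pieces)
  obtain Q where Q: "finite Q" "continuous_on {a..b} w"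
    "\<And>c d. a \<le> c \<Longrightarrow> c < d \<Longrightarrow> d \<le> b \<Longrightarrow> {c<..<d} \<inter> Q = {} \<Longrightarrow> smooth_curve_on {c..d} w"
    using piecewise_smooth_onE[OF w(1) assms(1) order_refl] by metis
  define B where "B s = 2 * (m (time s) * fst (w s)) - 2 * (\<xi> \<bullet> snd (w s))" for s
  have "(variation ?\<gamma> w has_integral (B b - B a)) {a..b}"
  proof (rule fundamental_theorem_of_calculus_interior_strong[OF Q(1)])
    show "a \<le> b" using assms by simp
    have "continuous_on {a..b} (\<lambda>s. m (time s))" using continuous_on_compose2[OF cont_m cont_time] by simp
    then show "continuous_on {a..b} B" unfolding B_def[abs_def] by (intro continuous_intros Q(2))
    fix s assume s: "s \<in> {a<..<b} - Q"
    obtain c d where cd: "a \<le> c" "c < s" "s < d" "d \<le> b" "{c<..<d} \<inter> Q = {}"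
      using piece_around[OF Q(1) s] .
    then have "c < d" by simp
    obtain k where k: "C1_curve c d w k"
      using smooth_curve_on_imp_C1_curve[OF Q(3)[OF cd(1) \<open>c < d\<close> cd(4,5)]] by blast
    note wk = C1_curve_at[OF k cd(2,3)]
    have sJ: "s \<in> dom_par" by (rule subsetD[OF assms(2)]) (use s in simp)
    have "at s within {a..b} = at s" by (rule at_within_interior) (use s in simp)
    with has_vector_derivative_within_subset[OF ray_time_derivative[OF sJ] assms(2)]
    have "(?\<gamma> has_vector_derivative (m (time s), vel (time s) \<xi>)) (at s)" by (simp only:)
    then have \<gamma>': "vector_derivative ?\<gamma> (at s) = (m (time s), vel (time s) \<xi>)"
      by (rule vector_derivative_at)
    have var: "variation ?\<gamma> w s = 2 * m (time s) * fst (k s) -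
        2 * (fst (w s) * Et (time s, vel (time s) \<xi>) + \<xi> \<bullet> snd (k s))"
      unfolding variation_def Let_def \<gamma>' vector_derivative_at[OF wk] by (simp add: G_vel xi)
    \<comment> \<open>The factor \<open>m\<close> from the parameter change cancels the denominator
      and leaves \<open>- Et\<close>, exactly the coefficient of \<open>fst (w s)\<close> in the
      variation up to the factor 2.\<close>
    have "((\<lambda>t. m t) \<circ> time has_vector_derivative
        m (time s) *\<^sub>R (- Et (time s, vel (time s) \<xi>) / m (time s))) (at s)"
      by (rule vector_diff_chain_at[OF time_derivative_dom[OF sJ] F_vel_has_derivative[OF xi]])
    then have m': "((\<lambda>s. m (time s)) has_real_derivative - Et (time s, vel (time s) \<xi>)) (at s)"
      using m_pos[of "time s"] by (simp add: o_def has_real_derivative_iff_has_vector_derivative)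
    have w0: "((\<lambda>s. fst (w s)) has_real_derivative fst (k s)) (at s)"
      unfolding has_real_derivative_iff_has_vector_derivative
      by (rule bounded_linear.has_vector_derivative[OF bounded_linear_fst wk])
    have w1: "((\<lambda>s. \<xi> \<bullet> snd (w s)) has_real_derivative \<xi> \<bullet> snd (k s)) (at s)"
      unfolding has_real_derivative_iff_has_vector_derivative
      by (rule bounded_linear.has_vector_derivative[OF bounded_linear_inner_right
            bounded_linear.has_vector_derivative[OF bounded_linear_snd wk]])
    have "(B has_real_derivative
        2 * (- Et (time s, vel (time s) \<xi>) * fst (w s) + fst (k s) * m (time s)) - 2 * (\<xi> \<bullet> snd (k s))) (at s)"
      unfolding B_def[abs_def] by (intro DERIV_diff DERIV_cmult DERIV_mult m' w0 w1)
    then show "(B has_vector_derivative variation ?\<gamma> w s) (at s)"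
      unfolding var has_real_derivative_iff_has_vector_derivative by (simp add: algebra_simps)
  qed
  then have "integral {a..b} (variation ?\<gamma> w) = B b - B a" by (rule integral_unique)
  also have "\<dots> = 0" by (simp add: B_def w)
  finally have "integral {a..b} (variation ?\<gamma> w) = 0" .
  then show "((\<lambda>\<epsilon>. action L a b (\<lambda>s. ?\<gamma> s + \<epsilon> *\<^sub>R w s)) has_real_derivative 0) (at 0)"
    using der by simp
qed

lemma pregeodesic_ray: "pregeodesic_on L {0..} ray"
  unfolding pregeodesic_on_def
proof (intro conjI regular_ray exI[of _ dom_par] exI[of _ time] interval_dom_par time_image
    smooth_curve_on_imp_piecewise[OF smooth_time] ballI allI impI)
  fix s v assume s: "s \<in> dom_par" and v: "one_sided_velocity dom_par time s v"
  have "v = m (time s)"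
    by (rule one_sided_velocity_unique[OF interval_dom_par s _ v])
      (rule has_vector_derivative_at_within[OF time_derivative_dom[OF s]])
  then show "v > 0" by (simp add: m_pos)
next
  show "geodesic_on L dom_par (ray \<circ> time)"
    unfolding geodesic_on_def by (intro conjI allI impI regular_ray_time critical_ray_time) simp_all
qed

end

end

subsection \<open>Normals of convex hypersurfaces\<close>

text \<open>The tangent curve is \<open>p + s u + g s w\<close>, where \<open>g\<close> solves the equation \<open>\<phi> = 0\<close> on a small square.
  It is an integral curve of a smooth vector field, hence smooth.\<close>

lemma level_set_tangent_pos:
  fixes \<phi> :: "'a::euclidean_space \<Rightarrow> real"
  assumes "open U" "p \<in> U" and sm: "smooth_on U \<phi>" and "\<phi> p = 0"
    and S: "\<And>x. x \<in> U \<Longrightarrow> \<phi> x = 0 \<Longrightarrow> x \<in> S"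
    and w: "frechet_derivative \<phi> (at p) w > 0" and u: "frechet_derivative \<phi> (at p) u = 0"
  shows "u \<in> tangent_vectors S p"
proof -
  define D where "D x v = frechet_derivative \<phi> (at x) v" for x v
  \<comment> \<open>On this neighbourhood \<open>\<phi>\<close> increases in direction
    \<open>w\<close>, which makes the solution in \<open>y\<close> unique.\<close>
  define U0 where "U0 = {x \<in> U. D x w > 0}"
  have der: "(\<phi> has_derivative D x) (at x)" if "x \<in> U0" for x
    using smooth_on_has_derivative[OF sm, of x] that by (simp add: U0_def D_def[abs_def])
  have lin: "linear (D x)" if "x \<in> U0" for x
    using der[OF that] has_derivative_linear by blast
  have "continuous_on U (\<lambda>x. D x w)"
    unfolding D_def by (rule smooth_on_imp_continuous_on[OF smooth_on_derivative[OF sm]])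
  then have "open (U \<inter> (\<lambda>x. D x w) -` {0<..})"
    using continuous_open_preimage[OF _ assms(1) open_greaterThan] by blast
  then have "open U0" by (simp add: U0_def Int_def)
  moreover have "p \<in> U0" using w assms(2) by (simp add: U0_def D_def)
  ultimately obtain e where e: "e > 0" "ball p e \<subseteq> U0" using open_contains_ball by blast
  define \<delta> where "\<delta> = e / (norm u + norm w + 1)"
  have N: "norm u + norm w + 1 > 0" by (simp add: add_nonneg_pos)
  have \<delta>: "\<delta> > 0" using e(1) N by (simp add: \<delta>_def)
  define q where "q s y = p + s *\<^sub>R u + y *\<^sub>R w" for s y
  have qU: "q s y \<in> U0" if "\<bar>s\<bar> \<le> \<delta>" "\<bar>y\<bar> \<le> \<delta>" for s y
  proof -
    have "norm (s *\<^sub>R u + y *\<^sub>R w) \<le> \<bar>s\<bar> * norm u + \<bar>y\<bar> * norm w"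
      using norm_triangle_ineq[of "s *\<^sub>R u" "y *\<^sub>R w"] by simp
    also have "\<dots> \<le> \<delta> * norm u + \<delta> * norm w"
      using that by (intro add_mono mult_right_mono) auto
    also have "\<dots> < \<delta> * (norm u + norm w + 1)" using \<delta> by (simp add: algebra_simps)
    also have "\<dots> = e" using N by (simp add: \<delta>_def)
    finally have "dist (q s y) p < e" by (simp add: q_def dist_norm add.assoc)
    then have "q s y \<in> ball p e" by (simp add: dist_commute)
    then show ?thesis using e(2) by blast
  qed
  define f where "f s y = \<phi> (q s y)" for s y
  have fy: "((\<lambda>y. f s y) has_real_derivative D (q s y) w) (at y)" if "\<bar>s\<bar> \<le> \<delta>" "\<bar>y\<bar> \<le> \<delta>" for s y
  proof -
    have "((\<lambda>y. q s y) has_derivative (\<lambda>h. h *\<^sub>R w)) (at y)"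
      unfolding q_def by (auto intro!: derivative_eq_intros)
    from has_derivative_compose[OF this der[OF qU[OF that]]]
    show ?thesis
      by (simp add: f_def has_field_derivative_def linear_scale[OF lin[OF qU[OF that]]] mult_commute_abs)
  qed
  have fmono: "f s y < f s z" if "\<bar>s\<bar> \<le> \<delta>" "-\<delta> \<le> y" "y < z" "z \<le> \<delta>" for s y z
  proof (rule DERIV_pos_imp_increasing[OF that(3)])
    fix r assume "y \<le> r" "r \<le> z"
    then have "\<bar>r\<bar> \<le> \<delta>" using that by auto
    then show "\<exists>d. ((\<lambda>y. f s y) has_real_derivative d) (at r) \<and> d > 0"
      using fy[OF that(1)] qU[OF that(1)] by (auto simp: U0_def)
  qed
  have f00: "f 0 0 = 0" using assms(4) by (simp add: f_def q_def)
  \<comment> \<open>At \<open>s = 0\<close> monotonicity makes \<open>f\<close> negative at the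
    bottom of the square and positive at the top. Both signs persist for small \<open>s\<close>, so
    a root lies between.\<close>
  have ev: "\<forall>\<^sub>F s in nhds 0. f s (-\<delta>) < 0 \<and> f s \<delta> > 0"
  proof -
    have "isCont (\<lambda>s. f s y) 0" if "\<bar>y\<bar> \<le> \<delta>" for y
    proof -
      have "isCont \<phi> (q 0 y)" using der[OF qU, of 0 y] that \<delta> has_derivative_continuous by force
      moreover have "isCont (\<lambda>s. q s y) 0" unfolding q_def by (intro continuous_intros)
      ultimately show ?thesis unfolding f_def by (rule isCont_o2[rotated])
    qed
    then have tend: "((\<lambda>s. f s y) \<longlongrightarrow> f 0 y) (nhds 0)" if "\<bar>y\<bar> \<le> \<delta>" for y
      using that tendsto_at_iff_tendsto_nhds[of "\<lambda>s. f s y" 0] by (simp add: isCont_def)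
    have "f 0 (-\<delta>) < 0" "f 0 \<delta> > 0" using fmono[of 0 "-\<delta>" 0] fmono[of 0 0 \<delta>] f00 \<delta> by auto
    then show ?thesis
      using order_tendstoD(2)[OF tend[of "-\<delta>"], of 0] order_tendstoD(1)[OF tend[of \<delta>], of 0] \<delta>
      by (intro eventually_conj) auto
  qed
  then obtain d where d: "d > 0" "\<And>s. \<bar>s\<bar> < d \<Longrightarrow> f s (-\<delta>) < 0 \<and> f s \<delta> > 0"
    unfolding eventually_nhds_metric by (auto simp: dist_real_def)
  define d' where "d' = min d \<delta>"
  define R0 where "R0 = {-\<delta><..<\<delta>} \<times> {-\<delta><..<\<delta>}"
  \<comment> \<open>A straightening map: \<open>g s\<close> is the second coordinate of
    \<open>\<Psi> (s, 0)\<close>, so differentiability of \<open>g\<close> reduces to that of an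
    inverse function.\<close>
  define \<Phi> where "\<Phi> r = (fst r, f (fst r) (snd r))" for r
  define \<Psi> where "\<Psi> = inv_into R0 \<Phi>"
  have inj: "inj_on \<Phi> R0"
  proof (rule inj_onI)
    fix r r' assume r: "r \<in> R0" "r' \<in> R0" "\<Phi> r = \<Phi> r'"
    then have "fst r = fst r'" "f (fst r) (snd r) = f (fst r) (snd r')" by (auto simp: \<Phi>_def)
    moreover have "\<bar>fst r\<bar> \<le> \<delta>" "- \<delta> \<le> snd r" "snd r \<le> \<delta>" "- \<delta> \<le> snd r'" "snd r' \<le> \<delta>"
      using r by (auto simp: R0_def mem_Times_iff)
    ultimately show "r = r'"
      using fmono[of "fst r" "snd r" "snd r'"] fmono[of "fst r" "snd r'" "snd r"]
      by (metis less_irrefl linorder_neqE_linordered_idom prod_eqI)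
  qed
  have root: "\<exists>y. y \<in> {-\<delta><..<\<delta>} \<and> f s y = 0" if "\<bar>s\<bar> < d'" for s
  proof -
    have s: "\<bar>s\<bar> < d" "\<bar>s\<bar> \<le> \<delta>" using that by (auto simp: d'_def)
    have "continuous_on {-\<delta>..\<delta>} (f s)"
      by (rule continuous_at_imp_continuous_on) (use fy[OF s(2)] DERIV_isCont in force)
    then obtain y where "-\<delta> \<le> y" "y \<le> \<delta>" "f s y = 0"
      using IVT'[of "f s" "-\<delta>" 0 \<delta>] d(2)[OF s(1)] \<delta> by force
    then show ?thesis using d(2)[OF s(1)] by (metis greaterThanLessThan_iff less_irrefl order_le_less)
  qed
  define g where "g s = snd (\<Psi> (s, 0))" for s
  have g: "g s \<in> {-\<delta><..<\<delta>}" "f s (g s) = 0" if s: "\<bar>s\<bar> < d'" for s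
  proof -
    obtain y where y: "y \<in> {-\<delta><..<\<delta>}" "f s y = 0" using root[OF s] by blast
    have "(s, y) \<in> R0" "\<Phi> (s, y) = (s, 0)" using s y by (auto simp: R0_def \<Phi>_def d'_def)
    then have "\<Psi> (s, 0) = (s, y)" unfolding \<Psi>_def using inv_into_f_f[OF inj] by metis
    then show "g s \<in> {-\<delta><..<\<delta>}" "f s (g s) = 0" using y by (auto simp: g_def)
  qed
  have g0: "g 0 = 0"
  proof -
    have "(0, 0) \<in> R0" "\<Phi> (0, 0) = (0, 0)" using \<delta> f00 by (auto simp: R0_def \<Phi>_def)
    then have "\<Psi> (0, 0) = (0, 0)" unfolding \<Psi>_def using inv_into_f_f[OF inj] by metis
    then show ?thesis by (simp add: g_def)
  qed
  have derq: "((\<lambda>r. f (fst r) (snd r)) has_derivative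
      (\<lambda>h. fst h * D (q (fst r) (snd r)) u + snd h * D (q (fst r) (snd r)) w)) (at r)" if "r \<in> R0" for r
  proof -
    have "\<bar>fst r\<bar> \<le> \<delta>" "\<bar>snd r\<bar> \<le> \<delta>" using that by (auto simp: R0_def mem_Times_iff)
    note U = qU[OF this]
    have "((\<lambda>r. q (fst r) (snd r)) has_derivative (\<lambda>h. fst h *\<^sub>R u + snd h *\<^sub>R w)) (at r)"
      unfolding q_def by (auto intro!: derivative_eq_intros)
    from has_derivative_compose[OF this der[OF U]]
    show ?thesis by (simp add: f_def linear_add[OF lin[OF U]] linear_scale[OF lin[OF U]])
  qed
  have gder: "(g has_real_derivative - D (q s (g s)) u / D (q s (g s)) w) (at s)" if s: "\<bar>s\<bar> < d'" for s
  proof -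
    define r where "r = (s, g s)"
    have r: "r \<in> R0" using g[OF s] s by (auto simp: r_def R0_def d'_def)
    define \<alpha> \<beta> where "\<alpha> = D (q s (g s)) u" and "\<beta> = D (q s (g s)) w"
    have "\<beta> > 0" using qU[of s "g s"] g[OF s] s by (auto simp: \<beta>_def U0_def d'_def)
    have "(\<Psi> has_derivative (\<lambda>h. (fst h, (snd h - fst h * \<alpha>) / \<beta>))) (at (\<Phi> r))"
    proof (rule has_derivative_inverse_strong[of R0 r \<Phi> \<Psi>])
      show "open R0" unfolding R0_def by (intro open_Times) auto
      show "r \<in> R0" by (rule r)
      show "continuous_on R0 \<Phi>"
        unfolding \<Phi>_def using has_derivative_continuous[OF derq]
        by (intro continuous_intros continuous_at_imp_continuous_on) auto
      show "\<Psi> (\<Phi> x) = x" if "x \<in> R0" for x unfolding \<Psi>_def by (rule inv_into_f_f[OF inj that])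
      show "(\<Phi> has_derivative (\<lambda>h. (fst h, fst h * \<alpha> + snd h * \<beta>))) (at r)"
        unfolding \<Phi>_def \<alpha>_def \<beta>_def using derq[OF r]
        by (intro has_derivative_Pair has_derivative_fst has_derivative_ident) (simp add: r_def)
      show "(\<lambda>h. (fst h, fst h * \<alpha> + snd h * \<beta>)) \<circ> (\<lambda>h. (fst h, (snd h - fst h * \<alpha>) / \<beta>)) = id"
        using \<open>\<beta> > 0\<close> by (auto simp: fun_eq_iff)
    qed
    moreover have "\<Phi> r = (s, 0)" using g(2)[OF s] by (simp add: \<Phi>_def r_def)
    ultimately have \<Psi>': "((\<lambda>q. snd (\<Psi> q)) has_derivative (\<lambda>h. (snd h - fst h * \<alpha>) / \<beta>)) (at (s, 0))"
      using has_derivative_snd by fastforce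
    have "((\<lambda>s. (s, 0::real)) has_derivative (\<lambda>h. (h, 0))) (at s)"
      by (auto intro!: derivative_eq_intros)
    from has_derivative_compose[OF this \<Psi>']
    have "(g has_derivative (\<lambda>h. (0 - h * \<alpha>) / \<beta>)) (at s)" by (simp add: g_def[abs_def])
    then show ?thesis
      unfolding has_field_derivative_def \<alpha>_def[symmetric] \<beta>_def[symmetric]
      by (rule has_derivative_eq_rhs) (simp add: fun_eq_iff)
  qed
  \<comment> \<open>\<open>D x (V x) = 0\<close>, so \<open>V\<close> is tangent to the level sets
    of \<open>\<phi>\<close>. Its coefficient at \<open>w\<close> is the derivative of
    \<open>g\<close> along the curve, and \<open>V p = u\<close>.\<close>
  define V where "V x = u + (- D x u / D x w) *\<^sub>R w" for x
  define c where "c s = q s (g s)" for s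
  define I where "I = {-d'<..<d'}"
  have I: "\<bar>s\<bar> < d'" if "s \<in> I" for s using that by (auto simp: I_def)
  have cU: "c s \<in> U0" if "s \<in> I" for s
    unfolding c_def using I[OF that] g[OF I[OF that]] by (intro qU) (auto simp: d'_def)
  have cder: "(c has_vector_derivative V (c s)) (at s)" if "s \<in> I" for s
  proof -
    have "((\<lambda>s. p + s *\<^sub>R u + g s *\<^sub>R w) has_vector_derivative
        0 + (s *\<^sub>R 0 + 1 *\<^sub>R u) + (g s *\<^sub>R 0 + (- D (q s (g s)) u / D (q s (g s)) w) *\<^sub>R w)) (at s)"
      by (intro has_vector_derivative_add has_vector_derivative_const has_vector_derivative_scaleR
          gder[OF I[OF that]] DERIV_ident)
    then show ?thesis by (simp add: c_def[abs_def] q_def V_def)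
  qed
  have smU0: "smooth_on U0 (\<lambda>x. D x v)" for v
    unfolding D_def by (rule smooth_on_subset[OF smooth_on_derivative[OF sm]]) (auto simp: U0_def)
  have "smooth_on U0 V"
    unfolding V_def
    by (intro smooth_on_add smooth_on_scaleR smooth_on_const smooth_on_divide smooth_on_uminus smU0 \<open>open U0\<close>)
      (auto simp: U0_def)
  then have "smooth_curve_on I c"
    by (rule integral_curve_smooth[OF \<open>open U0\<close> _ cU has_vector_derivative_at_within[OF cder]])
  moreover have "c ` I \<subseteq> S"
  proof (rule image_subsetI)
    fix s assume s: "s \<in> I"
    show "c s \<in> S"
      by (rule S) (use cU[OF s] g(2)[OF I[OF s]] in \<open>auto simp: U0_def c_def f_def\<close>)
  qed
  moreover have c0: "c 0 = p" by (simp add: c_def q_def g0)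
  moreover have "d' > 0" using d(1) \<delta> by (simp add: d'_def)
  moreover have "(c has_vector_derivative u) (at 0)"
  proof -
    have "V p = u" using u by (simp add: V_def D_def)
    moreover have "0 \<in> I" using \<open>d' > 0\<close> by (simp add: I_def)
    ultimately show ?thesis using cder[of 0] unfolding c0 by (simp only:)
  qed
  ultimately have "d' > 0 \<and> smooth_curve_on {-d'<..<d'} c \<and> c ` {-d'<..<d'} \<subseteq> S \<and> c 0 = p \<and>
      (c has_vector_derivative u) (at 0)"
    unfolding I_def by (intro conjI)
  then show ?thesis unfolding tangent_vectors_def by blast
qed

text \<open>Take the gradient of a local defining function. A direction \<open>w\<close> with
  positive derivative exists after a change of sign, and the level set lemma then realizes each
  vector of the kernel by a curve.\<close>

lemma hypersurface_tangent:
  assumes "embedded_hypersurface S" "p \<in> S"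
  obtains \<eta> where "\<eta> \<noteq> 0" "\<And>u. \<eta> \<bullet> u = 0 \<Longrightarrow> u \<in> tangent_vectors S p"
proof -
  obtain U and \<phi> :: "'a \<Rightarrow> real" where U: "open U" "p \<in> U" "smooth_on U \<phi>"
    "\<And>x. x \<in> U \<Longrightarrow> frechet_derivative \<phi> (at x) \<noteq> (\<lambda>u. 0)" "S \<inter> U = {x \<in> U. \<phi> x = 0}"
    using assms unfolding embedded_hypersurface_def by metis
  define D where "D = frechet_derivative \<phi> (at p)"
  have lin: "linear D"
    unfolding D_def using smooth_on_has_derivative[OF U(3,2)] has_derivative_linear by blast
  obtain w0 where "D w0 \<noteq> 0" using U(4)[OF U(2)] unfolding D_def by blast
  then obtain w where w: "D w > 0"
    using linear_neg[OF lin, of w0] by (metis linorder_neqE_linordered_idom neg_0_less_iff_less)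
  define \<eta> where "\<eta> = (\<Sum>b\<in>Basis. D b *\<^sub>R b)"
  have \<eta>: "\<eta> \<bullet> u = D u" for u
  proof -
    have "D u = D (\<Sum>b\<in>Basis. (u \<bullet> b) *\<^sub>R b)" by (simp add: euclidean_representation)
    also have "\<dots> = (\<Sum>b\<in>Basis. (u \<bullet> b) * D b)" by (simp add: linear_sum[OF lin] linear_scale[OF lin])
    also have "\<dots> = (\<Sum>b\<in>Basis. (D b *\<^sub>R b) \<bullet> u)" by (simp add: inner_commute mult.commute)
    also have "\<dots> = \<eta> \<bullet> u" unfolding \<eta>_def by (rule inner_sum_left[symmetric])
    finally show ?thesis by simp
  qed
  show ?thesis
  proof (rule that)
    show "\<eta> \<noteq> 0" using w \<eta>[of w] by auto
    fix u assume "\<eta> \<bullet> u = 0"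
    then show "u \<in> tangent_vectors S p"
      using level_set_tangent_pos[OF U(1,2,3), of S w u] U(2,5) assms(2) w \<eta>[of u] by (auto simp: D_def)
  qed
qed

section \<open>Supporting functionals of convex regions\<close>

definition supports :: "'a::real_inner set \<Rightarrow> 'a \<Rightarrow> 'a \<Rightarrow> bool" where
  "supports K \<zeta> x \<longleftrightarrow> x \<in> K \<and> \<zeta> \<noteq> 0 \<and> (\<forall>y\<in>K. \<zeta> \<bullet> y \<le> \<zeta> \<bullet> x)"

lemma supports_scale: "b > 0 \<Longrightarrow> supports K \<zeta> x \<Longrightarrow> supports K (b *\<^sub>R \<zeta>) x"
  by (simp add: supports_def)

text \<open>Along a curve in \<open>A\<close> through \<open>x\<close> the functional has a local
  maximum at the interior parameter \<open>0\<close>.\<close>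

lemma supports_tangent:
  assumes "supports K \<zeta> x" "A \<subseteq> K" "u \<in> tangent_vectors A x"
  shows "\<zeta> \<bullet> u = 0"
proof -
  obtain c e where c: "e > 0" "c ` {-e<..<e} \<subseteq> A" "c 0 = x" "(c has_vector_derivative u) (at (0::real))"
    using assms(3) unfolding tangent_vectors_def by blast
  have "((\<lambda>s. \<zeta> \<bullet> c s) has_real_derivative \<zeta> \<bullet> u) (at 0)"
    unfolding has_real_derivative_iff_has_vector_derivative
    by (rule bounded_linear.has_vector_derivative[OF bounded_linear_inner_right c(4)])
  moreover have "\<forall>s. \<bar>0 - s\<bar> < e \<longrightarrow> \<zeta> \<bullet> c s \<le> \<zeta> \<bullet> c 0"
  proof (intro allI impI)
    fix s assume "\<bar>0 - s\<bar> < e"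
    then have "s \<in> {-e<..<e}" by auto
    then have "c s \<in> K" using c(2) assms(2) by blast
    then show "\<zeta> \<bullet> c s \<le> \<zeta> \<bullet> c 0" using assms(1) unfolding supports_def c(3) by blast
  qed
  ultimately show ?thesis using DERIV_local_max[of "\<lambda>s. \<zeta> \<bullet> c s" "\<zeta> \<bullet> u" 0 e] c(1) by blast
qed

lemma orthogonal_imp_parallel:
  fixes \<eta> \<zeta> :: "'a::real_inner"
  assumes "\<eta> \<noteq> 0" "\<zeta> \<noteq> 0" "\<And>u. \<eta> \<bullet> u = 0 \<Longrightarrow> \<zeta> \<bullet> u = 0"
  obtains a where "a \<noteq> 0" "\<zeta> = a *\<^sub>R \<eta>"
proof -
  define a where "a = (\<eta> \<bullet> \<zeta>) / (\<eta> \<bullet> \<eta>)"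
  define u where "u = \<zeta> - a *\<^sub>R \<eta>"
  have "\<eta> \<bullet> u = 0" using assms(1) by (simp add: u_def a_def inner_diff_right)
  then have "u \<bullet> u = 0" using assms(3) by (simp add: u_def inner_diff_left)
  then have "\<zeta> = a *\<^sub>R \<eta>" by (simp add: u_def)
  then show ?thesis using that assms(2) by (metis scaleR_zero_left)
qed

text \<open>Separating \<open>K\<close> from the open ray in direction \<open>v\<close> gives some
  supporting functional \<open>a\<close> with \<open>a \<bullet> v \<ge> 0\<close>. The tangent
  space contains a hyperplane, so \<open>a\<close> and \<open>\<xi>\<close> are parallel, and
  \<open>\<xi> \<bullet> v > 0\<close> makes the factor positive.\<close>

lemma outward_normal_supports:
  fixes K :: "'a::euclidean_space set"
  assumes K: "convex K" "A \<subseteq> K" "x \<in> A"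
    and \<eta>: "\<eta> \<noteq> 0" "\<And>u. \<eta> \<bullet> u = 0 \<Longrightarrow> u \<in> tangent_vectors A x"
    and out: "\<forall>\<^sub>F \<epsilon> in at_right 0. x + \<epsilon> *\<^sub>R v \<notin> K"
    and \<xi>: "\<xi> \<bullet> v > 0" "\<And>u. u \<in> tangent_vectors A x \<Longrightarrow> \<xi> \<bullet> u = 0"
  shows "supports K \<xi> x"
proof -
  have xK: "x \<in> K" using K by blast
  define T where "T = (\<lambda>\<epsilon>. x + \<epsilon> *\<^sub>R v) ` {0<..}"
  have "linear (\<lambda>\<epsilon>. \<epsilon> *\<^sub>R v)" by (rule linearI) (simp_all add: scaleR_add_left)
  then have "convex ((+) x ` (\<lambda>\<epsilon>. \<epsilon> *\<^sub>R v) ` {0<..})"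
    by (intro convex_translation convex_linear_image convex_real_interval)
  then have "convex T" by (simp add: T_def image_image)
  \<comment> \<open>By convexity one point of the ray in \<open>K\<close> would put all points
    between it and \<open>x\<close> in \<open>K\<close>, against the outward condition near
    \<open>x\<close>.\<close>
  have disj: "x + \<epsilon> *\<^sub>R v \<notin> K" if "\<epsilon> > 0" for \<epsilon>
  proof
    assume in_K: "x + \<epsilon> *\<^sub>R v \<in> K"
    obtain b where b: "b > 0" "\<And>e. 0 < e \<Longrightarrow> e < b \<Longrightarrow> x + e *\<^sub>R v \<notin> K"
      using out unfolding eventually_at_right_field by blast
    define e where "e = min \<epsilon> (b / 2)"
    have e: "0 < e" "e < b" "e \<le> \<epsilon>" using b(1) that by (auto simp: e_def)
    have "(1 - e / \<epsilon>) *\<^sub>R x + (e / \<epsilon>) *\<^sub>R (x + \<epsilon> *\<^sub>R v) \<in> K"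
      using e that by (intro convexD[OF K(1) xK in_K]) auto
    moreover have "(1 - e / \<epsilon>) *\<^sub>R x + (e / \<epsilon>) *\<^sub>R (x + \<epsilon> *\<^sub>R v) = x + e *\<^sub>R v"
      using that by (simp add: algebra_simps)
    ultimately show False using b(2)[OF e(1,2)] by simp
  qed
  have "K \<inter> T = {}" using disj by (auto simp: T_def)
  moreover have "T \<noteq> {}" by (auto simp: T_def)
  ultimately obtain a \<beta> where a: "a \<noteq> 0" "\<And>y. y \<in> K \<Longrightarrow> a \<bullet> y \<le> \<beta>" "\<And>y. y \<in> T \<Longrightarrow> a \<bullet> y \<ge> \<beta>"
    using separating_hyperplane_sets[OF K(1) \<open>convex T\<close>] xK by blast
  have ge: "a \<bullet> x + \<epsilon> * (a \<bullet> v) \<ge> \<beta>" if "\<epsilon> > 0" for \<epsilon>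
    using a(3)[of "x + \<epsilon> *\<^sub>R v"] that by (auto simp: T_def inner_add_right)
  have "((\<lambda>\<epsilon>. a \<bullet> x + \<epsilon> * (a \<bullet> v)) \<longlongrightarrow> a \<bullet> x + 0 * (a \<bullet> v)) (at_right 0)"
    by (intro tendsto_intros)
  then have "\<beta> \<le> a \<bullet> x + 0 * (a \<bullet> v)"
    by (rule tendsto_lowerbound) (auto simp: eventually_at_right_field intro!: ge exI[of _ 1])
  then have ax: "a \<bullet> x = \<beta>" using a(2)[OF xK] by simp
  then have av: "a \<bullet> v \<ge> 0" using ge[of 1] by simp
  have supp: "supports K a x" using a ax xK by (simp add: supports_def)
  obtain \<alpha> where \<alpha>: "\<alpha> \<noteq> 0" "a = \<alpha> *\<^sub>R \<eta>"
    using orthogonal_imp_parallel[OF \<eta>(1) a(1)] supports_tangent[OF supp K(2) \<eta>(2)] by blast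
  have "\<xi> \<noteq> 0" using \<xi>(1) by auto
  then obtain b where b: "b \<noteq> 0" "\<xi> = b *\<^sub>R \<eta>"
    using orthogonal_imp_parallel[OF \<eta>(1)] \<xi>(2)[OF \<eta>(2)] by metis
  have \<xi>a: "\<xi> = (b / \<alpha>) *\<^sub>R a" using \<alpha> b by simp
  then have "(b / \<alpha>) * (a \<bullet> v) > 0" using \<xi>(1) by simp
  moreover from this have "a \<bullet> v > 0" using av by (cases "a \<bullet> v = 0") auto
  ultimately have "b / \<alpha> > 0" by (rule zero_less_mult_pos2)
  then show ?thesis unfolding \<xi>a by (rule supports_scale[OF _ supp])
qed

lemma orthogonal_vector_exists:
  fixes \<zeta> :: "'a::euclidean_space"
  assumes "DIM('a) \<ge> 2"
  obtains \<eta> where "\<eta> \<noteq> 0" "\<zeta> \<bullet> \<eta> = 0"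
proof -
  obtain b1 :: 'a where b1: "b1 \<in> Basis" using nonempty_Basis by blast
  have "\<not> (Basis :: 'a set) \<subseteq> {b1}"
  proof
    assume "(Basis :: 'a set) \<subseteq> {b1}"
    then have "card (Basis :: 'a set) \<le> card {b1}" by (intro card_mono) simp_all
    then show False using assms by simp
  qed
  then obtain b2 where b2: "b2 \<in> Basis" "b2 \<noteq> b1" by blast
  define \<eta> where "\<eta> = (\<zeta> \<bullet> b2) *\<^sub>R b1 - (\<zeta> \<bullet> b1) *\<^sub>R b2"
  have orth: "\<zeta> \<bullet> \<eta> = 0" by (simp add: \<eta>_def inner_diff_right)
  have "\<eta> \<bullet> b1 = \<zeta> \<bullet> b2"
    using b1 b2 by (simp add: \<eta>_def inner_diff_left inner_Basis)
  then have "\<zeta> \<bullet> b2 \<noteq> 0 \<Longrightarrow> \<eta> \<noteq> 0" by auto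
  with orth show ?thesis
    using that[of \<eta>] that[of b2] nonzero_Basis[OF b2(1)] by blast
qed

text \<open>If both \<open>\<zeta>\<close> and \<open>- \<zeta>\<close> supported \<open>K\<close>, then \<open>K\<close> would be flat, and a maximum point over \<open>K\<close> of a functional
  independent of \<open>\<zeta>\<close> would have two independent normals.\<close>

lemma hypersurface_normal_unique:
  fixes K :: "'a::euclidean_space set"
  assumes dim: "DIM('a) \<ge> 2" and S: "embedded_hypersurface A" and K: "compact K" "A \<subseteq> K"
    and boundary: "\<And>\<zeta> x. supports K \<zeta> x \<Longrightarrow> x \<in> A"
    and \<zeta>: "supports K \<zeta> x" "supports K \<zeta>' x"
  obtains a where "a > 0" "\<zeta>' = a *\<^sub>R \<zeta>"
proof -
  have par: "\<exists>a. a \<noteq> 0 \<and> \<zeta>2 = a *\<^sub>R \<zeta>1" if s: "supports K \<zeta>1 y" "supports K \<zeta>2 y" for \<zeta>1 \<zeta>2 y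
  proof -
    obtain \<eta> where \<eta>: "\<eta> \<noteq> 0" "\<And>u. \<eta> \<bullet> u = 0 \<Longrightarrow> u \<in> tangent_vectors A y"
      using hypersurface_tangent[OF S boundary[OF s(1)]] by blast
    have nz: "\<zeta>1 \<noteq> 0" "\<zeta>2 \<noteq> 0" using s by (simp_all add: supports_def)
    obtain a1 where "a1 \<noteq> 0" "\<zeta>1 = a1 *\<^sub>R \<eta>"
      by (rule orthogonal_imp_parallel[OF \<eta>(1) nz(1) supports_tangent[OF s(1) K(2) \<eta>(2)]])
    moreover obtain a2 where "a2 \<noteq> 0" "\<zeta>2 = a2 *\<^sub>R \<eta>"
      by (rule orthogonal_imp_parallel[OF \<eta>(1) nz(2) supports_tangent[OF s(2) K(2) \<eta>(2)]])
    ultimately show ?thesis by (intro exI[of _ "a2 / a1"]) simp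
  qed
  obtain a where a: "a \<noteq> 0" "\<zeta>' = a *\<^sub>R \<zeta>" using par[OF \<zeta>] by blast
  have "a > 0"
  proof (rule ccontr)
    assume "\<not> a > 0"
    then have "a < 0" using a(1) by simp
    have flat: "\<zeta> \<bullet> y = \<zeta> \<bullet> x" if "y \<in> K" for y
    proof -
      have le: "\<zeta>' \<bullet> y \<le> \<zeta>' \<bullet> x" "\<zeta> \<bullet> y \<le> \<zeta> \<bullet> x"
        using \<zeta> that unfolding supports_def by blast+
      from le(1) have "a * (\<zeta> \<bullet> y) \<le> a * (\<zeta> \<bullet> x)" unfolding a(2) by simp
      with le(2) show ?thesis using \<open>a < 0\<close> by (simp add: mult_le_cancel_left)
    qed
    obtain \<eta> where \<eta>: "\<eta> \<noteq> 0" "\<zeta> \<bullet> \<eta> = 0" using orthogonal_vector_exists[OF dim] by blast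
    have "K \<noteq> {}" using \<zeta>(1) by (auto simp: supports_def)
    then have "\<exists>y\<in>K. \<forall>z\<in>K. \<eta> \<bullet> z \<le> \<eta> \<bullet> y"
      by (intro continuous_attains_sup[OF K(1)] linear_continuous_on bounded_linear_inner_right)
    then obtain y where y: "y \<in> K" "\<And>z. z \<in> K \<Longrightarrow> \<eta> \<bullet> z \<le> \<eta> \<bullet> y" by blast
    have "supports K \<eta> y" using y \<eta>(1) by (simp add: supports_def)
    moreover have "\<zeta> \<bullet> z \<le> \<zeta> \<bullet> y" if "z \<in> K" for z
      using flat[OF that] flat[OF y(1)] by linarith
    then have "supports K \<zeta> y" using y(1) \<zeta>(1) unfolding supports_def by blast
    ultimately obtain b where "\<eta> = b *\<^sub>R \<zeta>" using par[of \<zeta> y \<eta>] by blast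
    then have "\<eta> \<bullet> \<eta> = 0" using \<eta>(2) by simp
    then show False using \<eta>(1) by simp
  qed
  then show ?thesis using a(2) by (rule that)
qed

lemma supports_not_interior:
  assumes "supports K \<zeta> x"
  shows "x \<notin> interior K"
proof
  assume "x \<in> interior K"
  then obtain e where e: "e > 0" "ball x e \<subseteq> K" by (auto simp: mem_interior)
  define r where "r = e / (2 * norm \<zeta>)"
  have nz: "norm \<zeta> > 0" using assms by (simp add: supports_def)
  have r: "r > 0" using e(1) nz by (simp add: r_def)
  have "norm (r *\<^sub>R \<zeta>) = e / 2" using nz e(1) by (simp add: r_def)
  then have "x + r *\<^sub>R \<zeta> \<in> ball x e" using e(1) by (simp add: dist_norm)
  then have "x + r *\<^sub>R \<zeta> \<in> K" using e(2) by blast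
  then have "\<zeta> \<bullet> (x + r *\<^sub>R \<zeta>) \<le> \<zeta> \<bullet> x" using assms unfolding supports_def by blast
  then have "r * (\<zeta> \<bullet> \<zeta>) \<le> 0" by (simp add: inner_add_right)
  then show False using mult_pos_pos[OF r, of "\<zeta> \<bullet> \<zeta>"] nz by simp
qed

text \<open>Separate \<open>Q\<close> from exterior points tending to \<open>y\<close> and pass to a
  limit of the unit normals. This also covers sets with empty interior.\<close>

lemma supporting_functional_exists:
  fixes Q :: "'a::euclidean_space set"
  assumes "convex Q" "closed Q" "y \<in> Q" "y \<notin> interior Q"
  obtains \<zeta> where "supports Q \<zeta> y"
proof -
  have "\<exists>z u. dist z y < inverse (real (Suc n)) \<and> norm u = 1 \<and> (\<forall>x\<in>Q. u \<bullet> x \<le> u \<bullet> z)" for n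
  proof -
    have "\<not> ball y (inverse (real (Suc n))) \<subseteq> Q"
      using assms(4) by (metis mem_interior inverse_positive_iff_positive of_nat_0_less_iff zero_less_Suc)
    then obtain z where "z \<in> ball y (inverse (real (Suc n)))" "z \<notin> Q" by blast
    then have z: "dist z y < inverse (real (Suc n))" "z \<notin> Q"
      by (simp_all only: mem_ball dist_commute[of y z] not_False_eq_True)
    obtain a b where ab: "a \<bullet> z < b" "\<forall>x\<in>Q. a \<bullet> x > b"
      using separating_hyperplane_closed_point[OF assms(1,2) z(2)] by blast
    then have "a \<noteq> 0" using assms(3) by auto
    have "(- a /\<^sub>R norm a) \<bullet> x \<le> (- a /\<^sub>R norm a) \<bullet> z" if "x \<in> Q" for x
    proof -
      have "a \<bullet> z \<le> a \<bullet> x" using ab that by force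
      then show ?thesis using \<open>a \<noteq> 0\<close> by (simp add: divide_right_mono)
    qed
    moreover have "norm (- a /\<^sub>R norm a) = 1" using \<open>a \<noteq> 0\<close> by simp
    ultimately show ?thesis using z(1) by blast
  qed
  then obtain z u where z: "\<And>n. dist (z n) y < inverse (real (Suc n))"
    and u: "\<And>n. norm (u n) = 1" "\<And>n x. x \<in> Q \<Longrightarrow> u n \<bullet> x \<le> u n \<bullet> z n" by metis
  have "z \<longlonglongrightarrow> y"
  proof (rule tendsto_dist_iff[THEN iffD2], rule tendsto_sandwich[OF _ _ tendsto_const LIMSEQ_inverse_real_of_nat])
    show "\<forall>\<^sub>F n in sequentially. 0 \<le> dist (z n) y" by simp
    show "\<forall>\<^sub>F n in sequentially. dist (z n) y \<le> inverse (real (Suc n))"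
      by (rule always_eventually) (rule allI, rule less_imp_le, rule z)
  qed
  have "seq_compact (sphere (0::'a) 1)" by (intro compact_imp_seq_compact compact_sphere)
  moreover have "\<forall>n. u n \<in> sphere 0 1" using u(1) by simp
  ultimately obtain l r where l: "l \<in> sphere 0 1" "strict_mono r" "(u \<circ> r) \<longlonglongrightarrow> l"
    by (rule seq_compactE)
  have zr: "(z \<circ> r) \<longlonglongrightarrow> y" by (rule LIMSEQ_subseq_LIMSEQ[OF \<open>z \<longlonglongrightarrow> y\<close> l(2)])
  have "l \<bullet> x \<le> l \<bullet> y" if "x \<in> Q" for x
  proof (rule LIMSEQ_le)
    show "(\<lambda>n. (u \<circ> r) n \<bullet> x) \<longlonglongrightarrow> l \<bullet> x" by (intro tendsto_intros l(3))
    show "(\<lambda>n. (u \<circ> r) n \<bullet> (z \<circ> r) n) \<longlonglongrightarrow> l \<bullet> y" by (intro tendsto_intros l(3) zr)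
    show "\<exists>N. \<forall>n\<ge>N. (u \<circ> r) n \<bullet> x \<le> (u \<circ> r) n \<bullet> (z \<circ> r) n" using u(2)[OF that] by auto
  qed
  then have "supports Q l y" using assms(3) l(1) by (auto simp: supports_def)
  then show ?thesis by (rule that)
qed

section \<open>Regions enclosed by compact sets\<close>

lemma enclosed_region_frontier:
  fixes Q :: "'a::euclidean_space set"
  assumes "compact Q" "convex Q"
  shows "enclosed_region (frontier Q) = Q"
  using inside_frontier_eq_interior[OF compact_imp_bounded[OF assms(1)] assms(2)]
    compact_imp_closed[OF assms(1)] interior_subset[of Q]
  by (auto simp: enclosed_region_def frontier_def)

text \<open>The last fact holds because \<open>inside A\<close> is open, whereas a supporting
  functional is never maximal at an interior point.\<close>

lemma enclosed_region_facts:
  fixes A :: "'a::euclidean_space set"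
  assumes "compact A"
  shows "compact (enclosed_region A)" "outside A = - enclosed_region A" "A \<subseteq> enclosed_region A"
    and "supports (enclosed_region A) \<zeta> x \<Longrightarrow> x \<in> A"
proof -
  show out: "outside A = - enclosed_region A" by (simp add: enclosed_region_def outside_inside)
  have "open (outside A)" by (rule open_outside[OF compact_imp_closed[OF assms]])
  then have "closed (enclosed_region A)" unfolding out by (simp add: closed_def)
  moreover have "bounded (enclosed_region A)"
    unfolding enclosed_region_def using assms by (simp add: bounded_inside compact_imp_bounded)
  ultimately show "compact (enclosed_region A)" by (simp add: compact_eq_bounded_closed)
  show "A \<subseteq> enclosed_region A" by (simp add: enclosed_region_def)
  assume s: "supports (enclosed_region A) \<zeta> x"
  have "inside A \<subseteq> interior (enclosed_region A)"
    by (rule interior_maximal[OF _ open_inside[OF compact_imp_closed[OF assms]]])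
      (simp add: enclosed_region_def)
  then have "x \<notin> inside A" using supports_not_interior[OF s] by blast
  moreover have "x \<in> enclosed_region A" using s by (simp add: supports_def)
  ultimately show "x \<in> A" by (simp add: enclosed_region_def)
qed

context time_only_finsler
begin

subsection \<open>The reachable region\<close>

lemma causal_inner_le:
  assumes causal: "causal_curve_on F {0..T} (\<lambda>t. (t, \<phi> t))" and "0 < T" and xi: "\<xi> \<noteq> 0"
  shows "\<xi> \<bullet> \<phi> T \<le> \<xi> \<bullet> \<phi> 0 + \<xi> \<bullet> disp T \<xi>"
proof -
  define \<gamma> where "\<gamma> = (\<lambda>t. (t, \<phi> t))"
  have reg: "piecewise_smooth_on {0..T} \<gamma>"
    and vel: "\<And>s V. s \<in> {0..T} \<Longrightarrow> one_sided_velocity {0..T} \<gamma> s V \<Longrightarrow> L (\<gamma> s) V \<ge> 0"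
    using causal unfolding causal_curve_on_def regular_curve_on_def \<gamma>_def by blast+
  obtain P where P: "finite P"
    "\<And>c d. 0 \<le> c \<Longrightarrow> c < d \<Longrightarrow> d \<le> T \<Longrightarrow> {c<..<d} \<inter> P = {} \<Longrightarrow> smooth_curve_on {c..d} \<gamma>"
    using piecewise_smooth_onE[OF reg \<open>0 < T\<close> order_refl] by metis
  \<comment> \<open>The lead of the ray over the causal curve in direction \<open>\<xi>\<close>. It
    is nondecreasing on each smooth piece, since the causal velocity lies in the unit ball of the
    metric.\<close>
  define \<psi> where "\<psi> t = \<xi> \<bullet> disp t \<xi> - \<xi> \<bullet> snd (\<gamma> t)" for t
  have "\<psi> 0 \<le> \<psi> T"
  proof (rule piecewise_induct[where R = "\<lambda>c d. \<psi> c \<le> \<psi> d", OF P(1) \<open>0 < T\<close>])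
    fix c d assume cd: "0 \<le> c" "c < d" "d \<le> T" "{c<..<d} \<inter> P = {}"
    obtain g where g: "C1_curve c d \<gamma> g" using smooth_curve_on_imp_C1_curve[OF P(2)[OF cd]] by blast
    have sub: "{c..d} \<subseteq> {0..T}" "{c..d} \<subseteq> {0..}" using cd by auto
    show "\<psi> c \<le> \<psi> d"
    proof (rule DERIV_nonneg_imp_increasing_open[OF less_imp_le[OF cd(2)]])
      have "continuous_on {0..} (\<lambda>t. disp t \<xi>)"
        using has_vector_derivative_continuous[OF disp_has_vector_derivative[OF xi]]
        by (simp add: continuous_on_eq_continuous_within)
      then have "continuous_on {c..d} (\<lambda>t. disp t \<xi>)" using sub(2) by (rule continuous_on_subset)
      then show "continuous_on {c..d} \<psi>"
        unfolding \<psi>_def[abs_def] by (intro continuous_intros C1_curve_continuous_on[OF g])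
    next
      fix t assume t: "c < t" "t < d"
      have gt: "(\<gamma> has_vector_derivative g t) (at t)" by (rule C1_curve_at[OF g t])
      have "((\<lambda>t. fst (\<gamma> t)) has_vector_derivative fst (g t)) (at t)"
        by (rule bounded_linear.has_vector_derivative[OF bounded_linear_fst gt])
      then have g1: "fst (g t) = 1"
        using vector_derivative_unique_at[of "\<lambda>t. t" _ t, OF _ has_vector_derivative_id]
        by (simp add: \<gamma>_def)
      have "one_sided_velocity {0..T} \<gamma> t (g t)"
        by (rule one_sided_velocity_piece[OF sub(1) cd(2)]) (use t g in \<open>auto simp: C1_curve_def\<close>)
      then have "L (\<gamma> t) (g t) \<ge> 0" using t cd by (intro vel) auto
      then have "(F t (\<phi> t) (snd (g t)))\<^sup>2 \<le> 1\<^sup>2" by (simp add: lorentz_finsler_def g1 \<gamma>_def)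
      then have "F t (\<phi> t) (snd (g t)) \<le> 1" by (rule power2_le_imp_le) simp
      then have le: "\<xi> \<bullet> snd (g t) \<le> \<xi> \<bullet> ind t \<xi>" by (rule inner_le_inner_ind[OF xi])
      have "at t within {0..} = at t" by (rule at_within_interior) (use t cd in simp)
      with disp_has_vector_derivative[OF xi, of t] t cd
      have "((\<lambda>t. disp t \<xi>) has_vector_derivative ind t \<xi>) (at t)" by simp
      from bounded_linear.has_vector_derivative[OF bounded_linear_inner_right[of \<xi>] this]
        bounded_linear.has_vector_derivative[OF bounded_linear_inner_right[of \<xi>]
          bounded_linear.has_vector_derivative[OF bounded_linear_snd gt]]
      have "(\<psi> has_real_derivative \<xi> \<bullet> ind t \<xi> - \<xi> \<bullet> snd (g t)) (at t)"
        unfolding \<psi>_def[abs_def] has_real_derivative_iff_has_vector_derivative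
        by (rule has_vector_derivative_diff)
      then show "\<exists>y. (\<psi> has_real_derivative y) (at t) \<and> y \<ge> 0" using le by auto
    qed
  qed linarith
  then show ?thesis by (simp add: \<psi>_def \<gamma>_def disp_0)
qed

text \<open>The set of displacements possible up to time \<open>t\<close>; its support function is \<open>\<zeta> \<mapsto> \<zeta> \<bullet> disp t \<zeta>\<close>.\<close>

definition displacements :: "real \<Rightarrow> (real ^ 'n) set" where
  "displacements t = {d. \<forall>\<zeta>. \<zeta> \<noteq> 0 \<longrightarrow> \<zeta> \<bullet> d \<le> \<zeta> \<bullet> disp t \<zeta>}"

definition reachable :: "(real ^ 'n) set \<Rightarrow> real \<Rightarrow> (real ^ 'n) set" where
  "reachable K t = {x + d | x d. x \<in> K \<and> d \<in> displacements t}"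

lemma displacements_inner: "d \<in> displacements t \<Longrightarrow> \<zeta> \<noteq> 0 \<Longrightarrow> \<zeta> \<bullet> d \<le> \<zeta> \<bullet> disp t \<zeta>"
  by (simp add: displacements_def)

lemma disp_in_displacements: "\<xi> \<noteq> 0 \<Longrightarrow> disp t \<xi> \<in> displacements t"
  by (simp add: displacements_def inner_disp_le)

lemma displacements_eq: "displacements t = (\<Inter>\<zeta>\<in>- {0}. {d. \<zeta> \<bullet> d \<le> \<zeta> \<bullet> disp t \<zeta>})"
  by (auto simp: displacements_def)

lemma convex_displacements: "convex (displacements t)"
  unfolding displacements_eq by (intro convex_INT convex_halfspace_le)

lemma compact_displacements: "compact (displacements t)"
proof -
  have "closed (displacements t)"
    unfolding displacements_eq by (intro closed_INT ballI closed_halfspace_le)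
  moreover have "bounded (displacements t)"
  proof (rule boundedI)
    fix d assume d: "d \<in> displacements t"
    \<comment> \<open>The constraints for \<open>b\<close> and \<open>- b\<close> bound each
      coordinate from both sides.\<close>
    have "\<bar>d \<bullet> b\<bar> \<le> \<bar>b \<bullet> disp t b\<bar> + \<bar>(- b) \<bullet> disp t (- b)\<bar>" if "b \<in> Basis" for b
    proof -
      have "b \<bullet> d \<le> b \<bullet> disp t b" "(- b) \<bullet> d \<le> (- b) \<bullet> disp t (- b)"
        by (rule displacements_inner[OF d]; use that in \<open>simp add: nonzero_Basis\<close>)+
      then show ?thesis by (simp add: inner_commute) 
    qed
    then have "(\<Sum>b\<in>Basis. \<bar>d \<bullet> b\<bar>) \<le> (\<Sum>b\<in>Basis. \<bar>b \<bullet> disp t b\<bar> + \<bar>(- b) \<bullet> disp t (- b)\<bar>)"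
      by (rule sum_mono)
    then show "norm d \<le> (\<Sum>b\<in>Basis. \<bar>b \<bullet> disp t b\<bar> + \<bar>(- b) \<bullet> disp t (- b)\<bar>)"
      using norm_le_l1[of d] by linarith
  qed
  ultimately show ?thesis by (simp add: compact_eq_bounded_closed)
qed

text \<open>The support function is differentiable at \<open>\<zeta>\<close> with gradient \<open>disp t \<zeta>\<close>.\<close>

lemma displacements_maximal:
  assumes d: "d \<in> displacements t" and \<zeta>: "\<zeta> \<noteq> 0" "\<zeta> \<bullet> d = \<zeta> \<bullet> disp t \<zeta>"
  shows "d = disp t \<zeta>"
proof -
  have le: "u \<bullet> d \<le> u \<bullet> disp t \<zeta>" for u
  proof -
    have ev: "\<forall>\<^sub>F \<epsilon> in at_right 0. \<zeta> + \<epsilon> *\<^sub>R u \<noteq> 0 \<and> \<epsilon> > (0::real)"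
    proof (rule eventually_conj)
      have "\<forall>\<^sub>F \<epsilon> in at (0::real). \<zeta> + \<epsilon> *\<^sub>R u \<noteq> 0"
        using eventually_shift_nonzero[OF \<zeta>(1), of u] by (simp add: eventually_at_filter eventually_mono)
      then show "\<forall>\<^sub>F \<epsilon> in at_right 0. \<zeta> + \<epsilon> *\<^sub>R u \<noteq> 0"
        by (rule filter_leD[OF at_le[OF subset_UNIV]])
      show "\<forall>\<^sub>F \<epsilon> in at_right 0. \<epsilon> > (0::real)" by (rule eventually_at_right_less)
    qed
    have "((\<lambda>\<epsilon>. \<zeta> + \<epsilon> *\<^sub>R u) \<longlongrightarrow> \<zeta> + 0 *\<^sub>R u) (at_right (0::real))" by (intro tendsto_intros)
    moreover have "isCont (disp t) \<zeta>"
      using continuous_on_disp[of t] \<zeta>(1) by (simp add: continuous_on_eq_continuous_at open_Compl)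
    ultimately have "((\<lambda>\<epsilon>. disp t (\<zeta> + \<epsilon> *\<^sub>R u)) \<longlongrightarrow> disp t \<zeta>) (at_right 0)"
      using isCont_tendsto_compose[of \<zeta> "disp t"] by simp
    then have lim: "((\<lambda>\<epsilon>. u \<bullet> disp t (\<zeta> + \<epsilon> *\<^sub>R u)) \<longlongrightarrow> u \<bullet> disp t \<zeta>) (at_right 0)"
      by (intro tendsto_intros)
    show ?thesis
    proof (rule tendsto_lowerbound[OF lim])
      show "\<forall>\<^sub>F \<epsilon> in at_right 0. u \<bullet> d \<le> u \<bullet> disp t (\<zeta> + \<epsilon> *\<^sub>R u)"
      proof (rule eventually_mono[OF ev])
        fix \<epsilon> :: real assume \<epsilon>: "\<zeta> + \<epsilon> *\<^sub>R u \<noteq> 0 \<and> \<epsilon> > 0"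
        \<comment> \<open>\<open>d\<close> is maximal for \<open>\<zeta>\<close> and
          \<open>?p\<close> for the perturbed functional. Combining the two comparisons cancels the
          \<open>\<zeta>\<close> terms and leaves only direction \<open>u\<close>.\<close>
        let ?p = "disp t (\<zeta> + \<epsilon> *\<^sub>R u)"
        have "(\<zeta> + \<epsilon> *\<^sub>R u) \<bullet> d \<le> (\<zeta> + \<epsilon> *\<^sub>R u) \<bullet> ?p" using displacements_inner[OF d] \<epsilon> by blast
        moreover have "\<zeta> \<bullet> ?p \<le> \<zeta> \<bullet> disp t \<zeta>" using inner_disp_le[OF _ \<zeta>(1)] \<epsilon> by blast
        ultimately have "\<epsilon> * (u \<bullet> d) \<le> \<epsilon> * (u \<bullet> ?p)" using \<zeta>(2) by (simp add: inner_add_left)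
        then show "u \<bullet> d \<le> u \<bullet> ?p" using \<epsilon> by simp
      qed
    qed simp
  qed
  \<comment> \<open>Testing the inequality in the direction of the difference itself forces the
    difference to vanish.\<close>
  have "(d - disp t \<zeta>) \<bullet> (d - disp t \<zeta>) \<le> 0" using le[of "d - disp t \<zeta>"] by (simp add: inner_diff_right)
  then have "(d - disp t \<zeta>) \<bullet> (d - disp t \<zeta>) = 0" by (rule order_antisym[OF _ inner_ge_zero])
  then show ?thesis by simp
qed

section \<open>Convexity and boundary of the Minkowski sum\<close>

lemma convex_reachable: "convex K \<Longrightarrow> convex (reachable K t)"
proof -
  assume "convex K"
  have "reachable K t = (\<Union>x\<in>K. \<Union>y\<in>displacements t. {x + y})" by (auto simp: reachable_def)
  then show ?thesis using convex_sums[OF \<open>convex K\<close> convex_displacements] by simp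
qed

lemma compact_reachable: "compact K \<Longrightarrow> compact (reachable K t)"
  unfolding reachable_def by (rule compact_sums[OF _ compact_displacements])

lemma supports_reachable:
  assumes "supports K \<xi> x"
  shows "supports (reachable K t) \<xi> (x + disp t \<xi>)"
proof -
  have xi: "\<xi> \<noteq> 0" "x \<in> K" and le: "\<And>y. y \<in> K \<Longrightarrow> \<xi> \<bullet> y \<le> \<xi> \<bullet> x" using assms by (auto simp: supports_def)
  have "\<xi> \<bullet> q \<le> \<xi> \<bullet> (x + disp t \<xi>)" if reach: "q \<in> reachable K t" for q
  proof -
    obtain y d where q: "q = y + d" "y \<in> K" "d \<in> displacements t" using reach by (auto simp: reachable_def)
    show ?thesis using le[OF q(2)] displacements_inner[OF q(3) xi(1)] by (simp add: q(1) inner_add_right)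
  qed
  moreover have "x + disp t \<xi> \<in> reachable K t"
    using xi disp_in_displacements[OF xi(1)] by (auto simp: reachable_def)
  ultimately show ?thesis using xi by (simp add: supports_def)
qed

text \<open>A functional maximal on a sum is maximal on each summand, and its maximum point in
  \<open>displacements t\<close> is unique.\<close>

lemma supports_reachable_iff:
  assumes "supports (reachable K t) \<zeta> y"
  obtains x where "supports K \<zeta> x" "y = x + disp t \<zeta>"
proof -
  have \<zeta>: "\<zeta> \<noteq> 0" "y \<in> reachable K t"
    and max: "\<And>q. q \<in> reachable K t \<Longrightarrow> \<zeta> \<bullet> q \<le> \<zeta> \<bullet> y" using assms by (auto simp: supports_def)
  obtain x d where y: "y = x + d" "x \<in> K" "d \<in> displacements t" using \<zeta>(2) by (auto simp: reachable_def)
  have le: "\<zeta> \<bullet> k + \<zeta> \<bullet> disp t \<zeta> \<le> \<zeta> \<bullet> x + \<zeta> \<bullet> d" if "k \<in> K" for k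
  proof -
    have "k + disp t \<zeta> \<in> reachable K t"
      using that disp_in_displacements[OF \<zeta>(1)] by (auto simp: reachable_def)
    from max[OF this] show ?thesis by (simp add: y(1) inner_add_right)
  qed
  have d: "\<zeta> \<bullet> d \<le> \<zeta> \<bullet> disp t \<zeta>" by (rule displacements_inner[OF y(3) \<zeta>(1)])
  have "d = disp t \<zeta>" by (rule displacements_maximal[OF y(3) \<zeta>(1)]) (use le[OF y(2)] d in linarith)
  moreover have "supports K \<zeta> x" using le d \<zeta>(1) y(2) unfolding supports_def by force
  ultimately show ?thesis using that y(1) by blast
qed

lemma frontier_reachable:
  assumes "compact K" "convex K"
  shows "frontier (reachable K t) = {x + disp t \<xi> | x \<xi>. supports K \<xi> x}"
proof (intro equalityI subsetI)
  have closed: "closed (reachable K t)" by (rule compact_imp_closed[OF compact_reachable[OF assms(1)]])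
  fix y
  {
    assume "y \<in> frontier (reachable K t)"
    then have "y \<in> reachable K t" "y \<notin> interior (reachable K t)" using closed by (auto simp: frontier_def)
    then obtain \<zeta> where "supports (reachable K t) \<zeta> y"
      by (rule supporting_functional_exists[OF convex_reachable[OF assms(2)] closed])
    then obtain x where "supports K \<zeta> x" "y = x + disp t \<zeta>" by (rule supports_reachable_iff)
    then show "y \<in> {x + disp t \<xi> | x \<xi>. supports K \<xi> x}" by blast
  next
    assume "y \<in> {x + disp t \<xi> | x \<xi>. supports K \<xi> x}"
    then obtain x \<xi> where "y = x + disp t \<xi>" "supports K \<xi> x" by blast
    then have "supports (reachable K t) \<xi> y" using supports_reachable by blast
    then have "y \<in> reachable K t" "y \<notin> interior (reachable K t)"
      using supports_not_interior by (auto simp: supports_def)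
    then show "y \<in> frontier (reachable K t)" using closed by (simp add: frontier_def)
  }
qed

text \<open>If a point of the segment were not interior, a supporting functional there would be
  constant on the segment. Both ends then share the displacement \<open>disp t \<zeta>\<close>, so
  they come from distinct maximum points in \<open>K\<close>. A singleton has none, and strict
  convexity makes their midpoint interior.\<close>

lemma strictly_convex_reachable:
  assumes "compact K" "convex K" and strict: "strictly_convex K \<or> (\<exists>p. K = {p})"
  shows "strictly_convex (reachable K t)"
  unfolding strictly_convex_def
proof (intro ballI impI subsetI)
  fix y z e assume yz: "y \<in> reachable K t" "z \<in> reachable K t" "y \<noteq> z" and e: "e \<in> open_segment y z"
  have conv: "convex (reachable K t)" by (rule convex_reachable[OF assms(2)])
  show "e \<in> interior (reachable K t)"
  proof (rule ccontr)
    assume not_int: "e \<notin> interior (reachable K t)"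
    obtain s where s: "0 < s" "s < 1" "e = (1 - s) *\<^sub>R y + s *\<^sub>R z" using e by (auto simp: in_segment)
    have "e \<in> reachable K t" unfolding s(3) by (rule convexD[OF conv yz(1,2)]) (use s in auto)
    from supporting_functional_exists[OF conv compact_imp_closed[OF compact_reachable[OF assms(1)]] this not_int]
    obtain \<zeta> where supp: "supports (reachable K t) \<zeta> e" .
    then have le: "\<zeta> \<bullet> y \<le> \<zeta> \<bullet> e" "\<zeta> \<bullet> z \<le> \<zeta> \<bullet> e" using yz by (simp_all add: supports_def)
    have comb: "(1 - s) * (\<zeta> \<bullet> e - \<zeta> \<bullet> y) + s * (\<zeta> \<bullet> e - \<zeta> \<bullet> z) = 0"
    proof -
      have "\<zeta> \<bullet> e = (1 - s) * (\<zeta> \<bullet> y) + s * (\<zeta> \<bullet> z)" by (simp add: s(3) inner_add_right)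
      then show ?thesis by (simp add: algebra_simps)
    qed
    have "(1 - s) * (\<zeta> \<bullet> e - \<zeta> \<bullet> y) \<ge> 0" "s * (\<zeta> \<bullet> e - \<zeta> \<bullet> z) \<ge> 0" using le s by simp_all
    then have "(1 - s) * (\<zeta> \<bullet> e - \<zeta> \<bullet> y) = 0" "s * (\<zeta> \<bullet> e - \<zeta> \<bullet> z) = 0" using comb by linarith+
    then have eq: "\<zeta> \<bullet> y = \<zeta> \<bullet> e" "\<zeta> \<bullet> z = \<zeta> \<bullet> e" using s by simp_all
    have "supports (reachable K t) \<zeta> y" "supports (reachable K t) \<zeta> z"
      using supp yz eq by (simp_all add: supports_def)
    then obtain y' z' where y': "supports K \<zeta> y'" "y = y' + disp t \<zeta>" and z': "supports K \<zeta> z'" "z = z' + disp t \<zeta>"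
      using supports_reachable_iff by metis
    then have ne: "y' \<noteq> z'" and inK: "y' \<in> K" "z' \<in> K" using yz(3) by (auto simp: supports_def)
    then have "strictly_convex K" using strict by auto
    then have "open_segment y' z' \<subseteq> interior K" using ne inK by (simp add: strictly_convex_def)
    moreover have "midpoint y' z' \<in> open_segment y' z'" using ne by simp
    ultimately have mid: "midpoint y' z' \<in> interior K" by blast
    have "\<zeta> \<bullet> y' = \<zeta> \<bullet> z'" using y'(1) z'(1) by (auto simp: supports_def intro: order_antisym)
    then have "\<zeta> \<bullet> midpoint y' z' = \<zeta> \<bullet> y'" by (simp add: midpoint_def inner_add_right)
    then have "supports K \<zeta> (midpoint y' z')"
      using y'(1) mid interior_subset[of K] by (auto simp: supports_def)
    then show False using supports_not_interior mid by blast
  qed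
qed

end

subsection \<open>Wavefronts\<close>

lemma strictly_convex_imp_convex: "strictly_convex K \<Longrightarrow> convex K"
  unfolding convex_contains_open_segment strictly_convex_def
  by (metis empty_subsetI interior_subset open_segment_idem order_trans)

locale wave = time_only_finsler F for F :: "real \<Rightarrow> real ^ 'n \<Rightarrow> real ^ 'n \<Rightarrow> real" +
  fixes A :: "(real ^ 'n) set"
  assumes dim: "CARD('n) \<ge> 2"
    and source: "(compact A \<and> embedded_hypersurface A) \<or> (\<exists>p. A = {p})"
    and convex_source: "convex (enclosed_region A)"
begin

abbreviation "K \<equiv> enclosed_region A"

lemma compact_A: "compact A"
  using source by auto

lemmas K_facts = enclosed_region_facts[OF compact_A]

text \<open>Every supporting covector generates a trajectory; the parameter is the initial velocity
  at a point source and the initial point otherwise.\<close>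

lemma trajectory_exists:
  assumes "supports K \<xi> x"
  shows "wave_trajectory F A (if \<exists>p. A = {p} then ind 0 \<xi> else x) (\<lambda>t. x + disp t \<xi>)"
  unfolding wave_trajectory_def
proof (intro conjI exI[of _ "ind 0 \<xi>"])
  have xi: "\<xi> \<noteq> 0" using assms by (simp add: supports_def)
  show "lightlike_curve_on F {0..} (\<lambda>t. (t, x + disp t \<xi>))" by (rule lightlike_ray[OF xi])
  show "pregeodesic_on L {0..} (\<lambda>t. (t, x + disp t \<xi>))" by (rule pregeodesic_ray[OF xi])
  show "x + disp 0 \<xi> \<in> A" using K_facts(4)[OF assms] by (simp add: disp_0)
  have "((\<lambda>t. x + disp t \<xi>) has_vector_derivative 0 + ind 0 \<xi>) (at 0 within {0..})"
    by (intro has_vector_derivative_add has_vector_derivative_const disp_has_vector_derivative[OF xi]) simp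
  then show "((\<lambda>t. x + disp t \<xi>) has_vector_derivative ind 0 \<xi>) (at 0 within {0..})" by simp
  have G: "G (0, ind 0 \<xi>) = inverse (F 0 0 (vel 0 \<xi>)) *\<^sub>R \<xi>"
    using G_scale[of "inverse (F 0 0 (vel 0 \<xi>))" "vel 0 \<xi>" 0] F_vel_pos[OF xi, of 0 0]
    by (simp add: ind_def vel_nonzero G_vel xi)
  show "finsler_orthogonal (F 0) A (x + disp 0 \<xi>) (ind 0 \<xi>)"
    unfolding finsler_orthogonal_def disp_0 add_0_right fundamental_tensor_self[OF ind_nonzero[OF xi]] G
    using ind_nonzero[OF xi] supports_tangent[OF assms K_facts(3)] by simp
  \<comment> \<open>The functional \<open>\<xi>\<close> strictly increases along
    \<open>ind 0 \<xi>\<close>, so the ray leaves \<open>K\<close> at once.\<close>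
  have "x + \<epsilon> *\<^sub>R ind 0 \<xi> \<in> outside A" if "\<epsilon> > 0" for \<epsilon>
  proof -
    have "\<xi> \<bullet> (x + \<epsilon> *\<^sub>R ind 0 \<xi>) > \<xi> \<bullet> x"
      using that inner_ind[OF xi, of 0] F_vel_pos[OF xi, of 0 0] by (simp add: inner_add_right)
    then have "x + \<epsilon> *\<^sub>R ind 0 \<xi> \<notin> K" using assms unfolding supports_def by force
    then show ?thesis by (simp add: K_facts(2))
  qed
  then show "points_outward A (x + disp 0 \<xi>) (ind 0 \<xi>)"
    unfolding points_outward_def disp_0 add_0_right
    by (intro eventually_mono[OF eventually_at_right_less]) 
  show "(if \<exists>p. A = {p} then ind 0 \<xi> else x) = (if \<exists>p. A = {p} then ind 0 \<xi> else x + disp 0 \<xi>)"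
    by (simp add: disp_0)
qed

text \<open>At a point source every nonzero covector supports \<open>K\<close>. At a hypersurface,
  orthogonality and outwardness together make the initial momentum a supporting covector.\<close>

lemma trajectory_form:
  assumes "wave_trajectory F A z c"
  obtains \<xi> where "supports K \<xi> (c 0)" "\<And>t. t \<ge> 0 \<Longrightarrow> c t = c 0 + disp t \<xi>"
    "if \<exists>p. A = {p} then \<xi> = G (0, z) else z = c 0"
proof -
  obtain v where light: "lightlike_curve_on F {0..} (\<lambda>t. (t, c t))"
    and geo: "pregeodesic_on L {0..} (\<lambda>t. (t, c t))" and c0: "c 0 \<in> A"
    and v: "(c has_vector_derivative v) (at 0 within {0..})"
    and orth: "finsler_orthogonal (F 0) A (c 0) v" and out: "points_outward A (c 0) v"
    and z: "z = (if \<exists>p. A = {p} then v else c 0)"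
    using assms unfolding wave_trajectory_def by blast
  note form = lightlike_pregeodesic_eq[OF light geo v]
  have "v \<noteq> 0" using form[of 0] by simp
  have "supports K (G (0, v)) (c 0)"
  proof (cases "\<exists>p. A = {p}")
    case True
    then have "K = {c 0}" using c0 by (auto simp: enclosed_region_def)
    then show ?thesis using G_nonzero[OF \<open>v \<noteq> 0\<close>] by (simp add: supports_def)
  next
    case False
    then have hyp: "embedded_hypersurface A" using source by blast
    obtain \<eta> where \<eta>: "\<eta> \<noteq> 0" "\<And>u. \<eta> \<bullet> u = 0 \<Longrightarrow> u \<in> tangent_vectors A (c 0)"
      using hypersurface_tangent[OF hyp c0] by blast
    have ev: "\<forall>\<^sub>F \<epsilon> in at_right 0. c 0 + \<epsilon> *\<^sub>R v \<notin> K"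
      using out unfolding points_outward_def K_facts(2) by simp
    have pos: "G (0, v) \<bullet> v > 0" using G_euler[OF \<open>v \<noteq> 0\<close>, of 0] E_pos[OF \<open>v \<noteq> 0\<close>, of 0] by simp
    have tan: "G (0, v) \<bullet> u = 0" if "u \<in> tangent_vectors A (c 0)" for u
      using orth that unfolding finsler_orthogonal_def fundamental_tensor_self[OF \<open>v \<noteq> 0\<close>] by blast
    show ?thesis
      by (rule outward_normal_supports[OF convex_source K_facts(3) c0 \<eta>(1) _ ev pos])
        (erule \<eta>(2), erule tan)
  qed
  moreover have "c t = c 0 + disp t (G (0, v))" if "t \<ge> 0" for t using form[OF that] by blast
  moreover have "if \<exists>p. A = {p} then G (0, v) = G (0, z) else z = c 0" using z by auto
  ultimately show ?thesis by (rule that)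
qed

text \<open>For a hypersurface the parameter records only the initial point, so uniqueness rests on
  the supporting direction there being unique up to a positive factor. This justifies the definite
  description in \<open>wavemap\<close>.\<close>

lemma trajectory_unique:
  assumes "wave_trajectory F A z c" "wave_trajectory F A z c'" "t \<ge> 0"
  shows "c t = c' t"
proof -
  obtain \<xi> where \<xi>: "supports K \<xi> (c 0)" "\<And>t. t \<ge> 0 \<Longrightarrow> c t = c 0 + disp t \<xi>"
    "if \<exists>p. A = {p} then \<xi> = G (0, z) else z = c 0" by (rule trajectory_form[OF assms(1)]) blast
  obtain \<xi>' where \<xi>': "supports K \<xi>' (c' 0)" "\<And>t. t \<ge> 0 \<Longrightarrow> c' t = c' 0 + disp t \<xi>'"
    "if \<exists>p. A = {p} then \<xi>' = G (0, z) else z = c' 0" by (rule trajectory_form[OF assms(2)]) blast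
  have A: "c 0 \<in> A" "c' 0 \<in> A" using \<xi>(1) \<xi>'(1) K_facts(4) by blast+
  have "c 0 = c' 0 \<and> disp t \<xi> = disp t \<xi>'"
  proof (cases "\<exists>p. A = {p}")
    case True
    then show ?thesis using A \<xi>(3) \<xi>'(3) by auto
  next
    case False
    then have eq: "c 0 = c' 0" using \<xi>(3) \<xi>'(3) by simp
    have hyp: "embedded_hypersurface A" using False source by blast
    have dim': "DIM(real ^ 'n) \<ge> 2" using dim by simp
    obtain a where "a > 0" "\<xi>' = a *\<^sub>R \<xi>"
      by (rule hypersurface_normal_unique[OF dim' hyp K_facts(1,3) _ \<xi>(1) \<xi>'(1)[folded eq]])
        (erule K_facts(4))
    moreover have "\<xi> \<noteq> 0" using \<xi>(1) by (simp add: supports_def)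
    ultimately show ?thesis using eq disp_scale by simp
  qed
  then show ?thesis using \<xi>(2)[OF assms(3)] \<xi>'(2)[OF assms(3)] by argo
qed

lemma wavemap_eq:
  assumes "wave_trajectory F A z c" "t \<ge> 0"
  shows "wavemap F A t z = c t"
  unfolding wavemap_def
proof (rule the_equality)
  show "\<exists>c'. wave_trajectory F A z c' \<and> c t = c' t" using assms(1) by blast
  fix y assume "\<exists>c'. wave_trajectory F A z c' \<and> y = c' t"
  then show "y = c t" using trajectory_unique[OF _ assms] by blast
qed

lemma trajectory_time_minimizing:
  assumes "supports K \<xi> x" and c: "\<And>t. t \<ge> 0 \<Longrightarrow> c t = x + disp t \<xi>"
  shows "time_minimizing F A c \<tau>"
  unfolding time_minimizing_def
proof (intro allI impI)
  fix t0 t1 \<phi>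
  assume "0 < t0 \<and> t0 \<le> \<tau> \<and> 0 < t1 \<and> causal_curve_on F {0..t1} (\<lambda>t. (t, \<phi> t)) \<and>
    \<phi> 0 \<in> A \<and> \<phi> t1 = c t0"
  then have t: "0 < t0" "0 < t1" and causal: "causal_curve_on F {0..t1} (\<lambda>t. (t, \<phi> t))"
    and \<phi>: "\<phi> 0 \<in> A" "\<phi> t1 = c t0" by blast+
  have xi: "\<xi> \<noteq> 0" using assms(1) by (simp add: supports_def)
  have "\<phi> t1 = x + disp t0 \<xi>" using \<phi>(2) c[of t0] t by simp
  then have "\<xi> \<bullet> x + \<xi> \<bullet> disp t0 \<xi> \<le> \<xi> \<bullet> \<phi> 0 + \<xi> \<bullet> disp t1 \<xi>"
    using causal_inner_le[OF causal t(2) xi] by (simp add: inner_add_right)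
  moreover have "\<xi> \<bullet> \<phi> 0 \<le> \<xi> \<bullet> x" using assms(1) \<phi>(1) K_facts(3) unfolding supports_def by blast
  ultimately have "\<xi> \<bullet> disp t0 \<xi> \<le> \<xi> \<bullet> disp t1 \<xi>" by linarith
  then show "t0 \<le> t1" using inner_disp_strict_mono[OF xi, of t1 t0] t by (meson less_imp_le linorder_not_le)
qed

lemma wavefront_eq:
  assumes "t > 0"
  shows "wavefront F A t = frontier (reachable K t)"
  unfolding frontier_reachable[OF K_facts(1) convex_source]
proof (intro equalityI subsetI)
  fix y assume "y \<in> wavefront F A t"
  then obtain z where "y = wavemap F A t z" "z \<in> wave_parameters F A"
    using assms by (auto simp: wavefront_def)
  then obtain c where c: "wave_trajectory F A z c" "y = c t"
    using wavemap_eq assms by (auto simp: wave_parameters_def)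
  obtain \<xi> where "supports K \<xi> (c 0)" "\<And>t. t \<ge> 0 \<Longrightarrow> c t = c 0 + disp t \<xi>"
    by (rule trajectory_form[OF c(1)]) blast
  then show "y \<in> {x + disp t \<xi> | x \<xi>. supports K \<xi> x}" using c(2) assms less_imp_le by blast
next
  fix y assume "y \<in> {x + disp t \<xi> | x \<xi>. supports K \<xi> x}"
  then obtain x \<xi> where y: "y = x + disp t \<xi>" and supp: "supports K \<xi> x" by blast
  obtain z where z: "wave_trajectory F A z (\<lambda>t. x + disp t \<xi>)" using trajectory_exists[OF supp] by blast
  have map: "wavemap F A s z = x + disp s \<xi>" if "s \<ge> 0" for s by (rule wavemap_eq[OF z that])
  have "z \<in> wave_parameters F A" using z by (auto simp: wave_parameters_def)
  moreover have "time_minimizing F A (\<lambda>t. wavemap F A t z) t"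
    by (rule trajectory_time_minimizing[OF supp map])
  moreover have "y = wavemap F A t z" using map[of t] y assms by simp
  ultimately show "y \<in> wavefront F A t" using assms unfolding wavefront_def by auto
qed

lemma enclosed_region_wavefront:
  assumes "t > 0"
  shows "enclosed_region (wavefront F A t) = reachable K t"
  unfolding wavefront_eq[OF assms]
  by (rule enclosed_region_frontier[OF compact_reachable[OF K_facts(1)] convex_reachable[OF convex_source]])

end

theorem theorem3p3:
  fixes F :: "real \<Rightarrow> real ^ 'n \<Rightarrow> real ^ 'n \<Rightarrow> real"
    and A :: "(real ^ 'n) set"
  assumes "CARD('n) \<ge> 2"
    and "time_dependent_finsler_metric F"
    and "time_only_dependent F"
    and "standing_bounds F"
    and "(compact A \<and> embedded_hypersurface A) \<or> (\<exists>p. A = {p})"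
  shows "(strictly_convex_front A \<or> (\<exists>p. A = {p}) \<longrightarrow>
            (\<forall>t>0. strictly_convex_front (wavefront F A t))) \<and>
         (convex_front A \<longrightarrow> (\<forall>t>0. convex_front (wavefront F A t)))"
proof (intro conjI impI allI)
  fix t :: real
  assume strict: "strictly_convex_front A \<or> (\<exists>p. A = {p})" and "t > 0"
  have region: "strictly_convex (enclosed_region A) \<or> (\<exists>p. enclosed_region A = {p})"
    using strict by (auto simp: strictly_convex_front_def enclosed_region_def)
  then have "convex (enclosed_region A)" using strictly_convex_imp_convex by auto
  then interpret wave F A using assms by unfold_locales
  show "strictly_convex_front (wavefront F A t)"
    unfolding strictly_convex_front_def enclosed_region_wavefront[OF \<open>t > 0\<close>]
    by (rule strictly_convex_reachable[OF K_facts(1) convex_source region])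
next
  fix t :: real
  assume "convex_front A" "t > 0"
  then interpret wave F A using assms by unfold_locales (simp_all add: convex_front_def)
  show "convex_front (wavefront F A t)"
    unfolding convex_front_def enclosed_region_wavefront[OF \<open>t > 0\<close>]
    by (rule convex_reachable[OF convex_source])
qed

end
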